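(* Let $n = 1 / C(\mu) = 2^{o(d)}$, let $c>1$ and $\gamma^* = 1 - 1/c^2$ be the inner product between the query and the planted nearest neighbor, and let $\alpha = \kappa \cdot \mu$ with constant $\kappa \in \left(\sqrt{(\gamma^* )^2/ (1 + (\gamma^* )^2)},\, 1\right)$. Using the $\alpha$-near neighbor graph, with high probability one can solve the sparse near neighbor problem in several iterations with complexities $$\texttt{Time} = n^{\frac{1 - 2 \gamma^* \sqrt{\kappa^2 (1 - \kappa^2)}}{1 - (\gamma^* )^2} + o(1)},\quad \texttt{Space} = n^{2 - \kappa^2 + o(1)},\quad \texttt{Insert} = n^{1 + o(1)},\quad \texttt{Delete} = n^{1 - \kappa^2 + o(1)}.$$ Writing $\texttt{Time} = n^{\rho_{\mathrm{q}} + o(1)}$ and $\texttt{Space} = n^{1 + \rho_{\mathrm{s}} + o(1)}$, the achieved exponents satisfy $$(2c^2 - 1) \rho_{\mathrm{q}} + 2 c^2 (c^2 - 1) \sqrt{\rho_{\mathrm{s}} (1 - \rho_{\mathrm{s}})} \geq c^4.$$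
   Context: $\mathcal{S}^{d-1}$ is the Euclidean unit sphere in $\mathbb{R}^d$; $C(\alpha)=\Pr_{X\sim\mathcal{U}(\mathcal{S}^{d-1})}(X_1>\alpha)$ is the relative volume of a spherical cap of height $\alpha$; $\mu=\sqrt{1-n^{-2/d}}$ (so $n\approx1/C(\mu)$ up to polynomial factors in $d$, and $\mu=o(1)$ when $n=2^{o(d)}$). Sparse near neighbor problem: data set $\mathcal{D}\subset\mathcal{S}^{d-1}$ of $n=2^{o(d)}$ points, independent uniform on the sphere except a planted point $p^*$ with $\langle p^*,q\rangle=\gamma^*$ for the query $q$ (uniform on the cap $\{u:\langle u,q\rangle\ge\gamma^*\}$); the goal is to find $p^*$. The $\alpha$-near neighbor graph has vertex set $\mathcal{D}$ and an edge between $p,p'$ iff $\langle p,p'\rangle\ge\alpha$, with neighbor lists $\mathcal{B}(p)$. Queries: start at a uniformly random vertex $p$, repeatedly move to some $p'\in\mathcal{B}(p)$ with $\langle p',q\rangle\ge\langle p,q\rangle+1/d$ until $\langle p,q\rangle\ge\gamma^*$, restarting at a fresh uniformly random vertex (a new "iteration") whenever no such $p'$ exists. Insert compares a new point to all points of $\mathcal{D}$ and adds the edges; Delete removes the point from the neighbor lists of its neighbors. Asymptotics as $d\to\infty$. *)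

theory Defs
  imports "HOL-Probability.Probability"
begin

definition ip :: "nat \<Rightarrow> (nat \<Rightarrow> real) \<Rightarrow> (nat \<Rightarrow> real) \<Rightarrow> real" where
  "ip d x y = (\<Sum>i<d. x i * y i)"

definition Rd :: "nat \<Rightarrow> (nat \<Rightarrow> real) measure" where
  "Rd d = PiM {..<d} (\<lambda>_. lborel)"

definition sphere_d :: "nat \<Rightarrow> (nat \<Rightarrow> real) set" where
  "sphere_d d = {x \<in> space (Rd d). ip d x x = 1}"

text \<open>Uniform (normalised surface / cone) measure on the sphere: the radial
  projection of the uniform distribution on the unit ball.\<close>
definition unif_sphere :: "nat \<Rightarrow> (nat \<Rightarrow> real) measure" where
  "unif_sphere d =
     distr (uniform_measure (Rd d) {x \<in> space (Rd d). ip d x x \<le> 1}) (Rd d)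
       (\<lambda>x. restrict (\<lambda>i. x i / sqrt (ip d x x)) {..<d})"

definition cap_unif :: "nat \<Rightarrow> (nat \<Rightarrow> real) \<Rightarrow> real \<Rightarrow> (nat \<Rightarrow> real) measure" where
  "cap_unif d q g = uniform_measure (unif_sphere d) {x \<in> space (unif_sphere d). g \<le> ip d x q}"

definition nbrs :: "nat \<Rightarrow> real \<Rightarrow> nat \<Rightarrow> (nat \<Rightarrow> nat \<Rightarrow> real) \<Rightarrow> nat \<Rightarrow> nat set" where
  "nbrs d \<alpha> n P i = {j. j < n \<and> j \<noteq> i \<and> \<alpha> \<le> ip d (P i) (P j)}"

definition impr :: "nat \<Rightarrow> real \<Rightarrow> nat \<Rightarrow> (nat \<Rightarrow> nat \<Rightarrow> real) \<Rightarrow> (nat \<Rightarrow> real) \<Rightarrow> nat \<Rightarrow> nat set" where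
  "impr d \<alpha> n P q i = {j \<in> nbrs d \<alpha> n P i. ip d (P i) q + 1 / real d \<le> ip d (P j) q}"

definition greedy_next :: "nat \<Rightarrow> real \<Rightarrow> nat \<Rightarrow> (nat \<Rightarrow> nat \<Rightarrow> real) \<Rightarrow> (nat \<Rightarrow> real) \<Rightarrow> nat \<Rightarrow> nat option" where
  "greedy_next d \<alpha> n P q i =
     (if impr d \<alpha> n P q i = {} then None
      else Some (LEAST j. j \<in> impr d \<alpha> n P q i \<and>
                   (\<forall>k\<in>impr d \<alpha> n P q i. ip d (P k) q \<le> ip d (P j) q)))"

text \<open>One iteration of the query, with fuel f (fuel n suffices since the walk
  visits distinct vertices). Returns the vertex reached with <p,q> \<ge> g (if
  any) and the cost: 1 plus the neighbour-list length for each scanned vertex.\<close>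
fun walk :: "nat \<Rightarrow> real \<Rightarrow> real \<Rightarrow> nat \<Rightarrow> (nat \<Rightarrow> nat \<Rightarrow> real) \<Rightarrow> (nat \<Rightarrow> real)
               \<Rightarrow> nat \<Rightarrow> nat \<Rightarrow> nat option \<times> nat" where
  "walk d \<alpha> g n P q 0 i = ((if g \<le> ip d (P i) q then Some i else None), 1)"
| "walk d \<alpha> g n P q (Suc f) i =
     (if g \<le> ip d (P i) q then (Some i, 1)
      else (case greedy_next d \<alpha> n P q i of
              None \<Rightarrow> (None, 1 + card (nbrs d \<alpha> n P i))
            | Some j \<Rightarrow> (fst (walk d \<alpha> g n P q f j),
                         1 + card (nbrs d \<alpha> n P i) + snd (walk d \<alpha> g n P q f j))))"

definition iter :: "nat \<Rightarrow> real \<Rightarrow> real \<Rightarrow> nat \<Rightarrow> (nat \<Rightarrow> nat \<Rightarrow> real) \<Rightarrow> (nat \<Rightarrow> real)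
                     \<Rightarrow> (nat \<Rightarrow> nat) \<Rightarrow> nat \<Rightarrow> nat option \<times> nat" where
  "iter d \<alpha> g n P q S k = walk d \<alpha> g n P q n (S k)"

definition query_ok where
  "query_ok d \<alpha> g n P q S \<longleftrightarrow> (\<exists>k. fst (iter d \<alpha> g n P q S k) \<noteq> None)"

definition query_iters where
  "query_iters d \<alpha> g n P q S = (LEAST k. fst (iter d \<alpha> g n P q S k) \<noteq> None)"

definition query_result where
  "query_result d \<alpha> g n P q S = fst (iter d \<alpha> g n P q S (query_iters d \<alpha> g n P q S))"

definition query_time where
  "query_time d \<alpha> g n P q S = (\<Sum>k\<le>query_iters d \<alpha> g n P q S. snd (iter d \<alpha> g n P q S k))"

definition space_cost where
  "space_cost d \<alpha> n P = n + (\<Sum>i<n. card (nbrs d \<alpha> n P i))"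

text \<open>Insert of z: compare with all n points, then add the new edges.\<close>
definition insert_cost where
  "insert_cost d \<alpha> n P z = n + card {j. j < n \<and> \<alpha> \<le> ip d z (P j)}"

text \<open>Delete of point i: remove it from the lists of its neighbours.\<close>
definition delete_cost where
  "delete_cost d \<alpha> n P i = card (nbrs d \<alpha> n P i)"

text \<open>Index 0 is the planted point p*, uniform on the cap around q; indices
  1..n-1 are uniform on the sphere; S is the i.i.d. sequence of uniformly
  random starting vertices; z is a fresh uniform point to be inserted.\<close>
definition nn_model :: "nat \<Rightarrow> nat \<Rightarrow> real \<Rightarrow> (nat \<Rightarrow> real)
     \<Rightarrow> (((nat \<Rightarrow> nat \<Rightarrow> real) \<times> (nat \<Rightarrow> nat)) \<times> (nat \<Rightarrow> real)) measure" where
  "nn_model d n g q =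
     (PiM {..<n} (\<lambda>i. if i = 0 then cap_unif d q g else unif_sphere d)
        \<Otimes>\<^sub>M PiM UNIV (\<lambda>_::nat. measure_pmf (pmf_of_set {..<n})))
     \<Otimes>\<^sub>M unif_sphere d"

definition good_event where
  "good_event d n \<alpha> g q \<rho>q \<kappa> e =
     {\<omega> \<in> space (nn_model d n g q).
        (let P = fst (fst \<omega>); S = snd (fst \<omega>); z = snd \<omega>; N = real n in
          query_ok d \<alpha> g n P q S
          \<and> query_result d \<alpha> g n P q S = Some 0
          \<and> real (query_time d \<alpha> g n P q S) \<le> N powr (\<rho>q + e)
          \<and> real (space_cost d \<alpha> n P) \<le> N powr (2 - \<kappa>^2 + e)
          \<and> real (insert_cost d \<alpha> n P z) \<le> N powr (1 + e)
          \<and> (\<forall>i<n. real (delete_cost d \<alpha> n P i) \<le> N powr (1 - \<kappa>^2 + e)))}"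

end

theory Submission
  imports Defs "HOL-Real_Asymp.Real_Asymp"
begin

text \<open>
  On the scale \<open>\<mu>\<close>, a cap cut out by several half spaces has measure \<open>n powr (- |v|^2 + o(1))\<close>, where
  \<open>v\<close> is the nearest point of the intersection. Both bounds need only translations and scalings of
  Lebesgue measure: a cap is contained in a ball around \<open>\<mu> v\<close>, and a constant fraction of such a ball
  lies in the cap. Put \<open>s = sqrt (1 - \<kappa>^2)\<close>. With high probability every point has a neighbour at
  height at least \<open>(s - \<eta>) \<mu>\<close> over the query, so a walk is above that height after one step. Above it,
  a walk has only \<open>n powr O(\<eta>)\<close> steps: chains of constantly many short steps do not exist if \<open>n\<close> is
  polynomial in \<open>d\<close>, and otherwise the increment \<open>1/d\<close> suffices.

  A start succeeds if its best neighbour is adjacent to the planted point. If the exponent \<open>\<rho>q\<close> is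
  less than 1, there are about \<open>n powr (1 - \<rho>q)\<close> points at height \<open>(s + \<eta>) \<mu>\<close> that are adjacent to the
  planted point, each has \<open>n powr (1 - \<kappa>^2)\<close> neighbours, and most of these have no rival neighbour at
  that height. If \<open>\<rho>q \<ge> 1\<close>, the starts adjacent to the planted point are already enough.
\<close>

section \<open>Volumes in product coordinates\<close>

text \<open>The height \<open>s * \<mu>\<close> is critical: a point has about
  \<open>n powr (1 - \<kappa>^2 - h^2)\<close> neighbours above \<open>h * \<mu>\<close>, a count
  that passes 1 at \<open>h = s\<close>. So the best neighbour of a start lies near
  \<open>s * \<mu>\<close>, whatever the start. The exponent \<open>\<rho>q\<close> is the squared
  length of the shortest \<open>v\<close> with inner product \<open>s\<close> with the query and
  \<open>\<kappa>\<close> with the planted point, for unit directions with inner product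
  \<open>\<gamma>\<close>. Then \<open>n powr (\<kappa>^2 + \<rho>q - 1)\<close> starts with lists
  of length \<open>n powr (1 - \<kappa>^2)\<close> cost \<open>n powr \<rho>q\<close>. The main
  obstacle is the length of a walk. All that is known of \<open>n\<close> is that it tends to
  infinity subexponentially, so the step bound of order \<open>d\<close> coming from the increment
  \<open>1/d\<close> may exceed every small power of \<open>n\<close>. The slab estimate meets this:
  a step that gains little height is improbable in proportion to the gain. The planted point is
  random in its cap, with inner product at least \<open>\<gamma>\<close>. All estimates are
  therefore uniform over its position, and the nearest-point exponent is shown to get only better as
  the inner product grows.\<close>

lemma ip_commute: "ip d x y = ip d y x"
  by (simp add: ip_def mult.commute)

lemma ip_comb_left: "ip d (\<lambda>i. a * x i + b * y i) z = a * ip d x z + b * ip d y z"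
  by (simp add: ip_def sum.distrib sum_distrib_left algebra_simps)

lemma ip_comb_right: "ip d z (\<lambda>i. a * x i + b * y i) = a * ip d z x + b * ip d z y"
  by (metis ip_comb_left ip_commute)

lemma ip_scale_left: "ip d (\<lambda>i. a * x i) z = a * ip d x z"
  by (simp add: ip_def sum_distrib_left mult.assoc)

lemma ip_scale_right: "ip d z (\<lambda>i. a * x i) = a * ip d z x"
  by (metis ip_scale_left ip_commute)

lemma ip_uminus_right: "ip d z (\<lambda>i. - x i) = - ip d z x"
  by (simp add: ip_def sum_negf)

lemma ip_uminus_left: "ip d (\<lambda>i. - x i) z = - ip d x z"
  by (simp add: ip_def sum_negf)

lemma ip_nonneg: "0 \<le> ip d x x"
  by (simp add: ip_def sum_nonneg)

lemma ip_cauchy_schwarz: "(ip d x y)^2 \<le> ip d x x * ip d y y"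
  using Cauchy_Schwarz_ineq_sum[of x y "{..<d}"] by (simp add: ip_def power2_eq_square)

lemma ip_abs_le_1:
  assumes "ip d x x \<le> 1" "ip d y y \<le> 1"
  shows "\<bar>ip d x y\<bar> \<le> 1"
proof -
  have "(ip d x y)^2 \<le> 1"
    using ip_cauchy_schwarz[of d x y] mult_mono[OF assms] ip_nonneg[of d y] by force
  thus ?thesis by (simp add: abs_square_le_1)
qed

section \<open>Affine maps, radial projection and the volume of balls\<close>

definition aff :: "nat \<Rightarrow> real \<Rightarrow> (nat \<Rightarrow> real) \<Rightarrow> (nat \<Rightarrow> real) \<Rightarrow> nat \<Rightarrow> real" where
  "aff d r w x = restrict (\<lambda>i. w i + r * x i) {..<d}"

definition proj :: "nat \<Rightarrow> (nat \<Rightarrow> real) \<Rightarrow> nat \<Rightarrow> real" where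
  "proj d x = restrict (\<lambda>i. x i / sqrt (ip d x x)) {..<d}"

definition uball :: "nat \<Rightarrow> (nat \<Rightarrow> real) set" where
  "uball d = {x \<in> space (Rd d). ip d x x \<le> 1}"

lemma ip_aff_left: "ip d (aff d r w x) y = ip d w y + r * ip d x y"
  by (simp add: ip_def aff_def sum.distrib sum_distrib_left algebra_simps)

lemma ip_aff_right: "ip d y (aff d r w x) = ip d y w + r * ip d y x"
  by (metis ip_aff_left ip_commute)

lemma ip_proj_left: "ip d (proj d x) y = ip d x y / sqrt (ip d x x)"
  by (simp add: ip_def proj_def sum_divide_distrib)

lemma ip_proj_self: "ip d (proj d x) (proj d x) = (if ip d x x = 0 then 0 else 1)"
proof -
  have "ip d (proj d x) (proj d x) = ip d x x / (sqrt (ip d x x) * sqrt (ip d x x))"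
    by (metis (no_types, lifting) divide_divide_eq_left ip_commute ip_proj_left)
  thus ?thesis using ip_nonneg[of d x] by simp
qed

lemma ip_eq_norm_proj: "ip d x y = sqrt (ip d x x) * ip d (proj d x) y"
proof (cases "ip d x x = 0")
  case True
  hence "(ip d x y)^2 \<le> 0" using ip_cauchy_schwarz[of d x y] by simp
  thus ?thesis using True by simp
qed (simp add: ip_proj_left)

lemma ip_proj_scale: "r > 0 \<Longrightarrow> proj d (aff d r (\<lambda>_. 0) x) = proj d x"
proof -
  assume r: "r > 0"
  have "ip d (aff d r (\<lambda>_. 0) x) (aff d r (\<lambda>_. 0) x) = r^2 * ip d x x"
    by (simp add: ip_aff_left ip_aff_right power2_eq_square) (simp add: ip_def)
  hence "sqrt (ip d (aff d r (\<lambda>_. 0) x) (aff d r (\<lambda>_. 0) x)) = r * sqrt (ip d x x)"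
    using r by (simp add: real_sqrt_mult)
  thus ?thesis using r by (auto simp: proj_def aff_def fun_eq_iff)
qed

lemma aff_in_space [simp]: "aff d r w x \<in> space (Rd d)"
  by (simp add: aff_def Rd_def space_PiM)

lemma proj_in_space [simp]: "proj d x \<in> space (Rd d)"
  by (simp add: proj_def Rd_def space_PiM)

lemma measurable_Rd_component:
  "i < d \<Longrightarrow> (\<lambda>x. x i) \<in> borel_measurable (Rd d)"
  unfolding Rd_def by measurable

lemma measurable_ip [measurable]:
  assumes "f \<in> measurable M (Rd d)" "g \<in> measurable M (Rd d)"
  shows "(\<lambda>x. ip d (f x) (g x)) \<in> borel_measurable M"
  unfolding ip_def
  by (intro borel_measurable_sum borel_measurable_times measurable_compose[OF assms(1)]
      measurable_compose[OF assms(2)] measurable_Rd_component) auto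

lemma measurable_ip_left [measurable]:
  assumes "f \<in> measurable M (Rd d)"
  shows "(\<lambda>x. ip d (f x) w) \<in> borel_measurable M"
  unfolding ip_def
  by (intro borel_measurable_sum borel_measurable_times measurable_compose[OF assms(1)]
      measurable_Rd_component) auto

lemma measurable_ip_right [measurable]:
  assumes "f \<in> measurable M (Rd d)"
  shows "(\<lambda>x. ip d w (f x)) \<in> borel_measurable M"
  unfolding ip_def
  by (intro borel_measurable_sum borel_measurable_times measurable_compose[OF assms(1)]
      measurable_Rd_component) auto

lemma measurable_aff [measurable]: "aff d r w \<in> measurable (Rd d) (Rd d)"
  unfolding aff_def Rd_def by measurable

lemma measurable_proj [measurable]: "proj d \<in> measurable (Rd d) (Rd d)"
proof -
  have "(\<lambda>x. restrict (\<lambda>i. x i / sqrt (ip d x x)) {..<d}) \<in> measurable (Rd d) (PiM {..<d} (\<lambda>_. lborel))"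
  proof (rule measurable_restrict)
    fix i assume "i \<in> {..<d}"
    hence [measurable]: "(\<lambda>x. x i) \<in> borel_measurable (Rd d)"
      by (auto intro: measurable_Rd_component)
    show "(\<lambda>x. x i / sqrt (ip d x x)) \<in> Rd d \<rightarrow>\<^sub>M lborel" by measurable
  qed
  thus ?thesis unfolding proj_def[abs_def] Rd_def .
qed

lemma uball_sets [measurable]: "uball d \<in> sets (Rd d)"
  unfolding uball_def by measurable

text \<open>Product measures are determined by their values on boxes. On a box the affine map acts
  coordinatewise, and each coordinate contributes one factor \<open>\<bar>r\<bar>\<close> by the
  one-dimensional change of variables.\<close>

lemma emeasure_aff:
  assumes r: "r \<noteq> 0" and S: "S \<in> sets (Rd d)"
  shows "ennreal (\<bar>r\<bar>^d) * emeasure (Rd d) {x \<in> space (Rd d). aff d r w x \<in> S} = emeasure (Rd d) S"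
proof -
  let ?P = "density (distr (Rd d) (Rd d) (aff d r w)) (\<lambda>_. ennreal (\<bar>r\<bar>^d))"
  interpret product_sigma_finite "\<lambda>_::nat. lborel :: real measure" ..
  have "?P = PiM {..<d} (\<lambda>_. lborel)"
  proof (rule PiM_eqI)
    show "sets ?P = sets (PiM {..<d} (\<lambda>_. lborel))" by (simp add: Rd_def)
    fix A :: "nat \<Rightarrow> real set" assume A: "\<And>i. i \<in> {..<d} \<Longrightarrow> A i \<in> sets lborel"
    hence AP: "Pi\<^sub>E {..<d} A \<in> sets (Rd d)" unfolding Rd_def by (intro sets_PiM_I_finite) auto
    have sc: "ennreal \<bar>r\<bar> * emeasure lborel ((\<lambda>x. w i + r * x) -` A i) = emeasure lborel (A i)"
      if "i < d" for i
    proof -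
      have Ai: "A i \<in> sets borel" using A[of i] that by simp
      have "emeasure lborel (A i) = emeasure (density (distr lborel borel (\<lambda>x. w i + r * x)) (\<lambda>_. ennreal \<bar>r\<bar>)) (A i)"
        using lborel_real_affine[OF r, of "w i"] by simp
      also have "\<dots> = ennreal \<bar>r\<bar> * emeasure (distr lborel borel (\<lambda>x. w i + r * x)) (A i)"
        using Ai by (subst emeasure_density_const) auto
      also have "\<dots> = ennreal \<bar>r\<bar> * emeasure lborel ((\<lambda>x. w i + r * x) -` A i)"
        using Ai by (subst emeasure_distr) auto
      finally show ?thesis by simp
    qed
    have "emeasure ?P (Pi\<^sub>E {..<d} A) = ennreal (\<bar>r\<bar>^d) * emeasure (distr (Rd d) (Rd d) (aff d r w)) (Pi\<^sub>E {..<d} A)"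
      using AP by (subst emeasure_density_const) auto
    also have "\<dots> = ennreal (\<bar>r\<bar>^d) * emeasure (Rd d) (aff d r w -` (Pi\<^sub>E {..<d} A) \<inter> space (Rd d))"
      using AP by (subst emeasure_distr) auto
    also have "aff d r w -` (Pi\<^sub>E {..<d} A) \<inter> space (Rd d) = Pi\<^sub>E {..<d} (\<lambda>i. (\<lambda>x. w i + r * x) -` A i)"
      by (auto simp: aff_def Rd_def space_PiM PiE_def Pi_def extensional_def)
    also have "emeasure (Rd d) \<dots> = (\<Prod>i<d. emeasure lborel ((\<lambda>x. w i + r * x) -` A i))"
    proof -
      have "(\<lambda>x. w i + r * x) -` A i \<in> sets lborel" if "i < d" for i
      proof -
        have "(\<lambda>x. w i + r * x) \<in> borel_measurable borel" by measurable
        from measurable_sets[OF this, of "A i"] A[of i] that show ?thesis by simp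
      qed
      thus ?thesis unfolding Rd_def by (subst emeasure_PiM) auto
    qed
    also have "ennreal (\<bar>r\<bar>^d) * \<dots> = (\<Prod>i<d. ennreal \<bar>r\<bar> * emeasure lborel ((\<lambda>x. w i + r * x) -` A i))"
      by (simp add: prod.distrib ennreal_power)
    also have "\<dots> = (\<Prod>i<d. emeasure lborel (A i))" using sc by (intro prod.cong) auto
    finally show "emeasure ?P (Pi\<^sub>E {..<d} A) = (\<Prod>i<d. emeasure lborel (A i))" .
  qed simp
  hence "emeasure (Rd d) S = emeasure ?P S" by (simp add: Rd_def)
  also have "\<dots> = ennreal (\<bar>r\<bar>^d) * emeasure (distr (Rd d) (Rd d) (aff d r w)) S"
    using S by (subst emeasure_density_const) auto
  also have "emeasure (distr (Rd d) (Rd d) (aff d r w)) S = emeasure (Rd d) {x \<in> space (Rd d). aff d r w x \<in> S}"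
    using S by (subst emeasure_distr) (auto intro!: arg_cong[of _ _ "emeasure (Rd d)"])
  finally show ?thesis by simp
qed

lemma measure_aff:
  assumes "r \<noteq> 0" "S \<in> sets (Rd d)"
  shows "\<bar>r\<bar>^d * measure (Rd d) {x \<in> space (Rd d). aff d r w x \<in> S} = measure (Rd d) S"
  using emeasure_aff[OF assms, of w] by (simp add: measure_def enn2real_mult flip: emeasure_aff[OF assms, of w])

lemma emeasure_uball_finite: "emeasure (Rd d) (uball d) < \<infinity>"
proof -
  interpret product_sigma_finite "\<lambda>_::nat. lborel :: real measure" ..
  have "uball d \<subseteq> Pi\<^sub>E {..<d} (\<lambda>_. {-1..1})"
  proof
    fix x assume x: "x \<in> uball d"
    have "\<bar>x i\<bar> \<le> 1" if "i < d" for i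
    proof -
      have "x i * x i \<le> ip d x x" unfolding ip_def using that
        by (intro member_le_sum[of i "{..<d}" "\<lambda>i. x i * x i"]) auto
      hence "(x i)^2 \<le> 1" using x by (simp add: uball_def power2_eq_square)
      thus ?thesis by (simp add: abs_square_le_1)
    qed
    thus "x \<in> Pi\<^sub>E {..<d} (\<lambda>_. {-1..1})" using x
      by (auto simp: uball_def Rd_def space_PiM PiE_def Pi_def abs_le_iff minus_le_iff)
  qed
  hence "emeasure (Rd d) (uball d) \<le> emeasure (Rd d) (Pi\<^sub>E {..<d} (\<lambda>_. {-1..1}))"
    unfolding Rd_def by (intro emeasure_mono sets_PiM_I_finite) auto
  also have "\<dots> = (\<Prod>i<d. emeasure lborel {-1..1::real})"
    unfolding Rd_def by (subst emeasure_PiM) auto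
  also have "\<dots> < \<infinity>" by (simp add: ennreal_power less_top[symmetric] power_eq_top_ennreal)
  finally show ?thesis .
qed

lemma emeasure_uball_pos: "0 < emeasure (Rd d) (uball d)"
proof (cases "d = 0")
  case True
  have "uball 0 = {\<lambda>_. undefined}" by (auto simp: uball_def Rd_def space_PiM ip_def)
  thus ?thesis using True by (simp add: Rd_def emeasure_PiM_empty)
next
  case False
  interpret product_sigma_finite "\<lambda>_::nat. lborel :: real measure" ..
  let ?r = "1 / real d"
  have "Pi\<^sub>E {..<d} (\<lambda>_. {-?r..?r}) \<subseteq> uball d"
  proof
    fix x assume x: "x \<in> Pi\<^sub>E {..<d} (\<lambda>_. {-?r..?r})"
    have "x i * x i \<le> ?r" if "i < d" for i
    proof -
      have "\<bar>x i\<bar> \<le> ?r" using x that by (force simp: PiE_def Pi_def abs_le_iff)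
      hence "\<bar>x i\<bar> * \<bar>x i\<bar> \<le> ?r * ?r" by (intro mult_mono) auto
      also have "\<dots> \<le> ?r" using False by (simp add: field_simps)
      finally show ?thesis by simp
    qed
    hence "ip d x x \<le> real (card {..<d}) * ?r" unfolding ip_def by (intro sum_bounded_above) auto
    thus "x \<in> uball d" using x False by (auto simp: uball_def Rd_def space_PiM)
  qed
  hence "emeasure (Rd d) (Pi\<^sub>E {..<d} (\<lambda>_. {-?r..?r})) \<le> emeasure (Rd d) (uball d)"
    by (intro emeasure_mono) auto
  moreover have "emeasure (Rd d) (Pi\<^sub>E {..<d} (\<lambda>_. {-?r..?r})) = (\<Prod>i<d. emeasure lborel {-?r..?r})"
    unfolding Rd_def by (subst emeasure_PiM) auto
  moreover have "0 < (\<Prod>i<d. emeasure lborel {-?r..?r})"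
    using False by (simp add: ennreal_power)
  ultimately show ?thesis by order
qed

definition ballvol :: "nat \<Rightarrow> real" where "ballvol d = measure (Rd d) (uball d)"

lemma ballvol_pos: "ballvol d > 0"
  unfolding ballvol_def measure_def
  using emeasure_uball_finite[of d] emeasure_uball_pos[of d] by (simp add: enn2real_positive_iff)

text \<open>The ball has centre \<open>- w\<close>, because \<open>aff d 1 w x\<close> is
  \<open>w + x\<close>; scaling by the inverse radius turns it into a preimage of the unit ball.
  Finiteness for an arbitrary real \<open>R\<close> follows by inclusion in the ball of radius
  \<open>\<bar>R\<bar> + 1\<close>.\<close>

lemma fmeasurable_ball: "{x \<in> space (Rd d). ip d (aff d 1 w x) (aff d 1 w x) \<le> R^2} \<in> fmeasurable (Rd d)"
  and measure_ball: "R > 0 \<Longrightarrow> measure (Rd d) {x \<in> space (Rd d). ip d (aff d 1 w x) (aff d 1 w x) \<le> R^2} = R^d * ballvol d"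
proof -
  have main: "{x \<in> space (Rd d). ip d (aff d 1 w x) (aff d 1 w x) \<le> r^2} \<in> fmeasurable (Rd d) \<and>
     measure (Rd d) {x \<in> space (Rd d). ip d (aff d 1 w x) (aff d 1 w x) \<le> r^2} = r^d * ballvol d"
    if r: "r > 0" for r
  proof -
    let ?B = "{x \<in> space (Rd d). aff d (1/r) (\<lambda>i. w i / r) x \<in> uball d}"
    have eq: "{x \<in> space (Rd d). ip d (aff d 1 w x) (aff d 1 w x) \<le> r^2} = ?B"
    proof -
      have "ip d (aff d (1/r) (\<lambda>i. w i / r) x) (aff d (1/r) (\<lambda>i. w i / r) x) = ip d (aff d 1 w x) (aff d 1 w x) / r^2" for x
        unfolding ip_def sum_divide_distrib aff_def using r
        by (intro sum.cong) (auto simp: field_simps power2_eq_square)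
      moreover have "t / r^2 \<le> 1 \<longleftrightarrow> t \<le> r^2" for t using r by (simp add: divide_simps)
      ultimately show ?thesis by (simp add: uball_def)
    qed
    have r0: "1 / r \<noteq> 0" using r by simp
    have e: "ennreal (\<bar>1/r\<bar>^d) * emeasure (Rd d) ?B = emeasure (Rd d) (uball d)"
      by (rule emeasure_aff[OF r0 uball_sets])
    have "emeasure (Rd d) ?B < \<infinity>"
    proof (rule ccontr)
      assume "\<not> ?thesis"
      hence "emeasure (Rd d) ?B = \<infinity>" by (simp add: less_top[symmetric])
      hence "emeasure (Rd d) (uball d) = \<infinity>" using e r by (simp add: ennreal_mult_top)
      thus False using emeasure_uball_finite[of d] by simp
    qed
    moreover have "?B \<in> sets (Rd d)" by measurable
    moreover have "measure (Rd d) ?B = r^d * ballvol d"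
      using measure_aff[OF r0 uball_sets, of d "\<lambda>i. w i / r"] r
      by (simp add: ballvol_def field_simps)
    ultimately show ?thesis unfolding eq by (auto simp: fmeasurable_def)
  qed
  show "R > 0 \<Longrightarrow> measure (Rd d) {x \<in> space (Rd d). ip d (aff d 1 w x) (aff d 1 w x) \<le> R^2} = R^d * ballvol d"
    using main by blast
  have "{x \<in> space (Rd d). ip d (aff d 1 w x) (aff d 1 w x) \<le> R^2} \<subseteq>
        {x \<in> space (Rd d). ip d (aff d 1 w x) (aff d 1 w x) \<le> (\<bar>R\<bar> + 1)^2}"
    by (auto intro: order_trans[OF _ power_mono[of "\<bar>R\<bar>" "\<bar>R\<bar> + 1" 2, simplified]])
  moreover have "{x \<in> space (Rd d). ip d (aff d 1 w x) (aff d 1 w x) \<le> (\<bar>R\<bar> + 1)^2} \<in> fmeasurable (Rd d)"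
    using main[of "\<bar>R\<bar> + 1"] by simp
  moreover have "{x \<in> space (Rd d). ip d (aff d 1 w x) (aff d 1 w x) \<le> R^2} \<in> sets (Rd d)" by measurable
  ultimately show "{x \<in> space (Rd d). ip d (aff d 1 w x) (aff d 1 w x) \<le> R^2} \<in> fmeasurable (Rd d)"
    using fmeasurableI2 by blast
qed

lemma fmeasurable_uball: "uball d \<in> fmeasurable (Rd d)"
  using emeasure_uball_finite by (auto simp: fmeasurable_def)

lemma fmeasurable_subset_uball: "C \<subseteq> uball d \<Longrightarrow> C \<in> sets (Rd d) \<Longrightarrow> C \<in> fmeasurable (Rd d)"
  using fmeasurableI2 fmeasurable_uball by blast

lemma fmeasurable_aff:
  assumes "r \<noteq> 0" "S \<in> fmeasurable (Rd d)"
  shows "{x \<in> space (Rd d). aff d r w x \<in> S} \<in> fmeasurable (Rd d)"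
proof -
  have S: "S \<in> sets (Rd d)" "emeasure (Rd d) S \<noteq> \<infinity>" using assms(2) by (auto simp: fmeasurable_def)
  have "emeasure (Rd d) {x \<in> space (Rd d). aff d r w x \<in> S} \<noteq> \<infinity>"
    using emeasure_aff[OF assms(1) S(1), of w] S(2) assms(1) by (auto simp: ennreal_mult_top)
  moreover have "{x \<in> space (Rd d). aff d r w x \<in> S} \<in> sets (Rd d)" using S(1) by measurable
  ultimately show ?thesis by (simp add: fmeasurable_def less_top)
qed

section \<open>The uniform measure on the sphere\<close>

lemma unif_sphere_alt: "unif_sphere d = distr (uniform_measure (Rd d) (uball d)) (Rd d) (proj d)"
  by (simp add: unif_sphere_def uball_def proj_def[abs_def])

lemma sets_unif_sphere [measurable_cong, simp]: "sets (unif_sphere d) = sets (Rd d)"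
  by (simp add: unif_sphere_alt)

lemma space_unif_sphere [simp]: "space (unif_sphere d) = space (Rd d)"
  by (simp add: unif_sphere_alt)

lemma prob_space_unif_sphere: "prob_space (unif_sphere d)"
proof -
  interpret prob_space "uniform_measure (Rd d) (uball d)"
    using emeasure_uball_finite[of d] emeasure_uball_pos[of d]
    by (intro prob_space_uniform_measure) auto
  show ?thesis unfolding unif_sphere_alt
    by (rule prob_space_distr) (simp add: measurable_proj cong: measurable_cong_sets)
qed

definition cone :: "nat \<Rightarrow> (nat \<Rightarrow> real) set \<Rightarrow> (nat \<Rightarrow> real) set" where
  "cone d A = {x \<in> uball d. proj d x \<in> A}"

lemma cone_sets [measurable]: "A \<in> sets (Rd d) \<Longrightarrow> cone d A \<in> sets (Rd d)"
proof -
  assume [measurable]: "A \<in> sets (Rd d)"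
  have "cone d A = uball d \<inter> {x \<in> space (Rd d). proj d x \<in> A}"
    by (auto simp: cone_def uball_def)
  also have "\<dots> \<in> sets (Rd d)" by measurable
  finally show ?thesis .
qed

lemma cone_fmeasurable: "A \<in> sets (Rd d) \<Longrightarrow> cone d A \<in> fmeasurable (Rd d)"
  by (rule fmeasurable_subset_uball) (auto simp: cone_def intro: cone_sets[unfolded cone_def])

lemma measure_unif_sphere:
  assumes A: "A \<in> sets (Rd d)"
  shows "measure (unif_sphere d) A = measure (Rd d) (cone d A) / ballvol d"
proof -
  have m: "proj d \<in> measurable (uniform_measure (Rd d) (uball d)) (Rd d)"
    by (simp add: measurable_proj cong: measurable_cong_sets)
  have "measure (unif_sphere d) A = measure (uniform_measure (Rd d) (uball d)) (proj d -` A \<inter> space (Rd d))"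
    unfolding unif_sphere_alt using m A by (subst measure_distr) auto
  also have "\<dots> = measure (Rd d) (uball d \<inter> (proj d -` A \<inter> space (Rd d))) / measure (Rd d) (uball d)"
    using A emeasure_uball_finite[of d] emeasure_uball_pos[of d]
    by (intro measure_uniform_measure measurable_sets[OF measurable_proj]) auto
  also have "uball d \<inter> (proj d -` A \<inter> space (Rd d)) = cone d A"
    by (auto simp: cone_def uball_def)
  finally show ?thesis by (simp add: ballvol_def)
qed

lemma unif_sphere_le_iff:
  assumes "A \<in> sets (Rd d)"
  shows "measure (unif_sphere d) A \<le> c \<longleftrightarrow> measure (Rd d) (cone d A) \<le> c * ballvol d"
  using ballvol_pos[of d] by (simp add: measure_unif_sphere[OF assms] divide_simps)

section \<open>Bounds for caps by comparing their cones with balls\<close>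

lemma ip_diff_self:
  "ip d (aff d 1 (\<lambda>i. - w i) x) (aff d 1 (\<lambda>i. - w i) x) = ip d x x - 2 * ip d x w + ip d w w"
  by (simp add: ip_aff_left ip_aff_right ip_uminus_left ip_uminus_right ip_commute[of d w x])

text \<open>At norm \<open>r\<close> the left side is at most \<open>r^2 - 2 * r * W\<close> plus a
  constant. For \<open>W \<le> 1/2\<close> this is largest on \<open>[0,1]\<close> at
  \<open>r = 1\<close>, so the worst points of the cone lie on the sphere.\<close>

lemma dist_cone_point:
  assumes "x \<in> uball d" "W \<le> ip d (proj d x) w" "0 \<le> W" "W \<le> 1/2"
  shows "ip d x x - 2 * ip d x w + ip d w w \<le> 1 - 2 * W + ip d w w"
proof -
  define r where "r = sqrt (ip d x x)"
  have r: "0 \<le> r" "r \<le> 1" "ip d x x = r^2" using assms(1) ip_nonneg[of d x] by (auto simp: r_def uball_def)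
  have "ip d x w \<ge> r * W" unfolding ip_eq_norm_proj[of d x w] r_def[symmetric]
    using assms(2) r by (intro mult_left_mono) auto
  moreover have "0 \<le> (1 - r) * (1 + r - 2 * W)" using r assms by (intro mult_nonneg_nonneg) auto
  ultimately show ?thesis using r(3) by (simp add: algebra_simps power2_eq_square)
qed

lemma exp_half_power: "(exp (- E / 2))^d = exp (- (E * real d / 2))" for E :: real
  by (simp add: exp_of_nat_mult[symmetric] mult.commute)

text \<open>The cone over a cap lies in a ball around \<open>w\<close> whose squared radius is \<open>1 - (2 W - |w|^2)\<close>.\<close>
lemma sphere_cap_upper:
  assumes W: "0 \<le> W" "W \<le> 1/2"
  shows "measure (unif_sphere d) {y \<in> space (Rd d). W \<le> ip d y w} \<le> exp (- ((2 * W - ip d w w) * real d / 2))"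
proof -
  let ?A = "{y \<in> space (Rd d). W \<le> ip d y w}"
  let ?E = "2 * W - ip d w w"
  \<comment> \<open>The squared radius \<open>1 - E\<close> is relaxed to \<open>exp (- E)\<close>,
    so that the volume ratio \<open>R^d\<close> is exactly the claimed exponential, also when
    \<open>1 - E\<close> is not positive.\<close>
  let ?R = "exp (- ?E / 2)"
  have R2: "?R^2 = exp (- ?E)" by (simp add: power2_eq_square exp_add[symmetric])
  have "cone d ?A \<subseteq> {x \<in> space (Rd d). ip d (aff d 1 (\<lambda>i. - w i) x) (aff d 1 (\<lambda>i. - w i) x) \<le> ?R^2}"
  proof
    fix x assume x: "x \<in> cone d ?A"
    have "ip d x x - 2 * ip d x w + ip d w w \<le> 1 + (- ?E)"
      using dist_cone_point[of x d W w] x W by (auto simp: cone_def)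
    also have "\<dots> \<le> ?R^2" unfolding R2 by (rule exp_ge_add_one_self)
    finally show "x \<in> {x \<in> space (Rd d). ip d (aff d 1 (\<lambda>i. - w i) x) (aff d 1 (\<lambda>i. - w i) x) \<le> ?R^2}"
      using x by (simp add: ip_diff_self cone_def uball_def)
  qed
  hence "measure (Rd d) (cone d ?A) \<le> measure (Rd d) {x \<in> space (Rd d). ip d (aff d 1 (\<lambda>i. - w i) x) (aff d 1 (\<lambda>i. - w i) x) \<le> ?R^2}"
    by (intro measure_mono_fmeasurable cone_sets fmeasurable_ball) measurable
  also have "\<dots> = ?R^d * ballvol d" by (rule measure_ball) simp
  finally have *: "measure (Rd d) (cone d ?A) \<le> ?R^d * ballvol d" .
  have "?A \<in> sets (Rd d)" by measurable
  thus ?thesis using * unif_sphere_le_iff[of ?A d "?R^d"] unfolding exp_half_power by blast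
qed

text \<open>Reflection in the origin preserves volume, and the half ball together with its
  reflection covers the ball.\<close>

lemma half_ball: "ballvol d \<le> 2 * measure (Rd d) {z \<in> uball d. ip d z w \<le> 0}"
proof -
  let ?U = "{z \<in> uball d. ip d z w \<le> 0}"
  have U: "?U \<in> sets (Rd d)" unfolding uball_def by measurable
  have Uf: "?U \<in> fmeasurable (Rd d)" by (rule fmeasurable_subset_uball) (use U in auto)
  let ?U' = "{x \<in> space (Rd d). aff d (-1) (\<lambda>_. 0) x \<in> ?U}"
  have "measure (Rd d) ?U' = measure (Rd d) ?U" using measure_aff[of "-1", OF _ U] by simp
  moreover have "uball d \<subseteq> ?U \<union> ?U'"
  proof
    fix x assume x: "x \<in> uball d"
    have z: "ip d (\<lambda>_. 0) y = 0" "ip d y (\<lambda>_. 0) = 0" for y by (auto simp: ip_def)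
    have "ip d (aff d (-1) (\<lambda>_. 0) x) (aff d (-1) (\<lambda>_. 0) x) = ip d x x"
       "ip d (aff d (-1) (\<lambda>_. 0) x) w = - ip d x w"
      unfolding ip_aff_left ip_aff_right z by simp_all
    thus "x \<in> ?U \<union> ?U'" using x by (auto simp: uball_def)
  qed
  moreover have "?U' \<in> fmeasurable (Rd d)" by (rule fmeasurable_aff[OF _ Uf]) simp
  ultimately have "ballvol d \<le> measure (Rd d) (?U \<union> ?U')" unfolding ballvol_def
    using Uf by (intro measure_mono_fmeasurable) auto
  also have "\<dots> \<le> measure (Rd d) ?U + measure (Rd d) ?U'"
    using Uf \<open>?U' \<in> fmeasurable (Rd d)\<close> by (intro measure_Un_le) auto
  finally show ?thesis using \<open>measure (Rd d) ?U' = measure (Rd d) ?U\<close> by simp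
qed

text \<open>Dividing by a norm at most 1 only pushes a negative inner product further down, so the
  tail lies in the cone over a cap in direction \<open>- y\<close>. The choice
  \<open>w = - t y\<close>, \<open>W = t^2\<close> gives the exponent
  \<open>2 * W - \<bar>w\<bar>^2 \<ge> t^2\<close>.\<close>

lemma ball_tail:
  assumes "0 \<le> t" "t^2 \<le> 1/2" "ip d y y \<le> 1"
  shows "measure (Rd d) {z \<in> uball d. ip d z y < - t} \<le> exp (- (t^2 * real d / 2)) * ballvol d"
proof -
  let ?w = "\<lambda>i. (- t) * y i"
  let ?A = "{z \<in> space (Rd d). t^2 \<le> ip d z ?w}"
  have A: "?A \<in> sets (Rd d)" by measurable
  have T: "{z \<in> uball d. ip d z y < - t} \<in> sets (Rd d)" unfolding uball_def by measurable
  have "{z \<in> uball d. ip d z y < - t} \<subseteq> cone d ?A"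
  proof
    fix z assume z: "z \<in> {z \<in> uball d. ip d z y < - t}"
    define r where "r = sqrt (ip d z z)"
    have r: "0 \<le> r" "r \<le> 1" using z ip_nonneg[of d z] by (auto simp: r_def uball_def)
    let ?p = "ip d (proj d z) y"
    have rp: "r * ?p < - t" using z ip_eq_norm_proj[of d z y] by (simp add: r_def)
    have "?p < 0" using rp r assms(1) by (smt (verit) mult_nonneg_nonneg)
    hence "?p \<le> r * ?p" using r by (smt (verit) mult_left_le_one_le mult_minus_right)
    hence "t \<le> - ?p" using rp by simp
    hence "t * t \<le> t * (- ?p)" using assms(1) by (intro mult_left_mono) auto
    hence "t^2 \<le> ip d (proj d z) ?w" by (simp only: ip_scale_right power2_eq_square)
    thus "z \<in> cone d ?A" using z by (simp add: cone_def)
  qed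
  hence "measure (Rd d) {z \<in> uball d. ip d z y < - t} \<le> measure (Rd d) (cone d ?A)"
    using T by (intro measure_mono_fmeasurable cone_fmeasurable A)
  also have "\<dots> \<le> exp (- ((2 * t^2 - ip d ?w ?w) * real d / 2)) * ballvol d"
    using sphere_cap_upper[of "t^2" d ?w] unif_sphere_le_iff[OF A] assms by simp
  also have "\<dots> \<le> exp (- (t^2 * real d / 2)) * ballvol d"
  proof -
    have "ip d ?w ?w = t^2 * ip d y y" by (simp only: ip_scale_left ip_scale_right) (simp add: power2_eq_square)
    hence "ip d ?w ?w \<le> t^2" using assms(3) mult_left_mono[of "ip d y y" 1 "t^2"] by simp
    hence "t^2 * real d \<le> (2 * t^2 - ip d ?w ?w) * real d" by (intro mult_right_mono) auto
    thus ?thesis using ballvol_pos[of d] by simp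
  qed
  finally show ?thesis .
qed

text \<open>A ball of squared radius \<open>1 - |w|^2\<close> around \<open>w\<close> has a constant fraction of its volume inside
  the unit ball and not below \<open>w\<close> in the directions \<open>y1\<close>, \<open>y2\<close>.\<close>
lemma sphere_two_caps_lower:
  assumes w: "ip d w w < 1" and y: "ip d y1 y1 \<le> 1" "ip d y2 y2 \<le> 1"
    and t: "0 \<le> t" "t^2 \<le> 1/2" and a: "0 < a1" "0 < a2"
    and wy: "a1 + t \<le> ip d w y1" "a2 + t \<le> ip d w y2"
  shows "(1/2 - 2 * exp (- (t^2 * real d / 2))) * sqrt (1 - ip d w w)^d
    \<le> measure (unif_sphere d) {x \<in> space (Rd d). a1 \<le> ip d x y1 \<and> a2 \<le> ip d x y2}"
proof -
  define V where "V = ballvol d"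
  define e where "e = exp (- (t^2 * real d / 2))"
  define r where "r = sqrt (1 - ip d w w)"
  have r: "0 < r" "r \<le> 1" "r^2 = 1 - ip d w w" using w ip_nonneg[of d w] by (auto simp: r_def)
  let ?A = "{x \<in> space (Rd d). a1 \<le> ip d x y1 \<and> a2 \<le> ip d x y2}"
  let ?U = "{z \<in> uball d. ip d z w \<le> 0}"
  let ?Z = "{z \<in> uball d. ip d z w \<le> 0 \<and> - t \<le> ip d z y1 \<and> - t \<le> ip d z y2}"
  let ?T = "\<lambda>y. {z \<in> uball d. ip d z y < - t}"
  have A: "?A \<in> sets (Rd d)" by measurable
  have Z: "?Z \<in> sets (Rd d)" unfolding uball_def by measurable
  have T: "?T y \<in> sets (Rd d)" for y unfolding uball_def by measurable
  have Zf: "?Z \<in> fmeasurable (Rd d)" by (rule fmeasurable_subset_uball) (use Z in auto)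
  have Tf: "?T y \<in> fmeasurable (Rd d)" for y by (rule fmeasurable_subset_uball) (use T in auto)
  have U: "?U \<in> sets (Rd d)" unfolding uball_def by measurable
  \<comment> \<open>Half of the ball has no positive component along \<open>w\<close>; removing the
    two tails from it leaves the usable part \<open>?Z\<close>.\<close>
  have "V / 2 \<le> measure (Rd d) ?U" using half_ball[of d w] by (simp add: V_def)
  also have "\<dots> \<le> measure (Rd d) (?Z \<union> (?T y1 \<union> ?T y2))"
    using U Zf Tf by (intro measure_mono_fmeasurable) auto
  also have "\<dots> \<le> measure (Rd d) ?Z + measure (Rd d) (?T y1 \<union> ?T y2)"
    using Z T by (intro measure_Un_le) auto
  also have "measure (Rd d) (?T y1 \<union> ?T y2) \<le> measure (Rd d) (?T y1) + measure (Rd d) (?T y2)"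
    using T by (intro measure_Un_le) auto
  also have "\<dots> \<le> e * V + e * V" unfolding e_def V_def by (intro add_mono ball_tail t y)
  finally have 1: "(1/2 - 2 * e) * V \<le> measure (Rd d) ?Z" by (simp add: algebra_simps)
  \<comment> \<open>The sign condition on \<open>ip d z w\<close> removes the cross term of the
    squared norm of \<open>w + r z\<close>, so this point stays in the unit ball. The margin
    \<open>t\<close> pays for the component of \<open>z\<close> along \<open>y1\<close> and
    \<open>y2\<close>, and projecting outwards to the sphere only increases positive inner
    products.\<close>
  have "?Z \<subseteq> {x \<in> space (Rd d). aff d r w x \<in> cone d ?A}"
  proof
    fix z assume z: "z \<in> ?Z"
    let ?x = "aff d r w z"
    have "ip d ?x ?x = ip d w w + 2 * r * ip d z w + r^2 * ip d z z"
      by (simp add: ip_aff_left ip_aff_right ip_commute[of d w z] power2_eq_square algebra_simps)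
    also have "\<dots> \<le> ip d w w + 0 + r^2 * 1"
      using z r w by (intro add_mono mult_left_mono) (auto simp: uball_def mult_nonneg_nonpos)
    finally have x1: "ip d ?x ?x \<le> 1" using r by simp
    have "a \<le> ip d (proj d ?x) y" if "0 < a" "a + t \<le> ip d w y" "- t \<le> ip d z y" for a y
    proof -
      have "r * (- t) \<le> r * ip d z y" using that r by (intro mult_left_mono) auto
      moreover have "r * t \<le> t" using r t by (simp add: mult_left_le_one_le)
      ultimately have "a \<le> ip d ?x y" using that by (simp add: ip_aff_left)
      hence *: "a \<le> sqrt (ip d ?x ?x) * ip d (proj d ?x) y" by (simp flip: ip_eq_norm_proj)
      have s: "0 \<le> sqrt (ip d ?x ?x)" "sqrt (ip d ?x ?x) \<le> 1" using x1 ip_nonneg[of d ?x] by auto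
      have "0 < ip d (proj d ?x) y" using * s that(1) by (smt (verit) mult_nonneg_nonpos)
      thus ?thesis using * s by (smt (verit) mult_left_le_one_le)
    qed
    thus "z \<in> {x \<in> space (Rd d). aff d r w x \<in> cone d ?A}"
      using z a wy x1 by (auto simp: cone_def uball_def)
  qed
  hence "measure (Rd d) ?Z \<le> measure (Rd d) {x \<in> space (Rd d). aff d r w x \<in> cone d ?A}"
    using Z r by (intro measure_mono_fmeasurable fmeasurable_aff cone_fmeasurable A) auto
  moreover have "r^d * measure (Rd d) {x \<in> space (Rd d). aff d r w x \<in> cone d ?A} = measure (Rd d) (cone d ?A)"
    using measure_aff[of r "cone d ?A" d w] r A cone_sets by auto
  moreover have "0 < r^d" using r by simp
  ultimately have "r^d * ((1/2 - 2 * e) * V) \<le> measure (Rd d) (cone d ?A)"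
    using 1 by (smt (verit) mult_left_mono)
  thus ?thesis using ballvol_pos[of d] unfolding measure_unif_sphere[OF A] r_def[symmetric] e_def[symmetric] V_def
    by (simp add: field_simps)
qed

text \<open>\<open>proj\<close> leaves the sphere only at points with \<open>ip d x x = 0\<close>,
  where division by zero returns the zero vector. Such points lie in centred balls of every radius,
  whose volumes tend to 0 because \<open>d > 0\<close>.\<close>

lemma AE_unif_sphere:
  assumes d: "d > 0"
  shows "measure (unif_sphere d) {x \<in> space (Rd d). ip d x x \<noteq> 1} = 0"
proof -
  let ?A = "{x \<in> space (Rd d). ip d x x \<noteq> 1}"
  have A: "?A \<in> sets (Rd d)" by measurable
  have "measure (Rd d) (cone d ?A) \<le> e" if e: "e > 0" for e
  proof -
    define V where "V = ballvol d"
    define R where "R = min 1 (e / V)"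
    have V: "V > 0" unfolding V_def by (rule ballvol_pos)
    have R: "R > 0" "R \<le> 1" "R \<le> e / V" using e V by (auto simp: R_def)
    have "cone d ?A \<subseteq> {x \<in> space (Rd d). ip d (aff d 1 (\<lambda>_. 0) x) (aff d 1 (\<lambda>_. 0) x) \<le> R^2}"
    proof
      fix x assume x: "x \<in> cone d ?A"
      hence "ip d x x = 0" by (auto simp: cone_def ip_proj_self split: if_splits)
      moreover have "ip d (aff d 1 (\<lambda>_. 0) x) (aff d 1 (\<lambda>_. 0) x) = ip d x x"
        by (simp add: ip_def aff_def)
      ultimately show "x \<in> {x \<in> space (Rd d). ip d (aff d 1 (\<lambda>_. 0) x) (aff d 1 (\<lambda>_. 0) x) \<le> R^2}"
        using x by (simp add: cone_def uball_def)
    qed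
    hence "measure (Rd d) (cone d ?A) \<le> measure (Rd d) {x \<in> space (Rd d). ip d (aff d 1 (\<lambda>_. 0) x) (aff d 1 (\<lambda>_. 0) x) \<le> R^2}"
      by (intro measure_mono_fmeasurable fmeasurable_ball cone_sets A)
    also have "\<dots> = R^d * V" unfolding V_def by (rule measure_ball) (rule R)
    also have "R^d \<le> R^1" using R d by (intro power_decreasing) auto
    hence "R^d * V \<le> e / V * V" using R V by (intro mult_right_mono) auto
    finally show ?thesis using V by simp
  qed
  hence "measure (Rd d) (cone d ?A) \<le> 0" by (rule field_le_epsilon) simp
  hence "measure (Rd d) (cone d ?A) = 0" using measure_nonneg by (intro antisym)
  thus ?thesis by (simp add: measure_unif_sphere[OF A])
qed

text \<open>Disjoint translates of the shell over the set in direction \<open>q\<close> all fit into one ball.\<close>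
lemma sphere_slab_upper:
  assumes x: "ip d x x \<le> 1" and q: "ip d q q = 1" and b: "\<bar>ip d x q\<bar> \<le> b"
    and A: "0 \<le> A" "A^2 + B^2 \<le> 1/2" and B: "0 \<le> B" and D: "0 \<le> D"
    and h: "1 / real d \<le> h" "h < 1" "d > 0"
    and om: "D + B * h < om" "real M * om \<le> sg" and M: "M > 0"
  shows "measure (unif_sphere d) {y \<in> space (Rd d). A \<le> ip d y x \<and> B \<le> ip d y q \<and> ip d y q \<le> B + D}
    \<le> 2 / real M * exp (- ((A^2 + B^2 - 2 * A * B * b - 2 * sg * (D + A * b) - sg^2) * real d / 2))"
proof -
  let ?K = "{y \<in> space (Rd d). A \<le> ip d y x \<and> B \<le> ip d y q \<and> ip d y q \<le> B + D}"
  define E where "E = A^2 + B^2 - 2 * A * B * b - 2 * sg * (D + A * b) - sg^2"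
  define V where "V = ballvol d"
  define C where "C = cone d ?K"
  define r where "r = 1 - h"
  define w where "w = (\<lambda>i. A * x i + B * q i)"
  have h0: "h > 0" using h by (smt (verit) divide_pos_pos of_nat_0_less_iff)
  have r: "0 < r" "r < 1" using h h0 by (auto simp: r_def)
  have K: "?K \<in> sets (Rd d)" by measurable
  have Cs: "C \<in> sets (Rd d)" unfolding C_def by (rule cone_sets[OF K])
  have Cf: "C \<in> fmeasurable (Rd d)" unfolding C_def by (rule cone_fmeasurable[OF K])
  \<comment> \<open>\<open>C'\<close> is the cone \<open>C\<close> shrunk by the factor
    \<open>r = 1 - h\<close>. Since \<open>h * d \<ge> 1\<close>, it has at most half of the volume,
    so the remaining shell \<open>S\<close> carries at least half.\<close>
  define C' where "C' = {y \<in> C. ip d y y \<le> r^2}"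
  define S where "S = {y \<in> C. ip d y y > r^2}"
  have Csp: "C \<subseteq> space (Rd d)" by (auto simp: C_def cone_def uball_def)
  have C's: "C' \<in> sets (Rd d)"
  proof -
    have "C' = C \<inter> {y \<in> space (Rd d). ip d y y \<le> r^2}" using Csp by (auto simp: C'_def)
    thus ?thesis using Cs by simp
  qed
  have Ss: "S \<in> sets (Rd d)"
  proof -
    have "S = C - C'" by (auto simp: C'_def S_def)
    thus ?thesis using Cs C's by simp
  qed
  have Sf: "S \<in> fmeasurable (Rd d)"
    by (rule fmeasurable_subset_uball) (use Ss in \<open>auto simp: S_def C_def cone_def\<close>)
  have C'f: "C' \<in> fmeasurable (Rd d)"
    by (rule fmeasurable_subset_uball) (use C's in \<open>auto simp: C'_def C_def cone_def\<close>)
  have ipr: "ip d (aff d r (\<lambda>_. 0) z) (aff d r (\<lambda>_. 0) z) = r^2 * ip d z z" for z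
    by (simp add: ip_aff_left ip_aff_right power2_eq_square) (simp add: ip_def)
  have "{z \<in> space (Rd d). aff d r (\<lambda>_. 0) z \<in> C'} = C"
  proof -
    have "aff d r (\<lambda>_. 0) z \<in> C' \<longleftrightarrow> z \<in> C" if z: "z \<in> space (Rd d)" for z
    proof -
      have "r^2 * t \<le> r^2 \<longleftrightarrow> t \<le> 1" for t :: real using r by simp
      moreover have "r^2 \<le> 1" using r by (simp add: power_le_one)
      ultimately have "r^2 * t \<le> 1 \<and> r^2 * t \<le> r^2 \<longleftrightarrow> t \<le> 1" for t :: real
        by (meson order_trans)
      thus ?thesis using z r by (auto simp: C'_def C_def cone_def uball_def ipr ip_proj_scale)
    qed
    thus ?thesis using Csp by auto
  qed
  hence C'm: "measure (Rd d) C' = r^d * measure (Rd d) C"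
    using measure_aff[OF _ C's, of r "\<lambda>_. 0"] r by simp
  have "r^d \<le> 1/2"
  proof -
    have "r \<le> exp (- h)" unfolding r_def using exp_ge_add_one_self[of "-h"] by simp
    hence "r^d \<le> exp (- h)^d" using r by (intro power_mono) auto
    also have "\<dots> = exp (- (h * real d))" by (simp add: exp_of_nat_mult[symmetric] mult.commute)
    also have "\<dots> \<le> exp (-1)" using h by (simp add: field_simps)
    also have "\<dots> \<le> 1/2" using exp_ge_add_one_self[of 1] by (simp add: exp_minus field_simps)
    finally show ?thesis .
  qed
  hence "measure (Rd d) C' \<le> 1/2 * measure (Rd d) C" unfolding C'm by (intro mult_right_mono) auto
  moreover have "measure (Rd d) C \<le> measure (Rd d) C' + measure (Rd d) S"
  proof -
    have "C = C' \<union> S" by (auto simp: C'_def S_def)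
    thus ?thesis using measure_Un_le[OF C's Ss] by simp
  qed
  ultimately have SC: "measure (Rd d) C \<le> 2 * measure (Rd d) S" by simp
  \<comment> \<open>On the shell the inner product with \<open>q\<close> ranges between
    \<open>B - B * h\<close> and \<open>B + D\<close>. Translating by multiples of
    \<open>om > D + B * h\<close> along \<open>q\<close> therefore gives disjoint copies.\<close>
  define T where "T k = {y \<in> space (Rd d). aff d 1 (\<lambda>i. (- (real k * om)) * q i) y \<in> S}" for k :: nat
  have Tm: "measure (Rd d) (T k) = measure (Rd d) S" for k
    using measure_aff[OF _ Ss, of 1] by (simp add: T_def)
  have Tf: "T k \<in> fmeasurable (Rd d)" for k unfolding T_def by (rule fmeasurable_aff[OF _ Sf]) simp
  have om0: "om > 0" using om D B h0 by (smt (verit) mult_nonneg_nonneg)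
  have Sq: "B * r \<le> ip d y q \<and> ip d y q \<le> B + D" if "y \<in> S" for y
  proof -
    define n where "n = sqrt (ip d y y)"
    have n: "r \<le> n" "n \<le> 1" using that r real_le_rsqrt[of r "ip d y y"]
      by (auto simp: n_def S_def C_def cone_def uball_def)
    let ?p = "ip d (proj d y) q"
    have p: "B \<le> ?p" "?p \<le> B + D" using that by (auto simp: S_def C_def cone_def)
    have e: "ip d y q = n * ?p" unfolding n_def by (rule ip_eq_norm_proj)
    have "B * r \<le> ?p * n" using p n r B by (intro mult_mono) auto
    moreover have "n * ?p \<le> ?p" using p n r B by (intro mult_left_le_one_le) auto
    ultimately show ?thesis using p e by (simp add: mult.commute)
  qed
  have Tq: "real k * om + B * r \<le> ip d y q \<and> ip d y q \<le> real k * om + B + D" if "y \<in> T k" for y k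
  proof -
    have "ip d (aff d 1 (\<lambda>i. (- (real k * om)) * q i) y) q = ip d y q - real k * om"
      by (simp only: ip_aff_left ip_scale_left q)
    thus ?thesis using Sq[of "aff d 1 (\<lambda>i. (- (real k * om)) * q i) y"] that by (simp add: T_def)
  qed
  have lt_disj: "T i \<inter> T j = {}" if "i < j" for i j
  proof (rule ccontr)
    assume "T i \<inter> T j \<noteq> {}"
    then obtain y where y: "y \<in> T i" "y \<in> T j" by auto
    have "real j * om + B * r \<le> real i * om + B + D" using Tq[OF y(1)] Tq[OF y(2)] by simp
    moreover have "B * r = B - B * h" by (simp add: r_def algebra_simps)
    moreover have "(real i + 1) * om \<le> real j * om" using that om0 by (intro mult_right_mono) auto
    ultimately show False using om by (simp add: algebra_simps)
  qed
  have disj: "disjoint_family_on T {..<M}"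
    unfolding disjoint_family_on_def by (metis inf_commute lt_disj linorder_neqE_nat)
  have "measure (Rd d) (\<Union>k<M. T k) = (\<Sum>k<M. measure (Rd d) (T k))"
    using Tf disj by (intro measure_finite_Union) (auto simp: fmeasurable_def image_subset_iff less_top)
  hence U: "measure (Rd d) (\<Union>k<M. T k) = real M * measure (Rd d) S" by (simp add: Tm)
  let ?R = "exp (- E / 2)"
  have R2: "?R^2 = exp (- E)" by (simp add: power2_eq_square exp_add[symmetric])
  let ?B = "{y \<in> space (Rd d). ip d (aff d 1 (\<lambda>i. - w i) y) (aff d 1 (\<lambda>i. - w i) y) \<le> ?R^2}"
  \<comment> \<open>For \<open>z = y + s q\<close> with \<open>y\<close> in the shell, the squared
    distance from \<open>w\<close> grows by \<open>2 * s\<close> times the inner product of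
    \<open>y - w\<close> with \<open>q\<close>, plus \<open>s^2\<close>. As
    \<open>s \<le> sg\<close>, this growth and the error from the correlation of \<open>x\<close>
    and \<open>q\<close> are exactly the corrections subtracted in \<open>E\<close>.\<close>
  have "(\<Union>k<M. T k) \<subseteq> ?B"
  proof
    fix z assume "z \<in> (\<Union>k<M. T k)"
    then obtain k where k: "k < M" and z: "z \<in> T k" by auto
    define s where "s = real k * om"
    have s: "0 \<le> s" "s \<le> sg"
    proof -
      have "real k * om \<le> real M * om" using k om0 by (intro mult_right_mono) auto
      thus "s \<le> sg" using om by (simp add: s_def)
    qed (use om0 in \<open>simp add: s_def\<close>)
    define y where "y = aff d 1 (\<lambda>i. (- s) * q i) z"
    have y: "y \<in> S" using z by (simp add: T_def y_def s_def)
    have yq: "ip d y q = ip d z q - s" unfolding y_def by (simp only: ip_aff_left ip_scale_left q)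
    have yw: "ip d y v = ip d z v - s * ip d q v" for v unfolding y_def by (simp only: ip_aff_left ip_scale_left)
    have yy: "ip d y y = ip d z z - 2 * s * ip d z q + s^2"
      unfolding y_def by (simp only: ip_aff_left ip_aff_right ip_scale_left ip_scale_right q ip_commute[of d q z])
        (simp add: algebra_simps power2_eq_square)
    have qw: "ip d q w = A * ip d x q + B" unfolding w_def ip_comb_right q by (simp add: ip_commute)
    have ww: "ip d w w = A^2 * ip d x x + 2 * A * B * ip d x q + B^2"
      unfolding w_def ip_comb_left ip_comb_right q
      by (simp add: ip_commute[of d q x] algebra_simps power2_eq_square)
    have "A^2 * ip d x x \<le> A^2" using x mult_left_mono[of "ip d x x" 1 "A^2"] by simp
    moreover have "A * B * ip d x q \<le> A * B * b" using b A B by (intro mult_left_mono) auto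
    ultimately have ww': "ip d w w \<le> A^2 + B^2 + 2 * A * B * b" using ww by simp
    have pw: "A^2 + B^2 \<le> ip d (proj d y) w"
    proof -
      have "A * A \<le> A * ip d (proj d y) x" "B * B \<le> B * ip d (proj d y) q"
        using y A B by (auto simp: S_def C_def cone_def intro!: mult_left_mono)
      thus ?thesis unfolding w_def ip_comb_right by (simp add: power2_eq_square)
    qed
    have *: "ip d y y - 2 * ip d y w + ip d w w \<le> 1 - 2 * (A^2 + B^2) + ip d w w"
      using y A pw by (intro dist_cone_point) (auto simp: S_def C_def cone_def)
    have "s * (ip d y q - ip d q w) \<le> s * (D + A * b)"
    proof -
      have "A * (- ip d x q) \<le> A * b" using b A by (intro mult_left_mono) auto
      thus ?thesis using s Sq[OF y] qw by (intro mult_left_mono) auto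
    qed
    also have "\<dots> \<le> sg * (D + A * b)" using s D A b by (intro mult_right_mono add_nonneg_nonneg mult_nonneg_nonneg) auto
    finally have **: "s * (ip d y q - ip d q w) \<le> sg * (D + A * b)" .
    have "s^2 \<le> sg^2" using s by (intro power_mono) auto
    moreover have "ip d z z - 2 * ip d z w + ip d w w = ip d y y - 2 * ip d y w + ip d w w + 2 * (s * (ip d y q - ip d q w)) + s^2"
      unfolding yy yq yw[of w] by (simp add: algebra_simps power2_eq_square)
    ultimately have "ip d z z - 2 * ip d z w + ip d w w \<le> 1 + - E"
      using * ** ww' unfolding E_def by (simp add: algebra_simps)
    also have "\<dots> \<le> ?R^2" unfolding R2 by (rule exp_ge_add_one_self)
    finally show "z \<in> ?B" using z by (simp add: ip_diff_self T_def)
  qed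
  moreover have "(\<Union>k<M. T k) \<in> sets (Rd d)" using Tf by auto
  ultimately have "measure (Rd d) (\<Union>k<M. T k) \<le> measure (Rd d) ?B"
    by (intro measure_mono_fmeasurable fmeasurable_ball)
  also have "\<dots> = ?R^d * V" unfolding V_def by (rule measure_ball) simp
  finally have "real M * measure (Rd d) S \<le> exp (- (E * real d / 2)) * V" unfolding U exp_half_power .
  hence "measure (Rd d) S \<le> exp (- (E * real d / 2)) * V / real M" using M by (simp add: field_simps)
  hence "measure (Rd d) C \<le> 2 * (exp (- (E * real d / 2)) * V / real M)" using SC by linarith
  hence "measure (Rd d) C \<le> 2 / real M * exp (- (E * real d / 2)) * V" by simp
  thus ?thesis unfolding unif_sphere_le_iff[OF K] C_def V_def E_def .
qed

section \<open>Integrating out independent coordinates\<close>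

text \<open>Fubini in the coordinate \<open>b\<close>: by \<open>inv\<close>, on each fibre the
  condition \<open>A\<close> holds everywhere or nowhere. In the first case \<open>B\<close> has
  fibre measure at most \<open>p\<close>, in the second the fibre contributes nothing. This replaces
  conditional probabilities throughout.\<close>

lemma measure_PiM_peel:
  fixes N :: "'a measure" and b :: "'i"
  assumes N: "prob_space N" and J: "finite J" "b \<in> J" and p: "0 \<le> p"
    and A: "{\<xi> \<in> space (PiM J (\<lambda>_. N)). A \<xi>} \<in> sets (PiM J (\<lambda>_. N))"
    and AB: "{\<xi> \<in> space (PiM J (\<lambda>_. N)). A \<xi> \<and> B \<xi>} \<in> sets (PiM J (\<lambda>_. N))"
    and inv: "\<And>\<xi> y. A \<xi> \<Longrightarrow> A (\<xi>(b := y))"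
    and bound: "\<And>\<xi>. \<xi> \<in> space (PiM J (\<lambda>_. N)) \<Longrightarrow> A \<xi> \<Longrightarrow> measure N {y \<in> space N. B (\<xi>(b := y))} \<le> p"
  shows "measure (PiM J (\<lambda>_. N)) {\<xi> \<in> space (PiM J (\<lambda>_. N)). A \<xi> \<and> B \<xi>}
    \<le> p * measure (PiM J (\<lambda>_. N)) {\<xi> \<in> space (PiM J (\<lambda>_. N)). A \<xi>}"
proof -
  interpret N: prob_space N by (rule N)
  interpret product_sigma_finite "\<lambda>_. N" ..
  let ?M = "PiM J (\<lambda>_. N)" and ?M' = "PiM (J - {b}) (\<lambda>_. N)"
  interpret P: prob_space ?M by (rule prob_space_PiM) (rule N)
  have Jb: "insert b (J - {b}) = J" using J by auto
  let ?A = "{\<xi> \<in> space ?M. A \<xi>}" and ?C = "{\<xi> \<in> space ?M. A \<xi> \<and> B \<xi>}"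
  have int: "emeasure ?M S = (\<integral>\<^sup>+ w. \<integral>\<^sup>+ y. indicator S (w(b := y)) \<partial>N \<partial>?M')" if "S \<in> sets ?M" for S
  proof -
    have "emeasure ?M S = (\<integral>\<^sup>+ w. indicator S w \<partial>(PiM (insert b (J - {b})) (\<lambda>_. N)))"
      unfolding Jb using that by simp
    also have "\<dots> = (\<integral>\<^sup>+ w. \<integral>\<^sup>+ y. indicator S (w(b := y)) \<partial>N \<partial>?M')"
      by (rule product_nn_integral_insert) (use J that in \<open>auto simp: Jb simp del: insert_Diff_single\<close>)
    finally show ?thesis .
  qed
  have upd [measurable]: "(\<lambda>y. w(b := y)) \<in> measurable N ?M" if "w \<in> space ?M'" for w
    using measurable_fun_upd[of J "J - {b}" b "\<lambda>_. w" N "\<lambda>_. N" "\<lambda>y. y"] J that by auto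
  have upd2: "(\<lambda>(w, y). w(b := y)) \<in> measurable (?M' \<Otimes>\<^sub>M N) ?M"
    using measurable_add_dim[of b "J - {b}" "\<lambda>_. N"] unfolding Jb .
  have "emeasure ?M ?C \<le> (\<integral>\<^sup>+ w. ennreal p * (\<integral>\<^sup>+ y. indicator ?A (w(b := y)) \<partial>N) \<partial>?M')"
    unfolding int[OF AB]
  proof (rule nn_integral_mono)
    fix w assume w: "w \<in> space ?M'"
    have sp: "w(b := y) \<in> space ?M" if "y \<in> space N" for y
      using measurable_space[OF upd[OF w] that] .
    have sec: "{y \<in> space N. w(b := y) \<in> S} \<in> sets N" if "S \<in> sets ?M" for S
      using measurable_sets[OF upd[OF w] that] by (simp add: vimage_def Collect_conj_eq Int_commute)
    have ind: "(\<integral>\<^sup>+ y. indicator S (w(b := y)) \<partial>N) = emeasure N {y \<in> space N. w(b := y) \<in> S}" if "S \<in> sets ?M" for S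
    proof -
      have "(\<integral>\<^sup>+ y. indicator S (w(b := y)) \<partial>N) = (\<integral>\<^sup>+ y. indicator {y \<in> space N. w(b := y) \<in> S} y \<partial>N)"
        by (intro nn_integral_cong) (auto simp: indicator_def)
      thus ?thesis using sec[OF that] by simp
    qed
    show "(\<integral>\<^sup>+ y. indicator ?C (w(b := y)) \<partial>N) \<le> ennreal p * (\<integral>\<^sup>+ y. indicator ?A (w(b := y)) \<partial>N)"
    proof (cases "\<exists>y0 \<in> space N. A (w(b := y0))")
      case True
      then obtain y0 where y0: "y0 \<in> space N" "A (w(b := y0))" by auto
      have Aall: "A (w(b := y))" for y using inv[OF y0(2), of y] by simp
      have "{y \<in> space N. w(b := y) \<in> ?A} = space N" using Aall sp by auto
      hence 1: "(\<integral>\<^sup>+ y. indicator ?A (w(b := y)) \<partial>N) = 1" using ind[OF A] N.emeasure_space_1 by simp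
      have "{y \<in> space N. w(b := y) \<in> ?C} = {y \<in> space N. B ((w(b := y0))(b := y))}" using Aall sp by auto
      hence "(\<integral>\<^sup>+ y. indicator ?C (w(b := y)) \<partial>N) \<le> ennreal p"
        using ind[OF AB] bound[OF sp[OF y0(1)] y0(2)] p by (simp add: N.emeasure_eq_measure)
      thus ?thesis using 1 by simp
    next
      case False
      hence empty: "{y \<in> space N. w(b := y) \<in> ?C} = {}" by auto
      show ?thesis unfolding ind[OF AB] empty by simp
    qed
  qed
  also have "\<dots> = ennreal p * emeasure ?M ?A"
    unfolding int[OF A]
  proof (rule nn_integral_cmult)
    have "(\<lambda>(w, y). indicator ?A (w(b := y)) :: ennreal) \<in> borel_measurable (?M' \<Otimes>\<^sub>M N)"
      using measurable_compose[OF upd2 borel_measurable_indicator[OF A]] by (simp add: split_beta')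
    thus "(\<lambda>w. \<integral>\<^sup>+ y. indicator ?A (w(b := y)) \<partial>N) \<in> borel_measurable ?M'"
      by (intro N.borel_measurable_nn_integral) auto
  qed
  finally show ?thesis
    using p by (simp add: P.emeasure_eq_measure ennreal_mult[symmetric] mult_nonneg_nonneg)
qed

text \<open>Points \<open>1..<n\<close> are i.i.d.; the point with index 0 is held fixed at \<open>x0\<close>.\<close>
locale iid_points = prob_space N for N :: "'a measure" +
  fixes n :: nat and x0 :: 'a
  assumes x0: "x0 \<in> space N"
begin

abbreviation pts :: "(nat \<Rightarrow> 'a) \<Rightarrow> nat \<Rightarrow> 'a" where "pts \<xi> \<equiv> \<xi>(0 := x0)"

definition \<Omega> :: "(nat \<Rightarrow> 'a) measure" where "\<Omega> = PiM {1..<n} (\<lambda>_. N)"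

sublocale Om: prob_space \<Omega>
  unfolding \<Omega>_def by (rule prob_space_PiM) unfold_locales

lemma measurable_pt [measurable]:
  assumes "i < n"
  shows "(\<lambda>\<xi>. pts \<xi> i) \<in> measurable \<Omega> N"
proof (cases "i = 0")
  case True
  thus ?thesis using x0 by simp
next
  case False
  thus ?thesis using assms unfolding \<Omega>_def by (simp add: measurable_component_singleton)
qed

lemma pt_space: "\<xi> \<in> space \<Omega> \<Longrightarrow> i < n \<Longrightarrow> pts \<xi> i \<in> space N"
  using measurable_space[OF measurable_pt] by blast

lemma pred_pt: "Measurable.pred N Q \<Longrightarrow> i < n \<Longrightarrow> Measurable.pred \<Omega> (\<lambda>\<xi>. Q (pts \<xi> i))"
  by (rule measurable_compose[OF measurable_pt])

lemma pred_pt2: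
  assumes "Measurable.pred (N \<Otimes>\<^sub>M N) (\<lambda>(x, y). R x y)" "i < n" "j < n"
  shows "Measurable.pred \<Omega> (\<lambda>\<xi>. R (pts \<xi> i) (pts \<xi> j))"
  using measurable_compose[OF measurable_Pair[OF measurable_pt[OF assms(2)] measurable_pt[OF assms(3)]] assms(1)]
  by simp

section \<open>Probability bounds by exposing one point at a time\<close>

lemma peel:
  assumes b: "0 < b" "b < n" and p: "0 \<le> p"
    and A: "Measurable.pred \<Omega> A" and B: "Measurable.pred \<Omega> B"
    and inv: "\<And>\<xi> y. A \<xi> \<Longrightarrow> A (\<xi>(b := y))"
    and bound: "\<And>\<xi>. \<xi> \<in> space \<Omega> \<Longrightarrow> A \<xi> \<Longrightarrow> prob {y \<in> space N. B (\<xi>(b := y))} \<le> p"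
  shows "Om.prob {\<xi> \<in> space \<Omega>. A \<xi> \<and> B \<xi>} \<le> p * Om.prob {\<xi> \<in> space \<Omega>. A \<xi>}"
  unfolding \<Omega>_def
proof (rule measure_PiM_peel)
  show "{\<xi> \<in> space (Pi\<^sub>M {1..<n} (\<lambda>_. N)). A \<xi>} \<in> sets (Pi\<^sub>M {1..<n} (\<lambda>_. N))"
    "{\<xi> \<in> space (Pi\<^sub>M {1..<n} (\<lambda>_. N)). A \<xi> \<and> B \<xi>} \<in> sets (Pi\<^sub>M {1..<n} (\<lambda>_. N))"
    using A B unfolding \<Omega>_def[symmetric] by measurable
  show "prob {y \<in> space N. B (\<xi>(b := y))} \<le> p" if "\<xi> \<in> space (Pi\<^sub>M {1..<n} (\<lambda>_. N))" "A \<xi>" for \<xi>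
    using bound that unfolding \<Omega>_def .
qed (use b p inv in \<open>simp_all add: prob_space_axioms\<close>)

text \<open>Once the centre \<open>i\<close> is exposed, the leaves in \<open>T\<close> are
  independent and are peeled off one by one. The centre may be the fixed point 0; the leaves are
  always random.\<close>

lemma star_bound:
  assumes R: "Measurable.pred (N \<Otimes>\<^sub>M N) (\<lambda>(x, y). R x y)" and Q: "Measurable.pred N Q"
    and i: "i < n" "i \<notin> T" and T: "T \<subseteq> {1..<n}" and p: "0 \<le> p"
    and bound: "\<And>x. x \<in> space N \<Longrightarrow> Q x \<Longrightarrow> prob {y \<in> space N. R x y} \<le> p"
  shows "Om.prob {\<xi> \<in> space \<Omega>. Q (pts \<xi> i) \<and> (\<forall>j\<in>T. R (pts \<xi> i) (pts \<xi> j))} \<le> p ^ card T"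
proof -
  have "finite T" using T finite_subset by blast
  thus ?thesis using i T
  proof (induction T rule: finite_induct)
    case empty
    show ?case by simp
  next
    case (insert b T)
    let ?A = "\<lambda>\<xi>. Q (pts \<xi> i) \<and> (\<forall>j\<in>T. R (pts \<xi> i) (pts \<xi> j))"
    let ?B = "\<lambda>\<xi>. R (pts \<xi> i) (pts \<xi> b)"
    have b: "0 < b" "b < n" "b \<noteq> i" "b \<notin> T" using insert by auto
    have [measurable]: "Measurable.pred \<Omega> (\<lambda>\<xi>. Q (pts \<xi> i))" by (rule pred_pt[OF Q i(1)])
    have Tn: "j < n" if "j \<in> T" for j using that insert by auto
    have mA: "Measurable.pred \<Omega> ?A"
      by (intro pred_intros_logic pred_intros_finite insert pred_pt[OF Q i(1)] pred_pt2[OF R i(1) Tn]) auto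
    have mB: "Measurable.pred \<Omega> ?B" using pred_pt2[OF R i(1) b(2)] .
    have "Om.prob {\<xi> \<in> space \<Omega>. ?A \<xi> \<and> ?B \<xi>} \<le> p * Om.prob {\<xi> \<in> space \<Omega>. ?A \<xi>}"
    proof (rule peel[OF b(1,2) p mA mB])
      fix \<xi> y assume "?A \<xi>"
      thus "?A (\<xi>(b := y))" using b by (cases "i = 0") auto
    next
      fix \<xi> assume w: "\<xi> \<in> space \<Omega>" "?A \<xi>"
      show "prob {y \<in> space N. ?B (\<xi>(b := y))} \<le> p"
        using bound[OF pt_space[OF w(1) i(1)]] w(2) b by (cases "i = 0") auto
    qed
    also have "\<dots> \<le> p * p ^ card T" using insert p by (intro mult_left_mono) auto
    also have "\<dots> = p ^ card (insert b T)" using insert by simp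
    finally show ?case by (simp add: conj_ac)
  qed
qed

lemma point_bound:
  assumes R: "Measurable.pred N R" and b: "0 < b" "b < n" and bound: "prob {y \<in> space N. R y} \<le> p"
  shows "Om.prob {\<xi> \<in> space \<Omega>. R (pts \<xi> b)} \<le> p"
proof -
  have "Measurable.pred (N \<Otimes>\<^sub>M N) (\<lambda>(x, y). R y)" using R by measurable
  moreover have "0 \<le> p" using bound measure_nonneg order_trans by blast
  ultimately show ?thesis
    using star_bound[of "\<lambda>_ y. R y" "\<lambda>_. True" 0 "{b}" p] b bound by simp
qed

lemma sets_Bex:
  assumes "finite F" "\<And>t. t \<in> F \<Longrightarrow> Measurable.pred \<Omega> (E t)"
  shows "{\<xi> \<in> space \<Omega>. \<exists>t\<in>F. E t \<xi>} \<in> sets \<Omega>"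
proof -
  have "{\<xi> \<in> space \<Omega>. \<exists>t\<in>F. E t \<xi>} = (\<Union>t\<in>F. {\<xi> \<in> space \<Omega>. E t \<xi>})" by blast
  also have "\<dots> \<in> sets \<Omega>" using assms by (intro sets.finite_UN) (auto simp: pred_def)
  finally show ?thesis .
qed

lemma union_bound:
  assumes "finite F" "\<And>t. t \<in> F \<Longrightarrow> Measurable.pred \<Omega> (E t)"
    "\<And>t. t \<in> F \<Longrightarrow> Om.prob {\<xi> \<in> space \<Omega>. E t \<xi>} \<le> p" "real (card F) * p \<le> c"
  shows "Om.prob {\<xi> \<in> space \<Omega>. \<exists>t\<in>F. E t \<xi>} \<le> c"
proof -
  have "{\<xi> \<in> space \<Omega>. \<exists>t\<in>F. E t \<xi>} = (\<Union>t\<in>F. {\<xi> \<in> space \<Omega>. E t \<xi>})" by auto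
  also have "Om.prob \<dots> \<le> (\<Sum>t\<in>F. Om.prob {\<xi> \<in> space \<Omega>. E t \<xi>})"
    using assms(1,2) by (intro Om.finite_measure_subadditive_finite) (auto simp: pred_def)
  also have "\<dots> \<le> real (card F) * p" using assms(3) by (rule sum_bounded_above)
  finally show ?thesis using assms(4) by simp
qed

lemma measurable_card_filter:
  assumes "finite F" "\<And>t. t \<in> F \<Longrightarrow> Measurable.pred \<Omega> (E t)"
  shows "(\<lambda>\<xi>. card {t \<in> F. E t \<xi>}) \<in> measurable \<Omega> (count_space UNIV)"
proof -
  have "card {t \<in> F. E t \<xi>} = (\<Sum>t\<in>F. if E t \<xi> then 1 else 0)" for \<xi>
    using assms(1) by (subst sum.inter_filter[symmetric]) simp_all
  moreover have "(\<lambda>\<xi>. \<Sum>t\<in>F. if E t \<xi> then 1 else (0 :: nat)) \<in> measurable \<Omega> (count_space UNIV)"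
    using assms(2) by (intro measurable_sum_nat measurable_If) auto
  ultimately show ?thesis by simp
qed

text \<open>Measurability is bundled with the bound, so that rare events can be joined without
  proving measurability again for each union.\<close>

definition rare :: "((nat \<Rightarrow> 'a) \<Rightarrow> bool) \<Rightarrow> real \<Rightarrow> bool" where
  "rare E p \<longleftrightarrow> {\<xi> \<in> space \<Omega>. E \<xi>} \<in> sets \<Omega> \<and> Om.prob {\<xi> \<in> space \<Omega>. E \<xi>} \<le> p"

lemma rareI: "Measurable.pred \<Omega> E \<Longrightarrow> Om.prob {\<xi> \<in> space \<Omega>. E \<xi>} \<le> p \<Longrightarrow> rare E p"
  by (simp add: rare_def pred_def)

lemma rare_mono: "rare E p \<Longrightarrow> p \<le> p' \<Longrightarrow> rare E p'"
  by (auto simp: rare_def)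

lemma rare_disj:
  assumes "rare E p" "rare F p'"
  shows "rare (\<lambda>\<xi>. E \<xi> \<or> F \<xi>) (p + p')"
proof -
  have e: "{\<xi> \<in> space \<Omega>. E \<xi> \<or> F \<xi>} = {\<xi> \<in> space \<Omega>. E \<xi>} \<union> {\<xi> \<in> space \<Omega>. F \<xi>}" by blast
  have "Om.prob ({\<xi> \<in> space \<Omega>. E \<xi>} \<union> {\<xi> \<in> space \<Omega>. F \<xi>})
      \<le> Om.prob {\<xi> \<in> space \<Omega>. E \<xi>} + Om.prob {\<xi> \<in> space \<Omega>. F \<xi>}"
    using assms by (intro measure_Un_le) (auto simp: rare_def)
  also have "\<dots> \<le> p + p'" using assms by (intro add_mono) (auto simp: rare_def)
  finally show ?thesis using assms by (auto simp: rare_def e)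
qed

lemma rare_Bex:
  assumes "finite F" "\<And>t. t \<in> F \<Longrightarrow> Measurable.pred \<Omega> (E t)"
    "\<And>t. t \<in> F \<Longrightarrow> Om.prob {\<xi> \<in> space \<Omega>. E t \<xi>} \<le> p" "real (card F) * p \<le> c"
  shows "rare (\<lambda>\<xi>. \<exists>t\<in>F. E t \<xi>) c"
  unfolding rare_def using sets_Bex[where E = E, OF assms(1,2)] union_bound[where E = E, OF assms] by simp

text \<open>By linearity the expected count is at most \<open>card F * p\<close>, however the events
  depend on each other; Markov's inequality does the rest.\<close>

lemma markov_card:
  assumes "finite F" "\<And>t. t \<in> F \<Longrightarrow> Measurable.pred \<Omega> (E t)"
    "\<And>t. t \<in> F \<Longrightarrow> Om.prob {\<xi> \<in> space \<Omega>. E t \<xi>} \<le> p" "0 < c"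
  shows "rare (\<lambda>\<xi>. c \<le> real (card {t \<in> F. E t \<xi>})) (real (card F) * p / c)"
proof -
  let ?u = "\<lambda>\<xi>. \<Sum>t\<in>F. indicator {\<xi> \<in> space \<Omega>. E t \<xi>} \<xi> :: real"
  have s: "{\<xi> \<in> space \<Omega>. E t \<xi>} \<in> sets \<Omega>" if "t \<in> F" for t using assms(2)[OF that] by (simp add: pred_def)
  have eq: "real (card {t \<in> F. E t \<xi>}) = ?u \<xi>" if "\<xi> \<in> space \<Omega>" for \<xi>
    using that assms(1) by (simp add: indicator_def sum.If_cases Int_def)
  have it: "integrable \<Omega> (\<lambda>\<xi>. indicator {\<xi> \<in> space \<Omega>. E t \<xi>} \<xi> :: real)" if "t \<in> F" for t
    using s[OF that] by (intro Om.integrable_const_bound[where B = 1]) (auto simp: indicator_def)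
  have int: "integrable \<Omega> ?u" by (rule Bochner_Integration.integrable_sum) (rule it)
  have "Om.prob {\<xi> \<in> space \<Omega>. c \<le> real (card {t \<in> F. E t \<xi>})} = Om.prob {\<xi> \<in> space \<Omega>. c \<le> ?u \<xi>}"
    using eq by (intro arg_cong[of _ _ "measure \<Omega>"]) auto
  also have "\<dots> \<le> (\<integral>\<xi>. ?u \<xi> \<partial>\<Omega>) / c"
    using int assms(4) by (intro integral_Markov_inequality_measure[where A = "{}"]) (auto intro!: sum_nonneg)
  also have "(\<integral>\<xi>. ?u \<xi> \<partial>\<Omega>) = (\<Sum>t\<in>F. Om.prob {\<xi> \<in> space \<Omega>. E t \<xi>})"
    using s by (subst Bochner_Integration.integral_sum[OF it]) (auto intro!: sum.cong)
  also have "\<dots> \<le> real (card F) * p" using assms(3) by (rule sum_bounded_above)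
  finally have b: "Om.prob {\<xi> \<in> space \<Omega>. c \<le> real (card {t \<in> F. E t \<xi>})} \<le> real (card F) * p / c"
    using assms(4) by (simp add: divide_right_mono)
  note [measurable] = measurable_card_filter[where E = E, OF assms(1,2)]
  have "Measurable.pred \<Omega> (\<lambda>\<xi>. c \<le> real (card {t \<in> F. E t \<xi>}))" by measurable
  thus ?thesis using b by (rule rareI)
qed

text \<open>A union bound over all \<open>k\<close>-subsets of leaves, of which there are at most
  \<open>n^k / k!\<close>. With \<open>k\<close> well above \<open>n * p\<close> it serves as a
  Chernoff bound.\<close>

lemma many_hits_bound:
  assumes R: "Measurable.pred (N \<Otimes>\<^sub>M N) (\<lambda>(x, y). R x y)"
    and i: "i < n" and p: "0 \<le> p"
    and bound: "\<And>x. x \<in> space N \<Longrightarrow> prob {y \<in> space N. R x y} \<le> p"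
  shows "Om.prob {\<xi> \<in> space \<Omega>. k \<le> card {j \<in> {1..<n} - {i}. R (pts \<xi> i) (pts \<xi> j)}}
    \<le> (real n * p) ^ k / fact k"
proof -
  let ?D = "{1..<n} - {i}"
  let ?F = "{T. T \<subseteq> ?D \<and> card T = k}"
  let ?E = "\<lambda>T \<xi>. \<forall>j\<in>T. R (pts \<xi> i) (pts \<xi> j)"
  have fin: "finite ?F" by simp
  have mE: "Measurable.pred \<Omega> (?E T)" if "T \<in> ?F" for T
  proof -
    have "finite T" using that finite_subset[of T ?D] by auto
    thus ?thesis using that by (intro pred_intros_finite pred_pt2[OF R i]) auto
  qed
  have bnd: "Om.prob {\<xi> \<in> space \<Omega>. \<exists>T\<in>?F. ?E T \<xi>} \<le> (real n * p) ^ k / fact k"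
  proof (rule union_bound[OF fin mE])
    fix T assume T: "T \<in> ?F"
    show "Om.prob {\<xi> \<in> space \<Omega>. ?E T \<xi>} \<le> p ^ k"
      using star_bound[OF R _ i _ _ p, of "\<lambda>_. True" T] T bound
      by (auto simp del: fun_upd_apply)
  next
    have "card ?F = card ?D choose k" by (rule n_subsets) simp
    moreover have "card ?D \<le> n" by (rule order_trans[OF card_mono[of "{1..<n}"]]) auto
    ultimately have "real (card ?F) \<le> real (n choose k)" using binomial_right_mono by simp
    also have "\<dots> * fact k \<le> real n ^ k"
      using binomial_fact_pow[of n k] by (metis of_nat_fact of_nat_le_iff of_nat_mult of_nat_power)
    hence "real (n choose k) \<le> real n ^ k / fact k" by (simp add: field_simps)
    finally have "real (card ?F) * p ^ k \<le> real n ^ k / fact k * p ^ k" using p by (intro mult_right_mono) auto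
    thus "real (card ?F) * p ^ k \<le> (real n * p) ^ k / fact k" by (simp add: power_mult_distrib)
  qed
  have sub: "{\<xi> \<in> space \<Omega>. k \<le> card {j \<in> ?D. R (pts \<xi> i) (pts \<xi> j)}}
     \<subseteq> {\<xi> \<in> space \<Omega>. \<exists>T\<in>?F. ?E T \<xi>}"
  proof
    fix \<xi> assume w: "\<xi> \<in> {\<xi> \<in> space \<Omega>. k \<le> card {j \<in> ?D. R (pts \<xi> i) (pts \<xi> j)}}"
    then obtain T where "T \<subseteq> {j \<in> ?D. R (pts \<xi> i) (pts \<xi> j)}" "card T = k"
      using obtain_subset_with_card_n by blast
    thus "\<xi> \<in> {\<xi> \<in> space \<Omega>. \<exists>T\<in>?F. ?E T \<xi>}" using w by blast
  qed
  have st: "{\<xi> \<in> space \<Omega>. \<exists>T\<in>?F. ?E T \<xi>} \<in> sets \<Omega>" by (rule sets_Bex[OF fin mE])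
  show ?thesis by (rule order_trans[OF Om.finite_measure_mono[OF sub st] bnd])
qed

text \<open>If fewer than \<open>r\<close> indices of an interval hit, one of its \<open>r\<close> blocks of length \<open>b\<close> contains no hit.\<close>
lemma few_hits_bound:
  assumes R: "Measurable.pred (N \<Otimes>\<^sub>M N) (\<lambda>(x, y). R x y)" and Q: "Measurable.pred N Q"
    and i: "i < n" "i \<notin> {l..<u}" and lu: "1 \<le> l" "u \<le> n" "l + r * b \<le> u" and p: "p \<le> 1"
    and bound: "\<And>x. x \<in> space N \<Longrightarrow> Q x \<Longrightarrow> p \<le> prob {y \<in> space N. R x y}"
  shows "Om.prob {\<xi> \<in> space \<Omega>. Q (pts \<xi> i) \<and> card {j \<in> {l..<u}. R (pts \<xi> i) (pts \<xi> j)} < r}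
    \<le> real r * (1 - p) ^ b"
proof -
  let ?B = "\<lambda>k. {l + k * b..<l + Suc k * b}"
  let ?E = "\<lambda>k \<xi>. Q (pts \<xi> i) \<and> (\<forall>j\<in>?B k. \<not> R (pts \<xi> i) (pts \<xi> j))"
  have Bsub: "?B k \<subseteq> {l..<u}" if "k < r" for k
  proof -
    have "Suc k * b \<le> r * b" using that by (intro mult_right_mono) auto
    thus ?thesis using lu by auto
  qed
  have nR: "Measurable.pred (N \<Otimes>\<^sub>M N) (\<lambda>(x, y). \<not> R x y)"
    using pred_intros_logic(2)[OF R] by (simp add: split_beta')
  have mE: "Measurable.pred \<Omega> (?E k)" if "k \<in> {..<r}" for k
    using that Bsub[of k] lu
    by (intro pred_intros_logic pred_intros_finite pred_pt[OF Q i(1)] pred_pt2[OF R i(1)]) auto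
  have bnd: "Om.prob {\<xi> \<in> space \<Omega>. \<exists>k\<in>{..<r}. ?E k \<xi>} \<le> real r * (1 - p) ^ b"
  proof (rule union_bound[OF _ mE])
    fix k assume k: "k \<in> {..<r}"
    have "Om.prob {\<xi> \<in> space \<Omega>. ?E k \<xi>} \<le> (1 - p) ^ card (?B k)"
    proof (rule star_bound[OF nR Q i(1)])
      fix x assume x: "x \<in> space N" "Q x"
      have "{y \<in> space N. R x y} \<in> events"
        using measurable_sets[OF measurable_compose[OF measurable_Pair1'[OF x(1)] R], of "{True}"]
        by (simp add: vimage_def Int_def conj_commute)
      moreover have "{y \<in> space N. \<not> R x y} = space N - {y \<in> space N. R x y}" by auto
      ultimately have "prob {y \<in> space N. \<not> R x y} = 1 - prob {y \<in> space N. R x y}"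
        using prob_compl[of "{y \<in> space N. R x y}"] by simp
      thus "prob {y \<in> space N. \<not> R x y} \<le> 1 - p" using bound[OF x] by simp
    qed (use k Bsub[of k] i lu p in auto)
    thus "Om.prob {\<xi> \<in> space \<Omega>. ?E k \<xi>} \<le> (1 - p) ^ b" by simp
  qed auto
  have sub: "{\<xi> \<in> space \<Omega>. Q (pts \<xi> i) \<and> card {j \<in> {l..<u}. R (pts \<xi> i) (pts \<xi> j)} < r}
      \<subseteq> {\<xi> \<in> space \<Omega>. \<exists>k\<in>{..<r}. ?E k \<xi>}"
  proof (intro subsetI, rule ccontr)
    fix \<xi> assume w: "\<xi> \<in> {\<xi> \<in> space \<Omega>. Q (pts \<xi> i) \<and> card {j \<in> {l..<u}. R (pts \<xi> i) (pts \<xi> j)} < r}"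
      and n: "\<xi> \<notin> {\<xi> \<in> space \<Omega>. \<exists>k\<in>{..<r}. ?E k \<xi>}"
    let ?H = "{j \<in> {l..<u}. R (pts \<xi> i) (pts \<xi> j)}"
    have "\<forall>k\<in>{..<r}. \<exists>j\<in>?B k. R (pts \<xi> i) (pts \<xi> j)" using w n by auto
    \<comment> \<open>One hit is picked from each block. The blocks are disjoint and ordered, so the
      picks are distinct and there are at least \<open>r\<close> hits.\<close>
    then obtain h where h: "\<And>k. k < r \<Longrightarrow> h k \<in> ?B k \<and> R (pts \<xi> i) (pts \<xi> (h k))"
      by (metis lessThan_iff)
    have lt: "h k < h k'" if "k < k'" "k' < r" for k k'
    proof -
      have "Suc k * b \<le> k' * b" using that by (intro mult_right_mono) auto
      thus ?thesis using h[of k] h[of k'] that by auto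
    qed
    have "inj_on h {..<r}" by (rule inj_onI) (metis lessThan_iff lt nat_neq_iff)
    moreover have "h ` {..<r} \<subseteq> ?H" using h Bsub by blast
    ultimately have "card {..<r} \<le> card ?H" by (intro card_inj_on_le) auto
    thus False using w by simp
  qed
  have st: "{\<xi> \<in> space \<Omega>. \<exists>k\<in>{..<r}. ?E k \<xi>} \<in> sets \<Omega>" by (rule sets_Bex[OF _ mE]) simp
  show ?thesis by (rule order_trans[OF Om.finite_measure_mono[OF sub st] bnd])
qed

lemma pred_chain:
  assumes R: "Measurable.pred (N \<Otimes>\<^sub>M N) (\<lambda>(x, y). R x y)" and "set xs \<subseteq> {1..<n}"
  shows "Measurable.pred \<Omega> (\<lambda>\<xi>. successively (\<lambda>i j. R (pts \<xi> i) (pts \<xi> j)) xs)"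
  using assms(2)
proof (induction xs rule: induct_list012)
  case (3 x y zs)
  have "Measurable.pred \<Omega> (\<lambda>\<xi>. R (pts \<xi> x) (pts \<xi> y))"
    using 3 by (intro pred_pt2[OF R]) auto
  thus ?case using 3 by simp
qed simp_all

text \<open>The last vertex of a distinct list occurs in no earlier relation, so it can be peeled
  off at cost \<open>p\<close>. Only the first vertex is free.\<close>

lemma chain_bound:
  assumes R: "Measurable.pred (N \<Otimes>\<^sub>M N) (\<lambda>(x, y). R x y)" and p: "0 \<le> p"
    and bound: "\<And>x. x \<in> space N \<Longrightarrow> prob {y \<in> space N. R x y} \<le> p"
    and xs: "distinct xs" "set xs \<subseteq> {1..<n}" "xs \<noteq> []"
  shows "Om.prob {\<xi> \<in> space \<Omega>. successively (\<lambda>i j. R (pts \<xi> i) (pts \<xi> j)) xs} \<le> p ^ (length xs - 1)"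
  using xs
proof (induction xs rule: rev_induct)
  case (snoc b xs)
  show ?case
  proof (cases "xs = []")
    case False
    let ?A = "\<lambda>\<xi>. successively (\<lambda>i j. R (pts \<xi> i) (pts \<xi> j)) xs"
    let ?B = "\<lambda>\<xi>. R (pts \<xi> (last xs)) (pts \<xi> b)"
    have b: "0 < b" "b < n" using snoc by auto
    have "last xs \<in> set xs" using False by simp
    hence l: "last xs < n" "last xs \<noteq> b" "last xs \<noteq> 0" using snoc.prems by (auto simp del: last_in_set)
    have "Om.prob {\<xi> \<in> space \<Omega>. ?A \<xi> \<and> ?B \<xi>} \<le> p * Om.prob {\<xi> \<in> space \<Omega>. ?A \<xi>}"
    proof (rule peel[OF b p pred_chain[OF R] pred_pt2[OF R l(1) b(2)]])
      show "set xs \<subseteq> {1..<n}" using snoc by simp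
      fix \<xi> y assume A: "?A \<xi>"
      have neq: "i \<noteq> b" if "i \<in> set xs" for i using snoc that by auto
      have "?A (\<xi>(b := y)) = ?A \<xi>"
        by (rule successively_cong) (use neq in \<open>simp_all add: fun_upd_def\<close>)
      with A show "?A (\<xi>(b := y))" by (rule rev_iffD2)
    next
      fix \<xi> assume w: "\<xi> \<in> space \<Omega>"
      show "prob {y \<in> space N. ?B (\<xi>(b := y))} \<le> p"
        using bound[OF pt_space[OF w l(1)]] b l by simp
    qed
    also have "\<dots> \<le> p * p ^ (length xs - 1)" using snoc False p by (intro mult_left_mono) auto
    also have "\<dots> = p ^ (length (xs @ [b]) - 1)" using False by (cases xs) auto
    finally show ?thesis using False by (simp add: successively_append_iff)
  qed simp
qed simp

text \<open>A union bound over at most \<open>n^(L+1)\<close> lists, each a chain with probability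
  at most \<open>p^L\<close>. If \<open>n * p\<close> is a negative power of \<open>n\<close>, a
  constant \<open>L\<close> already beats the leading factor \<open>n\<close>.\<close>

lemma no_chain_bound:
  assumes R: "Measurable.pred (N \<Otimes>\<^sub>M N) (\<lambda>(x, y). R x y)" and p: "0 \<le> p"
    and bound: "\<And>x. x \<in> space N \<Longrightarrow> prob {y \<in> space N. R x y} \<le> p"
  shows "rare (\<lambda>\<xi>. \<exists>xs\<in>{xs. set xs \<subseteq> {1..<n} \<and> length xs = Suc L \<and> distinct xs}.
      successively (\<lambda>i j. R (pts \<xi> i) (pts \<xi> j)) xs) (real n * (real n * p) ^ L)"
proof (rule rare_Bex)
  have f: "finite {xs. set xs \<subseteq> {1..<n} \<and> length xs = Suc L}" by (rule finite_lists_length_eq) simp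
  have sub: "{xs. set xs \<subseteq> {1..<n} \<and> length xs = Suc L \<and> distinct xs} \<subseteq> {xs. set xs \<subseteq> {1..<n} \<and> length xs = Suc L}" by auto
  show "finite {xs. set xs \<subseteq> {1..<n} \<and> length xs = Suc L \<and> distinct xs}" using finite_subset[OF sub f] .
  have "card {xs. set xs \<subseteq> {1..<n} \<and> length xs = Suc L \<and> distinct xs} \<le> card {1..<n} ^ Suc L"
    using card_mono[OF f sub] card_lists_length_eq[of "{1..<n}" "Suc L"] by simp
  also have "\<dots> \<le> n ^ Suc L" by (rule power_mono) auto
  finally have "real (card {xs. set xs \<subseteq> {1..<n} \<and> length xs = Suc L \<and> distinct xs}) \<le> real (n ^ Suc L)"
    by (simp only: of_nat_le_iff)
  hence "real (card {xs. set xs \<subseteq> {1..<n} \<and> length xs = Suc L \<and> distinct xs}) * p ^ L \<le> real (n ^ Suc L) * p ^ L"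
    using p by (intro mult_right_mono) auto
  thus "real (card {xs. set xs \<subseteq> {1..<n} \<and> length xs = Suc L \<and> distinct xs}) * p ^ L \<le> real n * (real n * p) ^ L"
    by (simp add: power_mult_distrib algebra_simps)
next
  fix xs assume xs: "xs \<in> {xs. set xs \<subseteq> {1..<n} \<and> length xs = Suc L \<and> distinct xs}"
  hence "xs \<noteq> []" by auto
  with xs show "Om.prob {\<xi> \<in> space \<Omega>. successively (\<lambda>i j. R (pts \<xi> i) (pts \<xi> j)) xs} \<le> p ^ L"
    using chain_bound[OF R p bound, of xs] by (auto simp del: fun_upd_apply)
qed (use pred_chain[OF R] in auto)

text \<open>The path \<open>j\<close>, \<open>i\<close>, \<open>k\<close> is exposed in this order,
  so that each relation is peeled off through its newest endpoint.\<close>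

lemma triple_bound:
  assumes Q: "Measurable.pred N Q" and R1: "Measurable.pred (N \<Otimes>\<^sub>M N) (\<lambda>(x, y). R1 x y)"
    and R2: "Measurable.pred (N \<Otimes>\<^sub>M N) (\<lambda>(x, y). R2 x y)"
    and p: "0 \<le> p0" "0 \<le> p1" "0 \<le> p2"
    and b0: "prob {y \<in> space N. Q y} \<le> p0"
    and b1: "\<And>x. x \<in> space N \<Longrightarrow> prob {y \<in> space N. R1 x y} \<le> p1"
    and b2: "\<And>x. x \<in> space N \<Longrightarrow> prob {y \<in> space N. R2 x y} \<le> p2"
    and ijk: "j \<in> {1..<n}" "i \<in> {1..<n}" "k \<in> {1..<n}" "i \<noteq> j" "k \<noteq> j" "k \<noteq> i"
  shows "Om.prob {\<xi> \<in> space \<Omega>. Q (pts \<xi> j) \<and> R1 (pts \<xi> j) (pts \<xi> i)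
      \<and> R2 (pts \<xi> i) (pts \<xi> k)} \<le> p2 * (p1 * p0)"
proof -
  have n: "j < n" "i < n" "k < n" using ijk by auto
  let ?A = "\<lambda>\<xi>. Q (pts \<xi> j)"
  let ?B = "\<lambda>\<xi>. R1 (pts \<xi> j) (pts \<xi> i)"
  let ?C = "\<lambda>\<xi>. R2 (pts \<xi> i) (pts \<xi> k)"
  note mA = pred_pt[OF Q n(1)] and mB = pred_pt2[OF R1 n(1,2)] and mC = pred_pt2[OF R2 n(2,3)]
  have 1: "Om.prob {\<xi> \<in> space \<Omega>. ?A \<xi>} \<le> p0" using ijk by (intro point_bound Q b0) auto
  have 2: "Om.prob {\<xi> \<in> space \<Omega>. ?A \<xi> \<and> ?B \<xi>} \<le> p1 * Om.prob {\<xi> \<in> space \<Omega>. ?A \<xi>}"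
  proof (rule peel[OF _ n(2) p(2) mA mB])
    fix \<xi> assume "\<xi> \<in> space \<Omega>"
    thus "prob {y \<in> space N. ?B (\<xi>(i := y))} \<le> p1" using b1[OF pt_space[of \<xi> j]] n ijk by auto
  qed (use ijk in auto)
  have 3: "Om.prob {\<xi> \<in> space \<Omega>. (?A \<xi> \<and> ?B \<xi>) \<and> ?C \<xi>} \<le> p2 * Om.prob {\<xi> \<in> space \<Omega>. ?A \<xi> \<and> ?B \<xi>}"
  proof (rule peel[OF _ n(3) p(3) pred_intros_logic(3)[OF mA mB] mC])
    fix \<xi> assume "\<xi> \<in> space \<Omega>"
    thus "prob {y \<in> space N. ?C (\<xi>(k := y))} \<le> p2" using b2[OF pt_space[of \<xi> i]] n ijk by auto
  qed (use ijk in auto)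
  also have "\<dots> \<le> p2 * (p1 * p0)"
    using 1 2 p by (intro mult_left_mono[OF order_trans[OF 2 mult_left_mono[OF 1]]]) auto
  finally show ?thesis by (simp add: conj_ac)
qed

end

lemma ip_comb_self:
  "ip d (\<lambda>i. a * x i + b * y i) (\<lambda>i. a * x i + b * y i) = a^2 * ip d x x + b^2 * ip d y y + 2 * (a * b * ip d x y)"
proof -
  have "ip d (\<lambda>i. a * x i + b * y i) (\<lambda>i. a * x i + b * y i)
    = (\<Sum>i<d. a^2 * (x i * x i) + b^2 * (y i * y i) + 2 * (a * b * (x i * y i)))"
    unfolding ip_def by (intro sum.cong) (auto simp: algebra_simps power2_eq_square)
  thus ?thesis by (simp add: ip_def sum.distrib sum_distrib_left mult.assoc)
qed

section \<open>Cap volumes as powers of n\<close>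

text \<open>The constant 3200 yields \<open>40 * \<mu> \<le> \<sigma>\<close> through
  \<open>\<mu>^2 \<le> 2 * ln n / d\<close>. The constant 24 serves twice: with the slack
  \<open>t = \<sigma> * \<mu> / 2\<close> it makes \<open>t^2 * d \<ge> 6\<close>, and it makes
  \<open>n powr \<sigma> \<ge> exp 24\<close>, large enough to absorb numerical factors up to
  25.\<close>

locale regime =
  fixes d n :: nat and \<sigma> \<mu> :: real
  assumes sg: "0 < \<sigma>" "\<sigma> \<le> 1/2" and n2: "2 \<le> n" and d0: "0 < d"
    and logn_upper: "3200 * ln (real n) \<le> \<sigma>^2 * real d"
    and logn_lower: "24 \<le> \<sigma>^2 * ln (real n)"
    and mu: "\<mu> = sqrt (1 - real n powr (- 2 / real d))"
begin

definition log_ratio :: real where "log_ratio = ln (real n) / real d"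

lemma lnn_pos: "0 < ln (real n)" using n2 by simp

lemma log_ratio_pos: "0 < log_ratio" using lnn_pos d0 by (simp add: log_ratio_def)

lemma log_ratio_d: "log_ratio * real d = ln (real n)" using d0 by (simp add: log_ratio_def)

lemma log_ratio_small: "3200 * log_ratio \<le> \<sigma>^2" using logn_upper d0 by (simp add: log_ratio_def field_simps)

lemma sg_sq: "\<sigma>^2 \<le> \<sigma>" using sg by (simp add: power2_eq_square mult_left_le_one_le)

lemma mu_sq: "\<mu>^2 = 1 - exp (- (2 * log_ratio))"
proof -
  have "real n powr (- 2 / real d) = exp (- (2 * log_ratio))" using n2 by (simp add: powr_def log_ratio_def)
  thus ?thesis using log_ratio_pos by (simp add: mu)
qed

lemma mu_sq_upper: "\<mu>^2 \<le> 2 * log_ratio"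
  unfolding mu_sq using exp_ge_add_one_self[of "- (2 * log_ratio)"] by simp

text \<open>With \<open>mu_sq_upper\<close> this pins \<open>\<mu>^2\<close> to
  \<open>2 * ln n / d\<close> up to second order. For \<open>y = 2 * log_ratio\<close> the product
  of \<open>1 - y + y^2/2\<close> and \<open>1 + y + y^2/2\<close> is \<open>1 + y^4/4\<close>,
  which turns the Taylor bound for \<open>exp y\<close> into one for
  \<open>exp (- y)\<close>.\<close>

lemma mu_sq_lower: "2 * log_ratio - 2 * log_ratio^2 \<le> \<mu>^2"
proof -
  have "exp (- (2 * log_ratio)) \<le> 1 - 2 * log_ratio + (2 * log_ratio)^2 / 2"
  proof -
    have "1 + 2 * log_ratio + (2 * log_ratio)^2 / 2 \<le> exp (2 * log_ratio)" using exp_lower_Taylor_quadratic[of "2 * log_ratio"] log_ratio_pos by simp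
    hence "exp (- (2 * log_ratio)) \<le> 1 / (1 + 2 * log_ratio + (2 * log_ratio)^2 / 2)"
      using log_ratio_pos by (simp add: exp_minus inverse_eq_divide frac_le add_pos_nonneg)
    also have "\<dots> \<le> 1 - 2 * log_ratio + (2 * log_ratio)^2 / 2"
    proof -
      have "(1 - 2 * log_ratio + (2 * log_ratio)^2 / 2) * (1 + 2 * log_ratio + (2 * log_ratio)^2 / 2) = 1 + (2*log_ratio)^4 / 4"
        by (simp add: algebra_simps power2_eq_square power4_eq_xxxx)
      hence "1 \<le> (1 - 2 * log_ratio + (2 * log_ratio)^2 / 2) * (1 + 2 * log_ratio + (2 * log_ratio)^2 / 2)" by simp
      thus ?thesis using log_ratio_pos by (simp add: divide_le_eq add_pos_nonneg)
    qed
    finally show ?thesis .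
  qed
  thus ?thesis unfolding mu_sq by (simp add: power2_eq_square)
qed

lemma log_ratio_le: "log_ratio \<le> \<sigma> / 3200" "log_ratio \<le> 1/3200"
  using log_ratio_small sg_sq sg by linarith+

lemma mu_sq_ge_l: "log_ratio \<le> \<mu>^2"
proof -
  have "log_ratio * log_ratio \<le> log_ratio * (1/2)" using log_ratio_pos log_ratio_le by (intro mult_left_mono) auto
  thus ?thesis using mu_sq_lower by (simp add: power2_eq_square)
qed

lemma mu_nonneg: "0 \<le> \<mu>"
proof -
  have "real n powr (- 2 / real d) = exp (- (2 * log_ratio))" using n2 by (simp add: powr_def log_ratio_def)
  thus ?thesis using log_ratio_pos by (simp add: mu)
qed

lemma mu_pos: "0 < \<mu>" using mu_nonneg mu_sq_ge_l log_ratio_pos by (smt (verit) power_zero_numeral zero_less_power2)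

lemma mu_small: "40 * \<mu> \<le> \<sigma>"
proof -
  have "(40 * \<mu>)^2 \<le> \<sigma>^2" using mu_sq_upper log_ratio_small by (simp add: power_mult_distrib)
  thus ?thesis using sg by (auto intro: power2_le_imp_le[of "40 * \<mu>" \<sigma>])
qed

lemma mu_le: "\<mu> \<le> 1/40" using mu_small sg by simp

lemma mu_sq_le: "\<mu>^2 \<le> 1/1600"
  using power_mono[OF mu_le mu_nonneg, of 2] by (simp add: power2_eq_square)

lemma lnn_ge: "24 \<le> \<sigma> * ln (real n)"
  using logn_lower sg_sq lnn_pos by (smt (verit) mult_right_mono)

text \<open>The increment demanded of a greedy step is negligible on the scale \<open>\<mu>\<close>:
  \<open>1/d \<le> \<sigma> * log_ratio\<close>, because \<open>\<sigma> * ln n \<ge> 1\<close>, and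
  \<open>log_ratio \<le> \<mu>\<close>.\<close>

lemma inv_d_le: "1 / real d \<le> \<sigma> * \<mu>"
proof -
  have "log_ratio * log_ratio \<le> log_ratio * 1" using log_ratio_le log_ratio_pos by (intro mult_left_mono) auto
  hence "log_ratio^2 \<le> \<mu>^2" using mu_sq_ge_l by (simp add: power2_eq_square)
  hence "log_ratio \<le> \<mu>" using mu_nonneg by (rule power2_le_imp_le)
  hence "\<sigma> * log_ratio \<le> \<sigma> * \<mu>" using sg by simp
  moreover have "1 / real d \<le> \<sigma> * log_ratio" using lnn_ge d0 by (simp add: log_ratio_def field_simps)
  ultimately show ?thesis by simp
qed

text \<open>The dictionary between squared radii in units of \<open>\<mu>^2\<close> and powers of
  \<open>n\<close>. Bounding \<open>\<theta>\<close> by 10 keeps the second-order error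
  \<open>\<theta> * log_ratio\<close> below \<open>\<sigma>\<close>.\<close>

lemma exp_bound:
  assumes "0 \<le> \<theta>" "\<theta> \<le> 10"
  shows "exp (- (\<theta> * \<mu>^2 * real d / 2)) \<le> real n powr (- \<theta> + \<sigma>)"
proof -
  have "ln (real n) * (1 - log_ratio) = (2 * log_ratio - 2 * log_ratio^2) * real d / 2"
    using log_ratio_d by (simp add: power2_eq_square algebra_simps) (simp add: mult.assoc[symmetric] flip: log_ratio_d)
  also have "\<dots> \<le> \<mu>^2 * real d / 2" using mu_sq_lower by (simp add: mult_right_mono)
  finally have "\<theta> * (ln (real n) * (1 - log_ratio)) \<le> \<theta> * (\<mu>^2 * real d / 2)" using assms by (intro mult_left_mono)
  moreover have "\<theta> * log_ratio \<le> 10 * log_ratio" using assms log_ratio_pos by simp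
  hence "\<theta> * log_ratio \<le> \<sigma>" using log_ratio_le sg by simp
  hence "\<theta> * log_ratio * ln (real n) \<le> \<sigma> * ln (real n)" using lnn_pos by (intro mult_right_mono) auto
  ultimately have "- (\<theta> * \<mu>^2 * real d / 2) \<le> (- \<theta> + \<sigma>) * ln (real n)" by (simp add: algebra_simps)
  thus ?thesis using n2 by (simp add: powr_def)
qed

text \<open>The converse direction of the dictionary, from
  \<open>ln (1 - y) \<ge> - y - 2 * y^2\<close> at \<open>y = 2 * log_ratio * \<theta>\<close>; as
  \<open>\<theta> \<le> 10\<close>, the quadratic term costs at most \<open>\<sigma>\<close> in the
  exponent.\<close>

lemma root_bound:
  assumes "0 \<le> \<theta>" "\<theta> \<le> 10" "W \<le> \<theta> * \<mu>^2"
  shows "real n powr (- \<theta> - \<sigma>) \<le> sqrt (1 - W) ^ d" "W < 1"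
proof -
  define y where "y = 2 * log_ratio * \<theta>"
  have y: "0 \<le> y" "y \<le> 20 * log_ratio" using assms log_ratio_pos mult_left_mono[of \<theta> 10 "2 * log_ratio"] by (auto simp: y_def)
  have "\<theta> * \<mu>^2 \<le> \<theta> * (2 * log_ratio)" using mu_sq_upper assms by (intro mult_left_mono)
  hence Wy: "W \<le> y" using assms by (simp add: y_def mult_ac)
  thus W1: "W < 1" using y log_ratio_le by simp
  have y1: "y < 1" using y log_ratio_le by simp
  have "y * y \<le> (20 * log_ratio) * (20 * log_ratio)" using y by (intro mult_mono) auto
  also have "\<dots> = log_ratio * (400 * log_ratio)" by simp
  also have "\<dots> \<le> log_ratio * \<sigma>" using log_ratio_le log_ratio_pos sg by (intro mult_left_mono) auto
  finally have "2 * y^2 \<le> 2 * log_ratio * \<sigma>" by (simp add: power2_eq_square)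
  moreover have "- y - 2 * y^2 \<le> ln (1 - y)" using ln_one_minus_pos_lower_bound[of y] y log_ratio_le by simp
  ultimately have "- (2 * log_ratio) * (\<theta> + \<sigma>) \<le> ln (1 - y)" by (simp add: y_def algebra_simps)
  also have "\<dots> \<le> ln (1 - W)" using Wy y1 by simp
  finally have "exp (- (2 * log_ratio) * (\<theta> + \<sigma>)) \<le> 1 - W"
    by (metis W1 diff_gt_0_iff_gt exp_le_cancel_iff exp_ln)
  moreover have "exp (- log_ratio * (\<theta> + \<sigma>))^2 = exp (- (2 * log_ratio) * (\<theta> + \<sigma>))"
    by (simp add: power2_eq_square exp_add[symmetric] algebra_simps)
  ultimately have "exp (- log_ratio * (\<theta> + \<sigma>)) \<le> sqrt (1 - W)" by (intro real_le_rsqrt) simp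
  hence "exp (- log_ratio * (\<theta> + \<sigma>)) ^ d \<le> sqrt (1 - W) ^ d" by (intro power_mono) auto
  moreover have "exp (- log_ratio * (\<theta> + \<sigma>)) ^ d = real n powr (- \<theta> - \<sigma>)"
  proof -
    have "exp (- log_ratio * (\<theta> + \<sigma>)) ^ d = exp (- (log_ratio * real d) * (\<theta> + \<sigma>))"
      by (simp add: exp_of_nat_mult[symmetric] mult_ac)
    also have "\<dots> = exp ((- \<theta> - \<sigma>) * ln (real n))" unfolding log_ratio_d by (simp add: algebra_simps)
    also have "\<dots> = real n powr (- \<theta> - \<sigma>)" using n2 by (simp add: powr_def)
    finally show ?thesis .
  qed
  ultimately show "real n powr (- \<theta> - \<sigma>) \<le> sqrt (1 - W) ^ d" by simp
qed

lemma powr_sg_ge: "exp 24 \<le> real n powr \<sigma>"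
  using lnn_ge n2 by (simp add: powr_def)

lemma powr_sg_ge4: "4 \<le> real n powr \<sigma>"
  using powr_sg_ge exp_ge_add_one_self[of 24] by linarith

section \<open>One cap, two caps and slabs in powers of n\<close>

abbreviation \<nu> where "\<nu> \<equiv> unif_sphere d"

lemma cap_upper:
  assumes x: "ip d x x \<le> 1" and a: "0 \<le> a" "a \<le> 2"
  shows "measure \<nu> {y \<in> space (Rd d). a * \<mu> \<le> ip d y x} \<le> real n powr (- (a^2) + \<sigma>)"
proof -
  let ?w = "\<lambda>i. (a * \<mu>) * x i"
  let ?W = "a^2 * \<mu>^2"
  have a2: "a^2 \<le> 4" using power_mono[OF a(2) a(1), of 2] by simp
  have W: "0 \<le> ?W" "?W \<le> 1/2" using mult_mono[OF a2 mu_sq_le] by auto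
  have ww: "ip d ?w ?w \<le> ?W"
    unfolding ip_scale_left ip_scale_right using mult_left_mono[OF x W(1)]
    by (simp add: power2_eq_square mult_ac)
  have "measure \<nu> {y \<in> space (Rd d). a * \<mu> \<le> ip d y x} \<le> measure \<nu> {y \<in> space (Rd d). ?W \<le> ip d y ?w}"
  proof -
    interpret prob_space \<nu> by (rule prob_space_unif_sphere)
    show ?thesis
    proof (rule finite_measure_mono)
      show "{y \<in> space (Rd d). ?W \<le> ip d y ?w} \<in> events" by measurable
      show "{y \<in> space (Rd d). a * \<mu> \<le> ip d y x} \<subseteq> {y \<in> space (Rd d). ?W \<le> ip d y ?w}"
      proof (safe)
        fix y assume "a * \<mu> \<le> ip d y x"
        hence "(a * \<mu>) * (a * \<mu>) \<le> (a * \<mu>) * ip d y x" using a mu_nonneg by (intro mult_left_mono) auto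
        thus "?W \<le> ip d y ?w" unfolding ip_scale_right by (simp add: power2_eq_square mult_ac)
      qed
    qed
  qed
  also have "\<dots> \<le> exp (- ((2 * ?W - ip d ?w ?w) * real d / 2))" by (rule sphere_cap_upper[OF W])
  also have "\<dots> \<le> exp (- (a^2 * \<mu>^2 * real d / 2))"
  proof -
    have "?W \<le> 2 * ?W - ip d ?w ?w" using ww by linarith
    hence "?W * real d \<le> (2 * ?W - ip d ?w ?w) * real d" by (intro mult_right_mono) auto
    thus ?thesis by simp
  qed
  also have "\<dots> \<le> real n powr (- (a^2) + \<sigma>)" using a2 by (intro exp_bound) auto
  finally show ?thesis .
qed

text \<open>The two directions are almost orthogonal, so the exponents add: the cross term is at
  most \<open>16 * \<mu>\<close>, which is below \<open>\<sigma>\<close>. If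
  \<open>a^2 + b^2 \<le> \<sigma>\<close>, the claimed bound is at least 1.\<close>

lemma two_caps_upper:
  assumes x: "ip d x x \<le> 1" and q: "ip d q q \<le> 1" and b0: "\<bar>ip d x q\<bar> \<le> 2 * \<mu>"
    and a: "0 \<le> a" "a \<le> 2" and b: "0 \<le> b" "b \<le> 2"
  shows "measure \<nu> {y \<in> space (Rd d). a * \<mu> \<le> ip d y x \<and> b * \<mu> \<le> ip d y q} \<le> real n powr (- (a^2 + b^2) + 2 * \<sigma>)"
proof (cases "a^2 + b^2 \<le> \<sigma>")
  case True
  interpret prob_space \<nu> by (rule prob_space_unif_sphere)
  have "1 \<le> real n powr (- (a^2 + b^2) + 2 * \<sigma>)" using True sg n2 by (intro ge_one_powr_ge_zero) auto
  thus ?thesis using prob_le_1 order_trans by blast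
next
  case False
  let ?w = "\<lambda>i. (a * \<mu>) * x i + (b * \<mu>) * q i"
  let ?W = "(a^2 + b^2) * \<mu>^2"
  have a2: "a^2 \<le> 4" using power_mono[OF a(2) a(1), of 2] by simp
  have b2: "b^2 \<le> 4" using power_mono[OF b(2) b(1), of 2] by simp
  have ab2: "a^2 + b^2 \<le> 8" using a2 b2 by simp
  have W: "0 \<le> ?W" "?W \<le> 1/2" using mult_mono[OF ab2 mu_sq_le] by auto
  have ab: "a * b \<le> 2 * 2" using a b by (intro mult_mono) auto
  have "a * b * ip d x q \<le> 2 * 2 * (2 * \<mu>)" using ab b0 a b mu_nonneg
    by (intro order_trans[OF mult_left_mono[of "ip d x q" "2 * \<mu>" "a * b"] mult_right_mono[OF ab]]) auto
  hence c: "2 * (a * b * ip d x q) \<le> \<sigma>" using mu_small mu_nonneg by linarith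
  have ww: "ip d ?w ?w \<le> (a^2 + b^2 + \<sigma>) * \<mu>^2"
  proof -
    have "ip d ?w ?w = (a^2 * ip d x x + b^2 * ip d q q + 2 * (a * b * ip d x q)) * \<mu>^2"
      unfolding ip_comb_self by algebra
    also have "\<dots> \<le> (a^2 * 1 + b^2 * 1 + \<sigma>) * \<mu>^2"
      using x q c by (intro mult_right_mono add_mono mult_left_mono) auto
    finally show ?thesis by simp
  qed
  have "measure \<nu> {y \<in> space (Rd d). a * \<mu> \<le> ip d y x \<and> b * \<mu> \<le> ip d y q} \<le> measure \<nu> {y \<in> space (Rd d). ?W \<le> ip d y ?w}"
  proof -
    interpret prob_space \<nu> by (rule prob_space_unif_sphere)
    show ?thesis
    proof (rule finite_measure_mono)
      show "{y \<in> space (Rd d). ?W \<le> ip d y ?w} \<in> events" by measurable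
      show "{y \<in> space (Rd d). a * \<mu> \<le> ip d y x \<and> b * \<mu> \<le> ip d y q} \<subseteq> {y \<in> space (Rd d). ?W \<le> ip d y ?w}"
      proof (safe)
        fix y assume "a * \<mu> \<le> ip d y x" "b * \<mu> \<le> ip d y q"
        hence "(a * \<mu>) * (a * \<mu>) + (b * \<mu>) * (b * \<mu>) \<le> (a * \<mu>) * ip d y x + (b * \<mu>) * ip d y q"
          using a b mu_nonneg by (intro add_mono mult_left_mono) auto
        thus "?W \<le> ip d y ?w" unfolding ip_comb_right by (simp add: power2_eq_square algebra_simps)
      qed
    qed
  qed
  also have "\<dots> \<le> exp (- ((2 * ?W - ip d ?w ?w) * real d / 2))" by (rule sphere_cap_upper[OF W])
  also have "\<dots> \<le> exp (- ((a^2 + b^2 - \<sigma>) * \<mu>^2 * real d / 2))"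
  proof -
    have "(a^2 + b^2 - \<sigma>) * \<mu>^2 \<le> 2 * ?W - ip d ?w ?w" using ww by (simp add: algebra_simps)
    hence "(a^2 + b^2 - \<sigma>) * \<mu>^2 * real d \<le> (2 * ?W - ip d ?w ?w) * real d" by (intro mult_right_mono) auto
    thus ?thesis by simp
  qed
  also have "\<dots> \<le> real n powr (- (a^2 + b^2 - \<sigma>) + \<sigma>)" using ab2 False sg by (intro exp_bound) auto
  finally show ?thesis by (simp add: algebra_simps)
qed

text \<open>The slack \<open>\<sigma> / 2\<close> in both heights is the margin \<open>t\<close> of
  the ball argument. Each tail then loses at most \<open>exp (- 3) \<le> 1/8\<close>, and the
  remaining fraction 1/4 is absorbed by one factor \<open>n powr (- \<sigma>)\<close>.\<close>

lemma caps_lower: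
  assumes w: "ip d w w \<le> \<theta> * \<mu>^2" and th: "0 \<le> \<theta>" "\<theta> \<le> 10"
    and y: "ip d y1 y1 \<le> 1" "ip d y2 y2 \<le> 1" and a: "0 < a1" "0 < a2"
    and wy: "(a1 + \<sigma> / 2) * \<mu> \<le> ip d w y1" "(a2 + \<sigma> / 2) * \<mu> \<le> ip d w y2"
  shows "real n powr (- \<theta> - 2 * \<sigma>) \<le> measure \<nu> {x \<in> space (Rd d). a1 * \<mu> \<le> ip d x y1 \<and> a2 * \<mu> \<le> ip d x y2}"
proof -
  let ?t = "\<sigma> / 2 * \<mu>"
  have t: "0 \<le> ?t" "?t^2 \<le> 1/2"
  proof -
    have "?t \<le> 1/2 * 1" using sg mu_le mu_nonneg by (intro mult_mono) auto
    moreover show "0 \<le> ?t" using sg mu_nonneg by simp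
    ultimately have "?t^2 \<le> (1/2)^2" by (intro power_mono) auto
    moreover have "(1/2)^2 \<le> (1/2::real)" by (simp add: power2_eq_square)
    ultimately show "?t^2 \<le> 1/2" by linarith
  qed
  have "6 \<le> ?t^2 * real d"
  proof -
    have "24 \<le> \<sigma>^2 * (log_ratio * real d)" using logn_lower log_ratio_d by simp
    also have "\<dots> \<le> \<sigma>^2 * (\<mu>^2 * real d)" using mu_sq_ge_l by (intro mult_left_mono mult_right_mono) auto
    finally show ?thesis by (simp add: power_mult_distrib power_divide)
  qed
  hence "- (?t^2 * real d / 2) \<le> - 3" by linarith
  hence "exp (- (?t^2 * real d / 2)) \<le> exp (- 3)" by (simp only: exp_le_cancel_iff)
  also have "\<dots> \<le> 1/8"
  proof -
    have "(2::real) \<le> exp 1" using exp_ge_add_one_self[of 1] by simp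
    hence "2 ^ 3 \<le> exp (1::real) ^ 3" by (intro power_mono) auto
    hence "(8::real) \<le> exp 3" using exp_of_nat_mult[of 3 "1::real"] by simp
    thus ?thesis by (simp add: exp_minus field_simps)
  qed
  finally have e0: "exp (- (?t^2 * real d / 2)) \<le> 1/8" .
  define E where "E = exp (- (?t^2 * real d / 2))"
  have e: "1/4 \<le> 1/2 - 2 * E" using e0 unfolding E_def[symmetric] by simp
  have n1: "real n powr (- \<sigma>) \<le> 1/4" using le_imp_inverse_le[OF powr_sg_ge4] by (simp add: powr_minus)
  have "real n powr (- \<theta> - 2 * \<sigma>) = real n powr (- \<sigma>) * real n powr (- \<theta> - \<sigma>)"
    by (simp add: powr_add[symmetric] algebra_simps)
  also have "\<dots> \<le> (1/2 - 2 * E) * sqrt (1 - ip d w w) ^ d"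
  proof (rule mult_mono[OF order_trans[OF n1 e] root_bound(1)[OF th w]])
    show "0 \<le> 1/2 - 2 * E" using e by linarith
    show "0 \<le> real n powr (- \<theta> - \<sigma>)" by (rule powr_ge_zero)
  qed
  also have "\<dots> \<le> measure \<nu> {x \<in> space (Rd d). a1 * \<mu> \<le> ip d x y1 \<and> a2 * \<mu> \<le> ip d x y2}"
    unfolding E_def
  proof (rule sphere_two_caps_lower[OF root_bound(2)[OF th w] y t])
    show "0 < a1 * \<mu>" "0 < a2 * \<mu>" using a mu_pos by simp_all
    show "a1 * \<mu> + ?t \<le> ip d w y1" "a2 * \<mu> + ?t \<le> ip d w y2" using wy by (simp_all add: distrib_right)
  qed
  finally show ?thesis .
qed

text \<open>Raising both coefficients of the centre by \<open>\<sigma>\<close> pays half for the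
  correlation of \<open>y1\<close> and \<open>y2\<close> and half for the slack of
  \<open>caps_lower\<close>. The squared length grows by at most
  \<open>10 * \<sigma>\<close>.\<close>

lemma two_caps_lower:
  assumes y: "ip d y1 y1 = 1" "ip d y2 y2 = 1" and b0: "\<bar>ip d y1 y2\<bar> \<le> 2 * \<mu>"
    and a: "0 < a" "a \<le> 1" and b: "0 < b" "b \<le> 1"
  shows "real n powr (- (a^2 + b^2) - 12 * \<sigma>)
    \<le> measure \<nu> {x \<in> space (Rd d). a * \<mu> \<le> ip d x y1 \<and> b * \<mu> \<le> ip d x y2}"
proof -
  let ?w = "\<lambda>i. ((a + \<sigma>) * \<mu>) * y1 i + ((b + \<sigma>) * \<mu>) * y2 i"
  let ?\<theta> = "a^2 + b^2 + 10 * \<sigma>"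
  have a2: "a^2 \<le> 1" using a by (simp add: power_le_one)
  have b2: "b^2 \<le> 1" using b by (simp add: power_le_one)
  have small: "\<bar>(c + \<sigma>) * ip d y1 y2\<bar> \<le> \<sigma> / 2" if "0 < c" "c \<le> 1" for c
  proof -
    have "\<bar>(c + \<sigma>) * ip d y1 y2\<bar> = (c + \<sigma>) * \<bar>ip d y1 y2\<bar>" using that sg by (simp add: abs_mult)
    also have "\<dots> \<le> 2 * (2 * \<mu>)" using that sg b0 by (intro mult_mono) auto
    finally show ?thesis using mu_small by simp
  qed
  have "real n powr (- (a^2 + b^2) - 12 * \<sigma>) = real n powr (- ?\<theta> - 2 * \<sigma>)" by simp
  also have "\<dots> \<le> measure \<nu> {x \<in> space (Rd d). a * \<mu> \<le> ip d x y1 \<and> b * \<mu> \<le> ip d x y2}"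
  proof -
    have True: "?\<theta> \<le> 10" using a2 b2 sg by simp
    show ?thesis
    proof (rule caps_lower[of ?w])
      have "ip d ?w ?w = ((a + \<sigma>)^2 + (b + \<sigma>)^2 + 2 * ((a + \<sigma>) * ((b + \<sigma>) * ip d y1 y2))) * \<mu>^2"
        unfolding ip_comb_self y by algebra
      also have "\<dots> \<le> ?\<theta> * \<mu>^2"
      proof (rule mult_right_mono)
        have "(a + \<sigma>) * ((b + \<sigma>) * ip d y1 y2) \<le> (a + \<sigma>) * (\<sigma> / 2)"
          using small[OF b] a sg by (intro mult_left_mono) auto
        also have "\<dots> \<le> 2 * (\<sigma> / 2)" using a sg by (intro mult_right_mono) auto
        finally have "2 * ((a + \<sigma>) * ((b + \<sigma>) * ip d y1 y2)) \<le> 2 * \<sigma>" by simp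
        moreover have "a * \<sigma> \<le> \<sigma>" "b * \<sigma> \<le> \<sigma>" using a b sg by (simp_all add: mult_left_le_one_le)
        ultimately show "(a + \<sigma>)^2 + (b + \<sigma>)^2 + 2 * ((a + \<sigma>) * ((b + \<sigma>) * ip d y1 y2)) \<le> ?\<theta>"
          using sg_sq sg unfolding power2_sum by linarith
      qed simp
      finally show "ip d ?w ?w \<le> ?\<theta> * \<mu>^2" .
    next
      have "(a + \<sigma> / 2) * \<mu> \<le> (a + \<sigma> + (b + \<sigma>) * ip d y1 y2) * \<mu>"
        using small[OF b] mu_nonneg by (intro mult_right_mono) auto
      thus "(a + \<sigma> / 2) * \<mu> \<le> ip d ?w y1"
        unfolding ip_comb_left y ip_commute[of d y2 y1] by (simp add: distrib_left distrib_right mult_ac)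
      have "(b + \<sigma> / 2) * \<mu> \<le> (b + \<sigma> + (a + \<sigma>) * ip d y1 y2) * \<mu>"
        using small[OF a] mu_nonneg by (intro mult_right_mono) auto
      thus "(b + \<sigma> / 2) * \<mu> \<le> ip d ?w y2"
        unfolding ip_comb_left y by (simp add: distrib_left distrib_right mult_ac)
    qed (use a b sg y True in auto)
  qed
  finally show ?thesis .
qed

end

context regime begin

text \<open>About \<open>\<zeta> / (4 * h)\<close> translates with step \<open>4 * h * \<mu>\<close>
  are used; the step exceeds the extent of the shell, which is at most \<open>3 * h * \<mu>\<close>.
  The total shift \<open>\<zeta> * \<mu>\<close> costs \<open>5 * \<zeta>\<close> in the exponent,
  while the width of the slab enters as the factor \<open>h\<close>.\<close>

lemma slab_upper:
  assumes x: "ip d x x \<le> 1" and q: "ip d q q = 1" and b0: "\<bar>ip d x q\<bar> \<le> 2 * \<mu>"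
    and k: "0 \<le> k" "k \<le> 1" and b: "0 \<le> b" "b \<le> 2"
    and h: "1 / real d \<le> h" "8 * h \<le> \<zeta>" and z: "0 < \<zeta>" "\<zeta> \<le> 1" and pos: "\<sigma> + 5 * \<zeta> \<le> k^2 + b^2"
  shows "measure \<nu> {y \<in> space (Rd d). k * \<mu> \<le> ip d y x \<and> b * \<mu> \<le> ip d y q \<and> ip d y q \<le> b * \<mu> + h * \<mu>}
    \<le> 16 * h / \<zeta> * real n powr (- (k^2 + b^2) + 5 * \<zeta> + 2 * \<sigma>)"
proof -
  have h0: "0 < h" using h(1) d0 by (smt (verit) divide_pos_pos of_nat_0_less_iff)
  define M where "M = nat \<lfloor>\<zeta> / (4 * h)\<rfloor>"
  have r2: "2 \<le> \<zeta> / (4 * h)" using h h0 by (simp add: field_simps)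
  have M1: "real M \<le> \<zeta> / (4 * h)" using r2 by (simp add: M_def)
  have M2: "\<zeta> / (8 * h) \<le> real M"
  proof -
    have "\<zeta> / (4 * h) < real M + 1" using r2 unfolding M_def by linarith
    moreover have "\<zeta> / (4 * h) = 2 * (\<zeta> / (8 * h))" by simp
    ultimately show ?thesis using r2 by linarith
  qed
  have zh: "0 < \<zeta> / (8 * h)" using z h0 by simp
  have M0: "0 < M" using M2 zh by (cases M) auto
  have k2: "k^2 \<le> 1" using k by (simp add: power_le_one)
  have b2: "b^2 \<le> 4" using power_mono[OF b(2) b(1), of 2] by simp
  let ?E = "(k * \<mu>)^2 + (b * \<mu>)^2 - 2 * (k * \<mu>) * (b * \<mu>) * (2 * \<mu>) - 2 * (\<zeta> * \<mu>) * (h * \<mu> + k * \<mu> * (2 * \<mu>)) - (\<zeta> * \<mu>)^2"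
  let ?\<theta> = "k^2 + b^2 - \<sigma> - 5 * \<zeta>"
  have "measure \<nu> {y \<in> space (Rd d). k * \<mu> \<le> ip d y x \<and> b * \<mu> \<le> ip d y q \<and> ip d y q \<le> b * \<mu> + h * \<mu>}
      \<le> 2 / real M * exp (- (?E * real d / 2))"
  proof (rule sphere_slab_upper[OF x q b0])
    show "0 \<le> k * \<mu>" "0 \<le> b * \<mu>" "0 \<le> h * \<mu>" using k b h0 mu_nonneg by auto
    have "k^2 * \<mu>^2 + b^2 * \<mu>^2 \<le> 1 * (1/1600) + 4 * (1/1600)"
      using k2 b2 mu_sq_le by (intro add_mono mult_mono) auto
    thus "(k * \<mu>)^2 + (b * \<mu>)^2 \<le> 1/2" by (simp add: power_mult_distrib)
    show "1 / real d \<le> h" by (rule h(1))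
    show "0 < d" by (rule d0)
    show "0 < M" by (rule M0)
    show "h < 1" using h z by simp
    have "b * \<mu> * h \<le> 2 * \<mu> * h" using b h0 mu_nonneg by (intro mult_right_mono) auto
    thus "h * \<mu> + b * \<mu> * h < 4 * h * \<mu>" using h0 mu_pos by (simp add: algebra_simps)
    have "real M * (4 * h) \<le> \<zeta>" using M1 h0 by (simp add: field_simps)
    hence "real M * (4 * h) * \<mu> \<le> \<zeta> * \<mu>" using mu_nonneg by (rule mult_right_mono)
    thus "real M * (4 * h * \<mu>) \<le> \<zeta> * \<mu>" by (simp add: mult.assoc)
  qed
  also have "\<dots> \<le> 16 * h / \<zeta> * exp (- (?E * real d / 2))"
  proof (rule mult_right_mono)
    have "2 / real M \<le> 2 / (\<zeta> / (8 * h))" by (rule frac_le[OF _ _ zh M2]) auto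
    thus "2 / real M \<le> 16 * h / \<zeta>" by simp
  qed simp
  also have "\<dots> \<le> 16 * h / \<zeta> * exp (- (?\<theta> * \<mu>^2 * real d / 2))"
  proof (intro mult_left_mono)
    have "?\<theta> * \<mu>^2 \<le> (k^2 + b^2 - 4 * (k * b * \<mu>) - 2 * (\<zeta> * (h + 2 * (k * \<mu>))) - \<zeta>^2) * \<mu>^2"
    proof (rule mult_right_mono)
      have "k * b * \<mu> \<le> 1 * 2 * \<mu>" using k b mu_nonneg by (intro mult_right_mono mult_mono) auto
      hence 1: "4 * (k * b * \<mu>) \<le> \<sigma>" using mu_small mu_nonneg by linarith
      have "k * \<mu> \<le> 1 * (1/40)" using k mu_le mu_nonneg by (intro mult_mono) auto
      hence "\<zeta> * (h + 2 * (k * \<mu>)) \<le> \<zeta> * 1" using z h by (intro mult_left_mono) auto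
      moreover have "\<zeta>^2 \<le> \<zeta>" using z by (simp add: power2_eq_square mult_left_le_one_le)
      ultimately show "?\<theta> \<le> k^2 + b^2 - 4 * (k * b * \<mu>) - 2 * (\<zeta> * (h + 2 * (k * \<mu>))) - \<zeta>^2"
        using 1 z by linarith
    qed simp
    also have "\<dots> = ?E" by algebra
    finally have "?\<theta> * \<mu>^2 * real d \<le> ?E * real d" by (rule mult_right_mono) simp
    thus "exp (- (?E * real d / 2)) \<le> exp (- (?\<theta> * \<mu>^2 * real d / 2))" by simp
    show "0 \<le> 16 * h / \<zeta>" using h0 z by simp
  qed
  also have "\<dots> \<le> 16 * h / \<zeta> * real n powr (- ?\<theta> + \<sigma>)"
    using exp_bound[of ?\<theta>] pos k2 b2 sg z h0 by (intro mult_left_mono) auto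
  finally show ?thesis by (simp add: algebra_simps)
qed

end

section \<open>Greedy walks\<close>

lemma nbrs_subset: "nbrs d \<alpha> n P i \<subseteq> {..<n}" by (auto simp: nbrs_def)

lemma finite_nbrs [simp]: "finite (nbrs d \<alpha> n P i)" by (rule finite_subset[OF nbrs_subset]) simp

lemma impr_subset: "impr d \<alpha> n P q i \<subseteq> nbrs d \<alpha> n P i" by (auto simp: impr_def)

lemma finite_impr [simp]: "finite (impr d \<alpha> n P q i)" by (rule finite_subset[OF impr_subset]) simp

lemma greedy_next_SomeD:
  assumes "greedy_next d \<alpha> n P q i = Some j"
  shows "j \<in> impr d \<alpha> n P q i" "\<And>k. k \<in> impr d \<alpha> n P q i \<Longrightarrow> ip d (P k) q \<le> ip d (P j) q"
proof -
  let ?I = "impr d \<alpha> n P q i"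
  let ?Q = "\<lambda>j. j \<in> ?I \<and> (\<forall>k\<in>?I. ip d (P k) q \<le> ip d (P j) q)"
  have ne: "?I \<noteq> {}" and j: "j = (LEAST j. ?Q j)" using assms by (auto simp: greedy_next_def split: if_splits)
  have "\<exists>m\<in>?I. \<forall>k\<in>?I. ip d (P k) q \<le> ip d (P m) q"
    using Max_in[of "(\<lambda>k. ip d (P k) q) ` ?I"] Max_ge[of "(\<lambda>k. ip d (P k) q) ` ?I"] ne by fastforce
  hence "\<exists>m. ?Q m" by blast
  hence "?Q j" unfolding j by (rule LeastI_ex)
  thus "j \<in> ?I" "\<And>k. k \<in> ?I \<Longrightarrow> ip d (P k) q \<le> ip d (P j) q" by auto
qed

lemma greedy_next_unique:
  assumes "j \<in> impr d \<alpha> n P q i" "\<And>k. k \<in> impr d \<alpha> n P q i \<Longrightarrow> k \<noteq> j \<Longrightarrow> ip d (P k) q < ip d (P j) q"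
  shows "greedy_next d \<alpha> n P q i = Some j"
proof -
  have "greedy_next d \<alpha> n P q i \<noteq> None" using assms(1) by (auto simp: greedy_next_def)
  then obtain m where m: "greedy_next d \<alpha> n P q i = Some m" by blast
  have "m = j" using greedy_next_SomeD[OF m] assms by (meson leD)
  thus ?thesis using m by simp
qed

lemma greedy_next_improves:
  assumes "greedy_next d \<alpha> n P q i = Some j"
  shows "j < n" "j \<noteq> i" "\<alpha> \<le> ip d (P i) (P j)" "ip d (P i) q + 1 / real d \<le> ip d (P j) q"
  using greedy_next_SomeD(1)[OF assms] unfolding impr_def nbrs_def by blast+

lemma walk_result:
  "fst (walk d \<alpha> g n P q f i) = Some j \<Longrightarrow> i < n \<Longrightarrow> j < n \<and> g \<le> ip d (P j) q"
proof (induction f arbitrary: i)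
  case (Suc f)
  show ?case
  proof (cases "g \<le> ip d (P i) q")
    case False
    then obtain k where k: "greedy_next d \<alpha> n P q i = Some k"
      using Suc(2) by (cases "greedy_next d \<alpha> n P q i") auto
    hence "fst (walk d \<alpha> g n P q f k) = Some j" using Suc(2) False by simp
    thus ?thesis using Suc.IH greedy_next_improves(1)[OF k] by blast
  qed (use Suc in simp)
qed (simp split: if_splits)

lemma walk_reached: "g \<le> ip d (P i) q \<Longrightarrow> fst (walk d \<alpha> g n P q f i) = Some i"
  by (cases f) simp_all

lemma walk_step:
  "ip d (P i) q < g \<Longrightarrow> greedy_next d \<alpha> n P q i = Some j \<Longrightarrow>
    fst (walk d \<alpha> g n P q (Suc f) i) = fst (walk d \<alpha> g n P q f j)"
  by simp

text \<open>Only the vertices before the last must be below the target height, since the last one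
  may be where the walk stops with success.\<close>

definition greedy_path where
  "greedy_path d \<alpha> g n P q xs \<longleftrightarrow> successively (\<lambda>i j. greedy_next d \<alpha> n P q i = Some j) xs
     \<and> (\<forall>i\<in>set (butlast xs). ip d (P i) q < g)"

lemma greedy_path_Cons:
  "greedy_path d \<alpha> g n P q xs \<Longrightarrow> xs \<noteq> [] \<Longrightarrow> greedy_next d \<alpha> n P q i = Some (hd xs) \<Longrightarrow> ip d (P i) q < g
    \<Longrightarrow> greedy_path d \<alpha> g n P q (i # xs)"
  unfolding greedy_path_def by (cases xs) simp_all

text \<open>Every scanned vertex costs at most \<open>1 + D\<close> and lengthens a greedy path from
  \<open>i\<close>. In the induction a path from the next vertex is extended by \<open>i\<close>, so
  \<open>T\<close> drops by one with each step.\<close>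

lemma walk_cost:
  assumes deg: "\<And>i. i < n \<Longrightarrow> card (nbrs d \<alpha> n P i) \<le> D"
    and path: "\<And>xs. greedy_path d \<alpha> g n P q xs \<Longrightarrow> length xs = Suc T \<Longrightarrow> hd xs = i \<Longrightarrow> False"
    and i: "i < n"
  shows "snd (walk d \<alpha> g n P q f i) \<le> T * (1 + D)"
  using path i
proof (induction f arbitrary: i T)
  case (0 i T)
  have "T \<noteq> 0" using 0(1)[of "[i]"] by (auto simp: greedy_path_def)
  thus ?case by (cases T) auto
next
  case (Suc f i T)
  have "T \<noteq> 0" using Suc(2)[of "[i]"] by (auto simp: greedy_path_def)
  then obtain T' where T: "T = Suc T'" by (cases T) auto
  show ?case
  proof (cases "g \<le> ip d (P i) q")
    case True
    thus ?thesis using T by simp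
  next
    case False
    show ?thesis
    proof (cases "greedy_next d \<alpha> n P q i")
      case None
      thus ?thesis using False T deg[OF Suc(3)] by simp
    next
      case (Some j)
      have "snd (walk d \<alpha> g n P q f j) \<le> T' * (1 + D)"
      proof (rule Suc.IH)
        fix xs assume xs: "greedy_path d \<alpha> g n P q xs" "length xs = Suc T'" "hd xs = j"
        have "greedy_path d \<alpha> g n P q (i # xs)"
          by (rule greedy_path_Cons[OF xs(1)]) (use xs Some False in auto)
        thus False using Suc(2)[of "i # xs"] xs T by simp
      qed (use greedy_next_improves(1)[OF Some] in auto)
      thus ?thesis using False Some T deg[OF Suc(3)] by simp
    qed
  qed
qed

lemma greedy_path_nth:
  assumes "greedy_path d \<alpha> g n P q xs" "Suc t < length xs"
  shows "greedy_next d \<alpha> n P q (xs ! t) = Some (xs ! Suc t)" "ip d (P (xs ! t)) q < g"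
proof -
  show "greedy_next d \<alpha> n P q (xs ! t) = Some (xs ! Suc t)"
    using assms unfolding greedy_path_def successively_conv_nth by blast
  have "butlast xs ! t \<in> set (butlast xs)" using assms(2) by (intro nth_mem) simp
  moreover have "butlast xs ! t = xs ! t" using assms(2) by (simp add: nth_butlast)
  ultimately show "ip d (P (xs ! t)) q < g" using assms(1) unfolding greedy_path_def by metis
qed

lemma greedy_path_increasing:
  assumes "greedy_path d \<alpha> g n P q xs" "t + k < length xs"
  shows "ip d (P (xs ! t)) q + real k / real d \<le> ip d (P (xs ! (t + k))) q"
  using assms(2)
proof (induction k)
  case (Suc k)
  have "ip d (P (xs ! (t + k))) q + 1 / real d \<le> ip d (P (xs ! Suc (t + k))) q"
    using Suc(2) by (intro greedy_next_improves(4)[OF greedy_path_nth(1)[OF assms(1)]]) simp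
  thus ?case using Suc by (simp add: add_divide_distrib)
qed simp

text \<open>The planted point is the only vertex at the target height, hence strictly the best
  candidate; the tie-breaking rule cannot interfere.\<close>

lemma one_step_success:
  assumes top: "\<And>k. 0 < k \<Longrightarrow> k < n \<Longrightarrow> ip d (P k) q < g" "g \<le> ip d (P 0) q"
    and i: "0 < i" "i < n" "\<alpha> \<le> ip d (P i) (P 0)" "ip d (P i) q + 1 / real d \<le> ip d (P 0) q"
  shows "greedy_next d \<alpha> n P q i = Some 0" "fst (walk d \<alpha> g n P q (Suc f) i) = Some 0"
proof -
  show gn: "greedy_next d \<alpha> n P q i = Some 0"
  proof (rule greedy_next_unique)
    show "0 \<in> impr d \<alpha> n P q i" using i by (auto simp: impr_def nbrs_def)
    show "ip d (P k) q < ip d (P 0) q" if "k \<in> impr d \<alpha> n P q i" "k \<noteq> 0" for k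
    proof -
      have "k < n" using that by (simp add: impr_def nbrs_def)
      thus ?thesis using top(1)[of k] top(2) that by simp
    qed
  qed
  show "fst (walk d \<alpha> g n P q (Suc f) i) = Some 0"
    unfolding walk_step[OF top(1)[OF i(1,2)] gn] using top(2) by (rule walk_reached)
qed

text \<open>If \<open>i\<close> happens to be adjacent to the planted point, one step suffices.
  Otherwise vertex 0 is no candidate, and \<open>best\<close> makes \<open>j\<close> the strict
  maximum.\<close>

lemma two_step_success:
  assumes top: "\<And>k. 0 < k \<Longrightarrow> k < n \<Longrightarrow> ip d (P k) q < g" "g \<le> ip d (P 0) q"
    and i: "0 < i" "i < n" and j: "0 < j" "j < n" "j \<noteq> i" "\<alpha> \<le> ip d (P i) (P j)" "\<alpha> \<le> ip d (P j) (P 0)"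
    and ij: "ip d (P i) q + 1 / real d \<le> ip d (P j) q" "ip d (P j) q + 1 / real d \<le> ip d (P 0) q"
    and best: "\<And>k. 0 < k \<Longrightarrow> k < n \<Longrightarrow> k \<noteq> i \<Longrightarrow> k \<noteq> j \<Longrightarrow> \<alpha> \<le> ip d (P i) (P k) \<Longrightarrow> ip d (P k) q < ip d (P j) q"
  shows "fst (walk d \<alpha> g n P q (Suc (Suc f)) i) = Some 0"
proof (cases "\<alpha> \<le> ip d (P i) (P 0)")
  case True
  have "0 \<le> 1 / real d" by simp
  hence "ip d (P i) q + 1 / real d \<le> ip d (P 0) q" using ij by linarith
  with top i True show ?thesis by (intro one_step_success(2)) auto
next
  case False
  have gn: "greedy_next d \<alpha> n P q i = Some j"
  proof (rule greedy_next_unique)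
    show "j \<in> impr d \<alpha> n P q i" using j ij by (auto simp: impr_def nbrs_def)
    show "ip d (P k) q < ip d (P j) q" if "k \<in> impr d \<alpha> n P q i" "k \<noteq> j" for k
    proof -
      have "k \<noteq> 0"
      proof
        assume "k = 0"
        thus False using that(1) False by (simp add: impr_def nbrs_def)
      qed
      thus ?thesis using best[of k] that by (auto simp: impr_def nbrs_def)
    qed
  qed
  show ?thesis unfolding walk_step[OF top(1)[OF i] gn]
    using top j ij by (intro one_step_success(2)) auto
qed

section \<open>Measurability of the data structure\<close>

text \<open>Points with index outside the configuration are constant: extensional functions take the value
  \<open>undefined\<close> there.\<close>
locale random_points =
  fixes M :: "'c measure" and P :: "'c \<Rightarrow> nat \<Rightarrow> nat \<Rightarrow> real" and d n :: nat
  assumes pt: "\<And>i. (\<lambda>w. P w i) \<in> measurable M (Rd d) \<or> (\<exists>v. \<forall>w\<in>space M. P w i = v)"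
begin

lemma measurable_ip_P [measurable]: "(\<lambda>w. ip d (P w i) q) \<in> borel_measurable M"
  using pt[of i]
proof
  assume "\<exists>v. \<forall>w\<in>space M. P w i = v"
  then obtain v where "\<forall>w\<in>space M. P w i = v" by blast
  thus ?thesis by (subst measurable_cong[where g = "\<lambda>_. ip d v q"]) auto
qed simp

lemma measurable_ip_PP [measurable]: "(\<lambda>w. ip d (P w i) (P w j)) \<in> borel_measurable M"
proof (cases "\<exists>v. \<forall>w\<in>space M. P w j = v")
  case True
  then obtain v where "\<forall>w\<in>space M. P w j = v" by blast
  thus ?thesis by (subst measurable_cong[where g = "\<lambda>w. ip d (P w i) v"]) auto
next
  case False
  hence [measurable]: "(\<lambda>w. P w j) \<in> measurable M (Rd d)" using pt[of j] by blast
  show ?thesis using pt[of i]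
  proof
    assume "\<exists>v. \<forall>w\<in>space M. P w i = v"
    then obtain v where "\<forall>w\<in>space M. P w i = v" by blast
    thus ?thesis by (subst measurable_cong[where g = "\<lambda>w. ip d v (P w j)"]) auto
  qed simp
qed

lemma measurable_card_nbrs [measurable]: "(\<lambda>w. card (nbrs d \<alpha> n (P w) i)) \<in> measurable M (count_space UNIV)"
proof -
  have "card (nbrs d \<alpha> n (P w) i) = (\<Sum>j<n. if j \<noteq> i \<and> \<alpha> \<le> ip d (P w i) (P w j) then 1 else 0)" for w
    by (simp add: nbrs_def sum.If_cases Int_def lessThan_def)
  thus ?thesis by simp
qed

lemma pred_impr [measurable]: "Measurable.pred M (\<lambda>w. j \<in> impr d \<alpha> n (P w) q i)"
  unfolding impr_def nbrs_def mem_Collect_eq by measurable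

lemma pred_best:
  "Measurable.pred M (\<lambda>w. j \<in> impr d \<alpha> n (P w) q i \<and>
      (\<forall>k\<in>impr d \<alpha> n (P w) q i. ip d (P w k) q \<le> ip d (P w j) q))"
proof -
  have "(\<forall>k\<in>impr d \<alpha> n (P w) q i. ip d (P w k) q \<le> ip d (P w j) q) \<longleftrightarrow>
      (\<forall>k\<in>{..<n}. k \<in> impr d \<alpha> n (P w) q i \<longrightarrow> ip d (P w k) q \<le> ip d (P w j) q)" for w
    using impr_subset nbrs_subset by blast
  thus ?thesis by simp
qed

lemma measurable_greedy_next [measurable]:
  "(\<lambda>w. greedy_next d \<alpha> n (P w) q i) \<in> measurable M (count_space UNIV)"
proof -
  have e: "impr d \<alpha> n (P w) q i = {} \<longleftrightarrow> \<not> (\<exists>j\<in>{..<n}. j \<in> impr d \<alpha> n (P w) q i)" for w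
    using impr_subset[of d \<alpha> n "P w" q i] nbrs_subset[of d \<alpha> n "P w" i] by blast
  have [measurable]: "Measurable.pred M (\<lambda>w. impr d \<alpha> n (P w) q i = {})" unfolding e by measurable
  have [measurable]: "(\<lambda>w. LEAST j. j \<in> impr d \<alpha> n (P w) q i \<and>
      (\<forall>k\<in>impr d \<alpha> n (P w) q i. ip d (P w k) q \<le> ip d (P w j) q)) \<in> measurable M (count_space UNIV)"
    using pred_best by (intro measurable_Least) auto
  show ?thesis unfolding greedy_next_def by measurable
qed

text \<open>The next vertex takes countably many values, so the walk is measurable piece by piece,
  for each fixed value of \<open>greedy_next\<close>.\<close>

lemma measurable_walk [measurable]:
  "(\<lambda>w. walk d \<alpha> g n (P w) q f i) \<in> measurable M (count_space UNIV)"
proof (induction f arbitrary: i)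
  case 0
  show ?case by simp
next
  case (Suc f)
  have [measurable]: "(\<lambda>w. walk d \<alpha> g n (P w) q f j) \<in> measurable M (count_space UNIV)" for j by (rule Suc)
  have "(\<lambda>w. (\<lambda>x w. case x of None \<Rightarrow> (None, 1 + card (nbrs d \<alpha> n (P w) i))
      | Some j \<Rightarrow> (fst (walk d \<alpha> g n (P w) q f j), 1 + card (nbrs d \<alpha> n (P w) i) + snd (walk d \<alpha> g n (P w) q f j)))
      (greedy_next d \<alpha> n (P w) q i) w) \<in> measurable M (count_space UNIV)"
  proof (rule measurable_compose_countable[OF _ measurable_greedy_next])
    fix x :: "nat option"
    show "(\<lambda>w. case x of None \<Rightarrow> (None :: nat option, 1 + card (nbrs d \<alpha> n (P w) i))
      | Some j \<Rightarrow> (fst (walk d \<alpha> g n (P w) q f j), 1 + card (nbrs d \<alpha> n (P w) i) + snd (walk d \<alpha> g n (P w) q f j)))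
      \<in> measurable M (count_space UNIV)"
      by (cases x) simp_all
  qed
  hence [measurable]: "(\<lambda>w. case greedy_next d \<alpha> n (P w) q i of None \<Rightarrow> (None, 1 + card (nbrs d \<alpha> n (P w) i))
      | Some j \<Rightarrow> (fst (walk d \<alpha> g n (P w) q f j), 1 + card (nbrs d \<alpha> n (P w) i) + snd (walk d \<alpha> g n (P w) q f j)))
      \<in> measurable M (count_space UNIV)" by simp
  show ?case unfolding walk.simps by measurable
qed

lemma measurable_iter:
  assumes [measurable]: "\<And>k. (\<lambda>w. S w k) \<in> measurable M (count_space UNIV)"
  shows "(\<lambda>w. iter d \<alpha> g n (P w) q (S w) k) \<in> measurable M (count_space UNIV)"
  unfolding iter_def by (rule measurable_compose_countable[OF measurable_walk]) measurable

lemma measurable_iter_fst_snd: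
  assumes "\<And>k. (\<lambda>w. S w k) \<in> measurable M (count_space UNIV)"
  shows "(\<lambda>w. fst (iter d \<alpha> g n (P w) q (S w) k)) \<in> measurable M (count_space UNIV)"
    "(\<lambda>w. snd (iter d \<alpha> g n (P w) q (S w) k)) \<in> measurable M (count_space UNIV)"
  by (rule measurable_compose[OF measurable_iter[of S, OF assms]], simp)+

lemma pred_query:
  assumes [measurable]: "\<And>k. (\<lambda>w. S w k) \<in> measurable M (count_space UNIV)"
  shows "Measurable.pred M (\<lambda>w. query_ok d \<alpha> g n (P w) q (S w))"
    "(\<lambda>w. query_result d \<alpha> g n (P w) q (S w)) \<in> measurable M (count_space UNIV)"
    "(\<lambda>w. query_time d \<alpha> g n (P w) q (S w)) \<in> measurable M (count_space UNIV)"
proof -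
  note [measurable] = measurable_iter_fst_snd[of S, OF assms]
  show "Measurable.pred M (\<lambda>w. query_ok d \<alpha> g n (P w) q (S w))" unfolding query_ok_def by measurable
  have [measurable]: "(\<lambda>w. query_iters d \<alpha> g n (P w) q (S w)) \<in> measurable M (count_space UNIV)"
    unfolding query_iters_def by measurable
  show "(\<lambda>w. query_result d \<alpha> g n (P w) q (S w)) \<in> measurable M (count_space UNIV)"
    unfolding query_result_def
    by (rule measurable_compose_countable[where f = "\<lambda>k w. fst (iter d \<alpha> g n (P w) q (S w) k)"]) measurable
  show "(\<lambda>w. query_time d \<alpha> g n (P w) q (S w)) \<in> measurable M (count_space UNIV)"
    unfolding query_time_def
    by (rule measurable_compose_countable[where f = "\<lambda>k w. \<Sum>k\<le>k. snd (iter d \<alpha> g n (P w) q (S w) k)"]) measurable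
qed

lemma measurable_costs:
  assumes [measurable]: "z \<in> measurable M (Rd d)"
  shows "(\<lambda>w. space_cost d \<alpha> n (P w)) \<in> measurable M (count_space UNIV)"
    "(\<lambda>w. insert_cost d \<alpha> n (P w) (z w)) \<in> measurable M (count_space UNIV)"
    "(\<lambda>w. delete_cost d \<alpha> n (P w) i) \<in> measurable M (count_space UNIV)"
proof -
  show "(\<lambda>w. space_cost d \<alpha> n (P w)) \<in> measurable M (count_space UNIV)"
    unfolding space_cost_def by measurable
  have [measurable]: "(\<lambda>w. ip d (z w) (P w j)) \<in> borel_measurable M" for j
    using pt[of j]
  proof
    assume "\<exists>v. \<forall>w\<in>space M. P w j = v"
    then obtain v where "\<forall>w\<in>space M. P w j = v" by blast
    thus ?thesis by (subst measurable_cong[where g = "\<lambda>w. ip d (z w) v"]) auto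
  qed measurable
  have "card {j. j < n \<and> \<alpha> \<le> ip d (z w) (P w j)} = (\<Sum>j<n. if \<alpha> \<le> ip d (z w) (P w j) then 1 else 0)" for w
    by (simp add: sum.If_cases Int_def lessThan_def)
  thus "(\<lambda>w. insert_cost d \<alpha> n (P w) (z w)) \<in> measurable M (count_space UNIV)"
    unfolding insert_cost_def by simp
  show "(\<lambda>w. delete_cost d \<alpha> n (P w) i) \<in> measurable M (count_space UNIV)"
    unfolding delete_cost_def by measurable
qed

end

lemma sets_cap_unif [simp, measurable_cong]: "sets (cap_unif d q g) = sets (Rd d)"
  by (simp add: cap_unif_def)

lemma space_cap_unif [simp]: "space (cap_unif d q g) = space (Rd d)"
  using sets_eq_imp_space_eq[OF sets_cap_unif] .

abbreviation points_model :: "nat \<Rightarrow> nat \<Rightarrow> real \<Rightarrow> (nat \<Rightarrow> real) \<Rightarrow> (nat \<Rightarrow> nat \<Rightarrow> real) measure" where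
  "points_model d n g q \<equiv> PiM {..<n} (\<lambda>i. if i = 0 then cap_unif d q g else unif_sphere d)"

lemma random_points_model: "random_points (points_model d n g q) (\<lambda>P. P) d"
proof
  fix i
  show "(\<lambda>P. P i) \<in> measurable (points_model d n g q) (Rd d) \<or> (\<exists>v. \<forall>P\<in>space (points_model d n g q). P i = v)"
  proof (cases "i < n")
    case True
    have "(\<lambda>P. P i) \<in> measurable (points_model d n g q) (if i = 0 then cap_unif d q g else unif_sphere d)"
      by (rule measurable_component_singleton) (use True in simp)
    thus ?thesis by (simp split: if_splits cong: measurable_cong_sets)
  next
    case False
    thus ?thesis by (intro disjI2 exI[of _ undefined]) (auto simp: space_PiM PiE_def extensional_def)
  qed
qed

lemma random_points_compose:
  assumes "random_points M P d" "h \<in> measurable M' M"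
  shows "random_points M' (\<lambda>w. P (h w)) d"
proof
  fix i
  from assms(1) have "(\<lambda>w. P w i) \<in> measurable M (Rd d) \<or> (\<exists>v. \<forall>w\<in>space M. P w i = v)"
    by (simp add: random_points_def)
  thus "(\<lambda>w. P (h w) i) \<in> measurable M' (Rd d) \<or> (\<exists>v. \<forall>w\<in>space M'. P (h w) i = v)"
    using measurable_compose[OF assms(2)] measurable_space[OF assms(2)] by blast
qed

text \<open>\<open>measure\<close> is 0 outside the sigma-algebra, so a lower bound on the success
  probability requires measurability of the whole search.\<close>

lemma good_event_sets: "good_event d n \<alpha> g q \<rho> \<kappa> e \<in> sets (nn_model d n g q)"
proof -
  let ?M = "nn_model d n g q"
  interpret random_points ?M "\<lambda>w. fst (fst w)" d n
    by (rule random_points_compose[OF random_points_model[where d = d and n = n and g = g and q = q]]) (simp add: nn_model_def)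
  have S [measurable]: "(\<lambda>w. snd (fst w) k) \<in> measurable ?M (count_space UNIV)" for k
  proof -
    have "(\<lambda>S. S k) \<in> measurable (PiM UNIV (\<lambda>_::nat. measure_pmf (pmf_of_set {..<n}))) (measure_pmf (pmf_of_set {..<n}))"
      by (rule measurable_component_singleton) simp
    hence "(\<lambda>S. S k) \<in> measurable (PiM UNIV (\<lambda>_::nat. measure_pmf (pmf_of_set {..<n}))) (count_space UNIV)"
      by (simp cong: measurable_cong_sets)
    thus ?thesis unfolding nn_model_def by measurable
  qed
  have z: "(\<lambda>w. snd w) \<in> measurable ?M (Rd d)"
    unfolding nn_model_def using measurable_snd by (simp cong: measurable_cong_sets)
  note [measurable] = pred_query[OF S] measurable_costs[OF z]
  show ?thesis unfolding good_event_def Let_def by measurable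
qed

section \<open>Elementary tail estimates\<close>

lemma power_fact_le_exp: "0 \<le> x \<Longrightarrow> x ^ k / fact k \<le> exp (x::real)"
proof -
  assume x: "0 \<le> x"
  have "(\<Sum>i\<in>{k}. x ^ i /\<^sub>R fact i) \<le> (\<Sum>i. x ^ i /\<^sub>R fact i)"
    using summable_exp_generic[of x] x by (intro sum_le_suminf) auto
  thus ?thesis by (simp add: exp_def divide_inverse mult.commute)
qed

text \<open>Multiplying by \<open>2^k\<close> gives a term of the series of
  \<open>exp (2 * x)\<close>, which is at most \<open>exp (k/5)\<close>; and \<open>2^k\<close> is
  at least \<open>exp (k/2)\<close>.\<close>

lemma power_fact_small:
  assumes "0 \<le> x" "10 * x \<le> real k"
  shows "x ^ k / fact k \<le> exp (- (real k / 4))"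
proof -
  have "exp (1/2) ^ 2 = exp (1::real)" by (simp add: power2_eq_square exp_add[symmetric])
  hence "exp (1/2) ^ 2 \<le> (2::real) ^ 2" using exp_le by simp
  hence "exp (1/2) \<le> (2::real)" by (rule power2_le_imp_le) simp
  hence "exp (1/2) ^ k \<le> (2::real) ^ k" by (intro power_mono) auto
  hence e2: "exp (real k / 2) \<le> 2 ^ k" by (simp add: exp_of_nat_mult[symmetric])
  have "2 ^ k * (x ^ k / fact k) = (2 * x) ^ k / fact k" by (simp add: power_mult_distrib)
  also have "\<dots> \<le> exp (2 * x)" using assms by (intro power_fact_le_exp) auto
  also have "\<dots> \<le> exp (real k / 5)" using assms by simp
  finally have "exp (real k / 2) * (x ^ k / fact k) \<le> exp (real k / 5)"
    using e2 assms(1) by (meson mult_right_mono order_trans zero_le_divide_iff zero_le_power fact_ge_zero)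
  hence "x ^ k / fact k \<le> exp (real k / 5) / exp (real k / 2)" by (simp add: field_simps)
  also have "\<dots> = exp (real k / 5 - real k / 2)" by (rule exp_diff[symmetric])
  also have "\<dots> \<le> exp (- (real k / 4))" by simp
  finally show ?thesis .
qed

lemma power_one_minus_le_exp:
  assumes "p \<le> 1" "x \<le> p * real b"
  shows "(1 - p) ^ b \<le> exp (- x)"
proof -
  have "(1 - p) ^ b \<le> exp (- p) ^ b"
    using assms exp_ge_add_one_self[of "- p"] by (intro power_mono) auto
  also have "\<dots> = exp (- (p * real b))" by (simp add: exp_of_nat_mult[symmetric] mult.commute)
  finally show ?thesis using assms by (meson exp_le_cancel_iff neg_le_iff_le order_trans)
qed

section \<open>Rare events around a fixed planted point\<close>

text \<open>\<open>\<eta>\<close> is the error allowed in exponents; the much smaller \<open>\<sigma>\<close> absorbs constants and \<open>n powr o(1)\<close>.\<close>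
locale search = regime d n \<sigma> \<mu> for d n \<sigma> \<mu> +
  fixes q x0 :: "nat \<Rightarrow> real" and \<kappa> s \<gamma> \<eta> :: real and L :: nat
  assumes q: "ip d q q = 1"
    and kap: "0 < \<kappa>" "\<kappa> < 1" and s: "0 < s" "s^2 = 1 - \<kappa>^2"
    and gam: "0 < \<gamma>" "\<gamma> < 1" "\<sigma> \<le> \<gamma>"
    and eta: "0 < \<eta>" "4 * \<eta> \<le> s" "10 * \<eta> \<le> 1" and sg_eta: "21 * \<sigma> \<le> s * \<eta>" and sg_kap: "\<sigma> \<le> \<kappa> * \<eta>"
    and rho_gap: "(1 - 2 * \<gamma> * \<kappa> * s) / (1 - \<gamma>^2) < 1 \<Longrightarrow>
      (1 - 2 * \<gamma> * \<kappa> * s) / (1 - \<gamma>^2) + 6 * \<eta> / s + 8 * \<sigma> \<le> 1"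
    and L: "2 \<le> \<eta> * real L"
    and n_large_exp: "real n ^ 2 * exp (- (real n powr \<sigma> / 4)) \<le> real n powr (- \<sigma>)"
    and n_large_eta: "16 / \<eta> \<le> real n powr (2 * \<eta>)"
    and n_large_L: "5 * real L \<le> real n powr \<eta>"
    and x0_space: "x0 \<in> space (Rd d)" and x0_unit: "ip d x0 x0 = 1" and x0_q: "\<gamma> \<le> ip d x0 q"
begin

sublocale iid_points \<nu> n x0
  by (intro iid_points.intro prob_space_unif_sphere iid_points_axioms.intro) (simp add: x0_space)

lemma s_less_1: "s < 1"
proof -
  have "0 < \<kappa>^2" using kap by simp
  hence "s^2 < 1^2" using s(2) by simp
  thus ?thesis by (rule power2_less_imp_less) simp
qed

lemma s_eta_le: "s * \<eta> \<le> \<eta>" "4 * (s * \<eta>) \<le> s^2" "\<eta>^2 \<le> s * \<eta>"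
proof -
  show "s * \<eta> \<le> \<eta>" using s s_less_1 eta by (simp add: mult_left_le_one_le)
  show "4 * (s * \<eta>) \<le> s^2" using mult_left_mono[OF eta(2), of s] s(1) by (simp add: power2_eq_square algebra_simps)
  show "\<eta>^2 \<le> s * \<eta>" using eta unfolding power2_eq_square by (intro mult_right_mono) auto
qed

lemma sg_le: "21 * \<sigma> \<le> \<eta>" "84 * \<sigma> \<le> s^2" "\<sigma> \<le> 1/210"
  using sg_eta s_eta_le eta by linarith+

lemma kap_sq: "0 < \<kappa>^2" "\<kappa>^2 < 1"
proof -
  show "0 < \<kappa>^2" using kap by simp
  have "0 < s^2" using s(1) by simp
  thus "\<kappa>^2 < 1" using s(2) by linarith
qed

lemma n1: "1 \<le> real n" using n2 by simp

lemma powr_le: "a \<le> b \<Longrightarrow> real n powr a \<le> real n powr b"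
  using n1 by (intro powr_mono) auto

lemma n_pow: "real n * real n powr a = real n powr (1 + a)"
  using n2 by (simp add: powr_add)

lemma n_ge: "25 \<le> real n"
proof -
  have "25 \<le> real n powr \<sigma>" using powr_sg_ge exp_ge_add_one_self[of 24] by linarith
  also have "\<dots> \<le> real n powr 1" using sg by (intro powr_le) auto
  finally show ?thesis using n2 by simp
qed

lemma n_sg: "25 \<le> real n powr \<sigma>"
  using powr_sg_ge exp_ge_add_one_self[of 24] by linarith

lemma absorb: "c \<le> 25 \<Longrightarrow> c * real n powr a \<le> real n powr (a + \<sigma>)"
proof -
  assume "c \<le> 25"
  hence "c \<le> real n powr \<sigma>" using n_sg by linarith
  hence "c * real n powr a \<le> real n powr \<sigma> * real n powr a" by (rule mult_right_mono) simp
  thus ?thesis by (simp add: powr_add mult.commute)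
qed

lemma exp_small: "real n * exp (- (real n powr \<sigma> / 4)) \<le> real n powr (- \<sigma>)"
  "exp (- (real n powr \<sigma> / 4)) \<le> real n powr (- \<sigma>)"
proof -
  let ?e = "exp (- (real n powr \<sigma> / 4))"
  have "real n * ?e \<le> real n ^ 2 * ?e" using n1 by (intro mult_right_mono) (auto simp: power2_eq_square)
  thus 1: "real n * ?e \<le> real n powr (- \<sigma>)" using n_large_exp by linarith
  have "1 * ?e \<le> real n * ?e" using n1 by (intro mult_right_mono) auto
  thus "?e \<le> real n powr (- \<sigma>)" using 1 by linarith
qed

text \<open>At height \<open>2 * \<mu>\<close> the tail is \<open>n powr (- 4 + \<sigma>)\<close>,
  small enough for a union bound over all points, while correlation \<open>2 * \<mu>\<close> with
  the query is still small enough for the two-cap estimates.\<close>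

definition typical :: "(nat \<Rightarrow> real) \<Rightarrow> bool" where
  "typical x \<longleftrightarrow> ip d x x = 1 \<and> \<bar>ip d x q\<bar> \<le> 2 * \<mu>"

lemma pred_typical [measurable]: "Measurable.pred \<nu> typical"
  unfolding typical_def by measurable

lemma typical_bound: "prob {y \<in> space (Rd d). \<not> typical y} \<le> 2 * real n powr (- 4 + \<sigma>)"
proof -
  let ?A = "{y \<in> space (Rd d). ip d y y \<noteq> 1}"
  let ?B = "{y \<in> space (Rd d). 2 * \<mu> \<le> ip d y q}"
  let ?C = "{y \<in> space (Rd d). 2 * \<mu> \<le> ip d y (\<lambda>i. - q i)}"
  have m: "?A \<in> events" "?B \<in> events" "?C \<in> events" by measurable
  have "prob {y \<in> space (Rd d). \<not> typical y} \<le> prob (?A \<union> (?B \<union> ?C))"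
    using m by (intro finite_measure_mono) (auto simp: typical_def ip_uminus_right)
  also have "\<dots> \<le> prob ?A + prob (?B \<union> ?C)" using m by (intro measure_Un_le) auto
  also have "prob (?B \<union> ?C) \<le> prob ?B + prob ?C" using m by (intro measure_Un_le) auto
  also have "prob ?B \<le> real n powr (- (2^2) + \<sigma>)" using q by (intro cap_upper) auto
  also have "prob ?C \<le> real n powr (- (2^2) + \<sigma>)" using q by (intro cap_upper) (auto simp: ip_uminus_right ip_uminus_left)
  also have "prob ?A = 0" by (rule AE_unif_sphere[OF d0])
  finally show ?thesis by simp
qed

lemma atypical_rare: "rare (\<lambda>\<xi>. \<exists>i\<in>{1..<n}. \<not> typical (pts \<xi> i)) (real n powr (- \<sigma>))"
proof (rule rare_Bex)
  show "Om.prob {\<xi> \<in> space \<Omega>. \<not> typical (pts \<xi> i)} \<le> 2 * real n powr (- 4 + \<sigma>)" if "i \<in> {1..<n}" for i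
    using that typical_bound by (intro point_bound) auto
  have "real (card {1..<n}) * (2 * real n powr (- 4 + \<sigma>)) \<le> real n * (2 * real n powr (- 4 + \<sigma>))"
    by (intro mult_right_mono) auto
  also have "\<dots> = 2 * real n powr (1 + (- 4 + \<sigma>))" using n_pow[of "- 4 + \<sigma>"] by simp
  also have "\<dots> \<le> real n powr (1 + (- 4 + \<sigma>) + \<sigma>)" by (rule absorb) simp
  also have "\<dots> \<le> real n powr (- \<sigma>)" using sg by (intro powr_le) auto
  finally show "real (card {1..<n}) * (2 * real n powr (- 4 + \<sigma>)) \<le> real n powr (- \<sigma>)" .
  show "Measurable.pred \<Omega> (\<lambda>\<xi>. \<not> typical (pts \<xi> i))" if "i \<in> {1..<n}" for i
    using that by (intro pred_intros_logic(2) pred_pt[OF pred_typical]) auto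
qed simp

text \<open>The mean degree is at most \<open>n powr (1 - \<kappa>^2 + \<sigma>)\<close>; the second
  \<open>\<sigma>\<close> makes the bound at least ten times the mean, as
  \<open>power_fact_small\<close> requires.\<close>

definition Dg :: nat where "Dg = nat \<lceil>real n powr (1 - \<kappa>^2 + 2 * \<sigma>)\<rceil>"

text \<open>The condition on \<open>x\<close> makes the cap bound valid for every \<open>x\<close>
  in the space, not only on the sphere. \<open>creep\<close> and \<open>rival\<close> contain
  \<open>typical x\<close> for the same reason: the peeling lemmas ask for bounds uniform in
  \<open>x\<close>.\<close>

definition adj :: "(nat \<Rightarrow> real) \<Rightarrow> (nat \<Rightarrow> real) \<Rightarrow> bool" where
  "adj x y \<longleftrightarrow> ip d x x \<le> 1 \<and> \<kappa> * \<mu> \<le> ip d y x"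

lemma pred_adj [measurable]: "Measurable.pred (\<nu> \<Otimes>\<^sub>M \<nu>) (\<lambda>(x, y). adj x y)"
  unfolding adj_def split_beta' by measurable

lemma adj_bound: "prob {y \<in> space (Rd d). adj x y} \<le> real n powr (- (\<kappa>^2) + \<sigma>)"
proof (cases "ip d x x \<le> 1")
  case True
  thus ?thesis using cap_upper[of x \<kappa>] kap by (simp add: adj_def)
qed (simp add: adj_def)

lemma high_degree_rare: "rare (\<lambda>\<xi>. \<exists>i\<in>{..<n}. Dg \<le> card {j \<in> {1..<n} - {i}. adj (pts \<xi> i) (pts \<xi> j)}) (real n powr (- \<sigma>))"
proof (rule rare_Bex)
  let ?p = "real n powr (- (\<kappa>^2) + \<sigma>)"
  have Dg: "real n powr (1 - \<kappa>^2 + 2 * \<sigma>) \<le> real Dg" unfolding Dg_def by (rule real_nat_ceiling_ge)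
  have np: "real n * ?p = real n powr (1 - \<kappa>^2 + \<sigma>)" using n_pow by (simp add: algebra_simps)
  have "10 * (real n * ?p) \<le> real n powr (1 - \<kappa>^2 + \<sigma> + \<sigma>)" unfolding np by (rule absorb) simp
  hence k10: "10 * (real n * ?p) \<le> real Dg" using Dg by (simp add: algebra_simps)
  have "real n powr \<sigma> \<le> real n powr (1 - \<kappa>^2 + 2 * \<sigma>)" using sg kap_sq by (intro powr_le) auto
  hence Dsg: "real n powr \<sigma> \<le> real Dg" using Dg by simp
  fix i assume i: "i \<in> {..<n}"
  have "Om.prob {\<xi> \<in> space \<Omega>. Dg \<le> card {j \<in> {1..<n} - {i}. adj (pts \<xi> i) (pts \<xi> j)}} \<le> (real n * ?p) ^ Dg / fact Dg"
    using i adj_bound by (intro many_hits_bound pred_adj) auto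
  also have "\<dots> \<le> exp (- (real Dg / 4))" using k10 by (intro power_fact_small) auto
  also have "\<dots> \<le> exp (- (real n powr \<sigma> / 4))" using Dsg by simp
  finally show "Om.prob {\<xi> \<in> space \<Omega>. Dg \<le> card {j \<in> {1..<n} - {i}. adj (pts \<xi> i) (pts \<xi> j)}} \<le> exp (- (real n powr \<sigma> / 4))" .
  have "(\<lambda>\<xi>. card {j \<in> {1..<n} - {i}. adj (pts \<xi> i) (pts \<xi> j)}) \<in> measurable \<Omega> (count_space UNIV)"
    using i by (intro measurable_card_filter pred_pt2[OF pred_adj]) auto
  thus "Measurable.pred \<Omega> (\<lambda>\<xi>. Dg \<le> card {j \<in> {1..<n} - {i}. adj (pts \<xi> i) (pts \<xi> j)})" by measurable
qed (use exp_small in auto)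

definition climb :: "(nat \<Rightarrow> real) \<Rightarrow> (nat \<Rightarrow> real) \<Rightarrow> bool" where
  "climb x y \<longleftrightarrow> \<kappa> * \<mu> \<le> ip d y x \<and> (s - \<eta>) * \<mu> \<le> ip d y q"

lemma pred_climb [measurable]: "Measurable.pred (\<nu> \<Otimes>\<^sub>M \<nu>) (\<lambda>(x, y). climb x y)"
  unfolding climb_def split_beta' by measurable

text \<open>Because \<open>\<kappa>^2 + s^2 = 1\<close>, the expected number of neighbours above
  \<open>(s - \<eta>) * \<mu>\<close> is at least \<open>n\<close> to the power
  \<open>2 * s * \<eta> - \<eta>^2 - 12 * \<sigma>\<close>, up to a constant. This exponent is at
  least \<open>\<sigma>\<close>, so finding none is superpolynomially unlikely.\<close>

lemma stuck_low_rare: "rare (\<lambda>\<xi>. \<exists>i\<in>{1..<n}. typical (pts \<xi> i) \<and> (\<forall>j\<in>{1..<n} - {i}. \<not> climb (pts \<xi> i) (pts \<xi> j))) (real n powr (- \<sigma>))"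
proof (rule rare_Bex)
  let ?p = "real n powr (- (\<kappa>^2 + (s - \<eta>)^2) - 12 * \<sigma>)"
  have nC: "Measurable.pred (\<nu> \<Otimes>\<^sub>M \<nu>) (\<lambda>(x, y). \<not> climb x y)"
    using pred_intros_logic(2)[OF pred_climb] by (simp add: split_beta')
  have "?p \<le> real n powr 0" using sg zero_le_power2[of \<kappa>] zero_le_power2[of "s - \<eta>"] by (intro powr_le) linarith
  hence p1: "?p \<le> 1" using n2 by simp
  fix i assume i: "i \<in> {1..<n}"
  have "Om.prob {\<xi> \<in> space \<Omega>. typical (pts \<xi> i) \<and> (\<forall>j\<in>{1..<n} - {i}. \<not> climb (pts \<xi> i) (pts \<xi> j))} \<le> (1 - ?p) ^ card ({1..<n} - {i})"
  proof (rule star_bound[OF nC pred_typical])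
    fix x assume x: "x \<in> space \<nu>" "typical x"
    have "?p \<le> prob {y \<in> space (Rd d). \<kappa> * \<mu> \<le> ip d y x \<and> (s - \<eta>) * \<mu> \<le> ip d y q}"
      using x q kap eta s s_less_1 by (intro two_caps_lower) (auto simp: typical_def)
    also have "{y \<in> space (Rd d). \<kappa> * \<mu> \<le> ip d y x \<and> (s - \<eta>) * \<mu> \<le> ip d y q} = {y \<in> space (Rd d). climb x y}"
      by (auto simp: climb_def)
    finally have c: "?p \<le> prob {y \<in> space (Rd d). climb x y}" .
    have "{y \<in> space (Rd d). climb x y} \<in> events" unfolding climb_def using x(1) by measurable
    moreover have "{y \<in> space \<nu>. \<not> climb x y} = space \<nu> - {y \<in> space (Rd d). climb x y}" by auto
    ultimately show "prob {y \<in> space \<nu>. \<not> climb x y} \<le> 1 - ?p"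
      using c prob_compl[of "{y \<in> space (Rd d). climb x y}"] by simp
  qed (use i p1 in auto)
  also have "card ({1..<n} - {i}) = n - 2" using i by (simp add: numeral_2_eq_2)
  also have "(1 - ?p) ^ (n - 2) \<le> exp (- (real n powr \<sigma> / 4))"
  proof (rule power_one_minus_le_exp[OF p1])
    have "\<kappa>^2 + (s - \<eta>)^2 = 1 - 2 * (s * \<eta>) + \<eta>^2" using s(2) by (simp add: power2_diff)
    hence "\<sigma> \<le> 1 + (- (\<kappa>^2 + (s - \<eta>)^2) - 12 * \<sigma>)" using s_eta_le(3) sg_eta sg by linarith
    hence "real n powr \<sigma> \<le> real n * ?p" unfolding n_pow by (rule powr_le)
    also have "real n * ?p \<le> (4 * real (n - 2)) * ?p" using n_ge by (intro mult_right_mono) auto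
    finally show "real n powr \<sigma> / 4 \<le> ?p * real (n - 2)" by (simp add: mult_ac)
  qed
  finally show "Om.prob {\<xi> \<in> space \<Omega>. typical (pts \<xi> i) \<and> (\<forall>j\<in>{1..<n} - {i}. \<not> climb (pts \<xi> i) (pts \<xi> j))} \<le> exp (- (real n powr \<sigma> / 4))" .
  show "Measurable.pred \<Omega> (\<lambda>\<xi>. typical (pts \<xi> i) \<and> (\<forall>j\<in>{1..<n} - {i}. \<not> climb (pts \<xi> i) (pts \<xi> j)))"
    using i by (intro pred_intros_logic pred_intros_finite pred_pt[OF pred_typical] pred_pt2[OF pred_climb]) auto
next
  have "real (card {1..<n}) * exp (- (real n powr \<sigma> / 4)) \<le> real n * exp (- (real n powr \<sigma> / 4))"
    by (intro mult_right_mono) auto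
  thus "real (card {1..<n}) * exp (- (real n powr \<sigma> / 4)) \<le> real n powr (- \<sigma>)" using exp_small by linarith
qed auto

text \<open>The budget behind 14: \<open>2 * \<eta>\<close> absorbs the constant
  \<open>16 / \<eta>\<close> of the slab bound, \<open>4 * \<eta>\<close> the start at level
  \<open>s - 2 * \<eta>\<close> instead of \<open>s\<close>, \<open>5 * \<eta>\<close> the total
  shift of the translates. What remains is \<open>3 * \<eta>\<close>, of which \<open>\<eta>\<close>
  is kept after the \<open>\<sigma>\<close> terms.\<close>

definition \<Delta> :: real where "\<Delta> = real n powr (- 14 * \<eta>)"

definition creep :: "(nat \<Rightarrow> real) \<Rightarrow> (nat \<Rightarrow> real) \<Rightarrow> bool" where
  "creep x y \<longleftrightarrow> typical x \<and> (s - 2 * \<eta>) * \<mu> \<le> ip d x q \<and> \<kappa> * \<mu> \<le> ip d y x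
     \<and> ip d x q \<le> ip d y q \<and> ip d y q \<le> ip d x q + \<Delta> * \<mu>"

lemma pred_creep [measurable]: "Measurable.pred (\<nu> \<Otimes>\<^sub>M \<nu>) (\<lambda>(x, y). creep x y)"
  unfolding creep_def split_beta' typical_def by measurable

text \<open>The slab estimate with width \<open>\<Delta>\<close>, which must be at least
  \<open>1/d\<close> for the shell argument. The result is below \<open>1/n\<close> by a power of
  \<open>n\<close>, so a point has on average fewer than one such successor.\<close>

lemma creep_bound:
  assumes d: "1 / real d \<le> \<Delta>"
  shows "prob {y \<in> space (Rd d). creep x y} \<le> real n powr (- 1 - \<eta>)"
proof (cases "typical x \<and> (s - 2 * \<eta>) * \<mu> \<le> ip d x q")
  case True
  define b where "b = ip d x q / \<mu>"
  have bm: "b * \<mu> = ip d x q" using mu_pos by (simp add: b_def)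
  have b1: "s - 2 * \<eta> \<le> b" using True mu_pos by (simp add: b_def field_simps)
  have b2: "b \<le> 2" using True mu_pos by (simp add: b_def pos_divide_le_eq typical_def abs_le_iff)
  have b0: "0 \<le> b" using b1 eta s by simp
  have "(s - 2 * \<eta>)^2 \<le> b^2" using b1 eta s by (intro power_mono) auto
  moreover have "(s - 2 * \<eta>)^2 = s^2 - 4 * (s * \<eta>) + 4 * \<eta>^2" by (simp add: power2_eq_square algebra_simps)
  ultimately have kb: "1 - 4 * \<eta> \<le> \<kappa>^2 + b^2" using s s_eta_le by (smt (verit) zero_le_power2)
  have "16 / \<eta> * \<Delta> \<le> real n powr (2 * \<eta>) * real n powr (- 14 * \<eta>)"
    unfolding \<Delta>_def using n_large_eta by (intro mult_right_mono) auto
  also have "\<dots> = real n powr (- 12 * \<eta>)" by (simp add: powr_add[symmetric])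
  finally have D12: "16 / \<eta> * \<Delta> \<le> real n powr (- 12 * \<eta>)" .
  also have "\<dots> \<le> real n powr 0" using eta by (intro powr_le) auto
  finally have "16 / \<eta> * \<Delta> \<le> 1" using n2 by simp
  hence D8: "8 * \<Delta> \<le> \<eta>" using eta by (simp add: field_simps)
  have "prob {y \<in> space (Rd d). creep x y} \<le> prob {y \<in> space (Rd d). \<kappa> * \<mu> \<le> ip d y x \<and> b * \<mu> \<le> ip d y q \<and> ip d y q \<le> b * \<mu> + \<Delta> * \<mu>}"
  proof (rule finite_measure_mono)
    show "{y \<in> space (Rd d). \<kappa> * \<mu> \<le> ip d y x \<and> b * \<mu> \<le> ip d y q \<and> ip d y q \<le> b * \<mu> + \<Delta> * \<mu>} \<in> events" by measurable
  qed (auto simp: creep_def bm)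
  also have "\<dots> \<le> 16 * \<Delta> / \<eta> * real n powr (- (\<kappa>^2 + b^2) + 5 * \<eta> + 2 * \<sigma>)"
    using True q kap b0 b2 d D8 eta kb sg_le by (intro slab_upper) (auto simp: typical_def)
  also have "\<dots> \<le> real n powr (- 12 * \<eta>) * real n powr (- (1 - 4 * \<eta>) + 5 * \<eta> + 2 * \<sigma>)"
  proof (rule mult_mono)
    show "16 * \<Delta> / \<eta> \<le> real n powr (- 12 * \<eta>)" using D12 by simp
    show "real n powr (- (\<kappa>^2 + b^2) + 5 * \<eta> + 2 * \<sigma>) \<le> real n powr (- (1 - 4 * \<eta>) + 5 * \<eta> + 2 * \<sigma>)"
      using kb by (intro powr_le) auto
  qed auto
  also have "\<dots> = real n powr (- 1 - 3 * \<eta> + 2 * \<sigma>)" by (simp add: powr_add[symmetric] algebra_simps)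
  also have "\<dots> \<le> real n powr (- 1 - \<eta>)" using sg_le eta by (intro powr_le) linarith
  finally show ?thesis .
next
  case False
  hence e: "{y \<in> space (Rd d). creep x y} = {}" by (auto simp: creep_def)
  show ?thesis unfolding e by simp
qed

text \<open>The expected number of chains is at most \<open>n powr (1 - \<eta> * L)\<close>, and
  \<open>L\<close> was chosen with \<open>\<eta> * L \<ge> 2\<close>.\<close>

lemma creep_chain_rare:
  assumes d: "1 / real d \<le> \<Delta>"
  shows "rare (\<lambda>\<xi>. \<exists>xs\<in>{xs. set xs \<subseteq> {1..<n} \<and> length xs = Suc L \<and> distinct xs}.
      successively (\<lambda>i j. creep (pts \<xi> i) (pts \<xi> j)) xs) (real n powr (- \<sigma>))"
proof (rule rare_mono[OF no_chain_bound[where p = "real n powr (- 1 - \<eta>)", OF pred_creep]])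
  show "prob {y \<in> space \<nu>. creep x y} \<le> real n powr (- 1 - \<eta>)" for x using creep_bound[OF d] by simp
  have e: "real n * real n powr (- 1 - \<eta>) = real n powr (- \<eta>)" unfolding n_pow by simp
  have "(real n powr (- \<eta>)) ^ L = real n powr (- (\<eta> * real L))"
  proof -
    have "0 < real n powr (- \<eta>)" using n2 by simp
    hence "(real n powr (- \<eta>)) ^ L = (real n powr (- \<eta>)) powr real L" by (simp add: powr_realpow)
    also have "\<dots> = real n powr (- \<eta> * real L)" by (rule powr_powr)
    finally show ?thesis by simp
  qed
  hence "real n * (real n powr (- \<eta>)) ^ L = real n powr (1 - \<eta> * real L)" using n_pow by simp
  hence "real n * (real n powr (- \<eta>)) ^ L \<le> real n powr (- \<sigma>)"
    using L sg powr_le[of "1 - \<eta> * real L" "- \<sigma>"] by linarith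
  thus "real n * (real n * real n powr (- 1 - \<eta>)) ^ L \<le> real n powr (- \<sigma>)" unfolding e .
qed simp

end

section \<open>Counting the successful starts\<close>

lemma nat_div_ge:
  assumes "0 < b"
  shows "real a / real b - 1 \<le> real (a div b)"
proof -
  have "real a = real (a div b) * real b + real (a mod b)"
    by (metis div_mult_mod_eq of_nat_add of_nat_mult)
  moreover have "real (a mod b) < real b" using assms by simp
  ultimately have "real a \<le> (real (a div b) + 1) * real b" by (simp add: distrib_right)
  hence "real a / real b \<le> real (a div b) + 1" using assms by (simp add: pos_divide_le_eq)
  thus ?thesis by linarith
qed

text \<open>Double counting: \<open>i\<close> is certified by \<open>j\<close> if \<open>i \<in> D j\<close> and nothing obstructs the pair.\<close>
lemma card_certified:
  fixes D :: "'a \<Rightarrow> 'b set" and bad :: "'a \<Rightarrow> 'b \<Rightarrow> 'c set"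
  assumes fin: "finite G" "finite I" "finite K"
    and D: "\<And>j. j \<in> G \<Longrightarrow> D j \<subseteq> I" and bad: "\<And>j i. bad j i \<subseteq> K"
    and many: "\<And>j. j \<in> G \<Longrightarrow> t \<le> card (D j)" and G: "r \<le> card G"
    and uniq: "\<And>j j' i. j \<in> G \<Longrightarrow> j' \<in> G \<Longrightarrow> j \<noteq> j' \<Longrightarrow> i \<in> D j \<Longrightarrow> i \<in> D j' \<Longrightarrow> bad j i \<noteq> {}"
  shows "r * t \<le> card {i \<in> I. \<exists>j\<in>G. i \<in> D j \<and> bad j i = {}}
    + card {(j, i, k). j \<in> G \<and> i \<in> D j \<and> k \<in> bad j i}"
proof -
  let ?S = "{i \<in> I. \<exists>j\<in>G. i \<in> D j \<and> bad j i = {}}"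
  let ?B = "{(j, i, k). j \<in> G \<and> i \<in> D j \<and> k \<in> bad j i}"
  let ?A0 = "{(j, i). j \<in> G \<and> i \<in> D j \<and> bad j i = {}}"
  let ?A1 = "{(j, i). j \<in> G \<and> i \<in> D j \<and> bad j i \<noteq> {}}"
  have finD: "finite (D j)" if "j \<in> G" for j using finite_subset[OF D[OF that] fin(2)] .
  have "r * t \<le> card G * t" using G by simp
  also have "\<dots> \<le> (\<Sum>j\<in>G. card (D j))" using many by (intro sum_bounded_below[where K = t, simplified])
  also have "\<dots> = card (Sigma G D)" using fin finD by simp
  also have "Sigma G D = ?A0 \<union> ?A1" by auto
  also have "card (?A0 \<union> ?A1) \<le> card ?A0 + card ?A1" by (rule card_Un_le)
  also have "card ?A0 \<le> card ?S"
  proof (rule card_inj_on_le[of snd])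
    \<comment> \<open>By \<open>uniq\<close>, an unobstructed \<open>i\<close> lies in
      \<open>D j\<close> for only one \<open>j\<close>, so the certified pairs are counted by their
      second components.\<close>
    show "inj_on snd ?A0" using uniq by (fastforce simp: inj_on_def)
    show "snd ` ?A0 \<subseteq> ?S" using D by force
  qed (use fin in auto)
  also have "card ?A1 \<le> card ?B"
  proof -
    have "?B \<subseteq> G \<times> I \<times> K" using D bad by fast
    hence "finite ?B" using fin by (meson finite_SigmaI finite_subset)
    moreover have "?A1 \<subseteq> (\<lambda>(j, i, k). (j, i)) ` ?B" by (force simp: image_iff)
    ultimately show ?thesis by (meson card_image_le card_mono finite_imageI order_trans)
  qed
  finally show ?thesis by simp
qed

context search begin

text \<open>The lower half of the indices supplies the intermediate points, the upper half the
  starts. The two index ranges are disjoint, so the starts are independent of the intermediate point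
  under consideration.\<close>

definition m :: nat where "m = n div 2"

lemma half_bounds: "1 \<le> m" "m \<le> n" "real n / 2 \<le> real (n - m)" "real n / 4 \<le> real (m - 1)"
proof -
  have "25 \<le> n" using n_ge by linarith
  thus "1 \<le> m" "m \<le> n" by (auto simp: m_def)
  have "2 * m \<le> n" by (simp add: m_def)
  thus "real n / 2 \<le> real (n - m)" by linarith
  have "n \<le> 2 * m + 1" by (simp add: m_def)
  thus "real n / 4 \<le> real (m - 1)" using \<open>25 \<le> n\<close> by linarith
qed

text \<open>A block is longer than the reciprocal of the hit probability
  \<open>n powr (- (\<kappa>^2) - 13 * \<sigma>)\<close> by \<open>n powr \<sigma>\<close>, so that
  it contains no hit with probability at most \<open>exp (- (n powr \<sigma>))\<close>. The number
  of blocks becomes the lower bound for the number of hits.\<close>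

definition block_len :: nat where "block_len = nat \<lceil>real n powr (\<kappa>^2 + 14 * \<sigma>)\<rceil>"
definition n_blocks :: nat where "n_blocks = (n - m) div block_len"

lemma block_len_ge: "real n powr (\<kappa>^2 + 14 * \<sigma>) \<le> real block_len"
  unfolding block_len_def by (rule real_nat_ceiling_ge)

lemma n_blocks_ge: "real n powr (1 - \<kappa>^2 - 16 * \<sigma>) \<le> real n_blocks"
proof -
  let ?Z = "real n powr (\<kappa>^2 + 14 * \<sigma>)"
  have "real n powr 0 \<le> ?Z" using sg by (intro powr_le) (simp add: add_nonneg_nonneg)
  hence Z1: "1 \<le> ?Z" using n2 by simp
  have "real block_len \<le> ?Z + 1" unfolding block_len_def by (simp add: of_nat_ceiling real_nat_ceiling_ge)
  hence b: "real block_len \<le> 2 * ?Z" using Z1 by simp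
  have b0: "0 < real block_len" using block_len_ge Z1 by linarith
  have "real n powr 0 \<le> real n powr (1 - \<kappa>^2 - 16 * \<sigma>)" using sg_le(2) sg s(2) by (intro powr_le) linarith
  hence Y1: "1 \<le> real n powr (1 - \<kappa>^2 - 16 * \<sigma>)" using n2 by simp
  have "16 * real n powr (1 - \<kappa>^2 - 16 * \<sigma>) \<le> real n powr (1 - \<kappa>^2 - 16 * \<sigma> + \<sigma>)" by (rule absorb) simp
  also have "\<dots> \<le> real n powr (1 - (\<kappa>^2 + 14 * \<sigma>))" using sg by (intro powr_le) simp
  also have "\<dots> = real n / ?Z" using n2 by (simp only: powr_diff) simp
  finally have "16 * real n powr (1 - \<kappa>^2 - 16 * \<sigma>) \<le> real n / ?Z" .
  hence "4 * real n powr (1 - \<kappa>^2 - 16 * \<sigma>) \<le> real n / ?Z / 4" by simp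
  also have "real n / ?Z / 4 \<le> real (n - m) / real block_len"
  proof -
    have "(real n / 2) / (2 * ?Z) \<le> real (n - m) / real block_len" using half_bounds(3) b b0 by (intro frac_le) auto
    thus ?thesis by simp
  qed
  finally have "4 * real n powr (1 - \<kappa>^2 - 16 * \<sigma>) \<le> real (n - m) / real block_len" .
  moreover have "real (n - m) / real block_len - 1 \<le> real n_blocks" unfolding n_blocks_def using b0 by (intro nat_div_ge) simp
  ultimately show ?thesis using Y1 by linarith
qed

lemma few_hits_small:
  assumes R: "Measurable.pred (\<nu> \<Otimes>\<^sub>M \<nu>) (\<lambda>(x, y). R x y)" and Q: "Measurable.pred \<nu> Q"
    and i: "i < n" "i \<notin> {lo..<u}" and lu: "1 \<le> lo" "u \<le> n" "lo \<le> u" and b: "0 < b" and r: "r = (u - lo) div b"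
    and pb: "p \<le> 1" "real n powr \<sigma> / 4 \<le> p * real b"
    and bound: "\<And>x. x \<in> space (Rd d) \<Longrightarrow> Q x \<Longrightarrow> p \<le> prob {y \<in> space (Rd d). R x y}"
  shows "rare (\<lambda>\<xi>. Q (pts \<xi> i) \<and> card {j \<in> {lo..<u}. R (pts \<xi> i) (pts \<xi> j)} < r) (real n * exp (- (real n powr \<sigma> / 4)))"
proof (rule rareI)
  have "(u - lo) div b * b \<le> u - lo" by simp
  hence lr: "lo + r * b \<le> u" unfolding r using lu by linarith
  have "Om.prob {\<xi> \<in> space \<Omega>. Q (pts \<xi> i) \<and> card {j \<in> {lo..<u}. R (pts \<xi> i) (pts \<xi> j)} < r} \<le> real r * (1 - p) ^ b"
    using bound by (intro few_hits_bound R Q i lu lr pb) auto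
  also have "\<dots> \<le> real n * exp (- (real n powr \<sigma> / 4))"
  proof (rule mult_mono)
    have "r \<le> u - lo" unfolding r by (rule div_le_dividend)
    thus "real r \<le> real n" using lu by simp
    show "(1 - p) ^ b \<le> exp (- (real n powr \<sigma> / 4))" using pb by (rule power_one_minus_le_exp)
  qed (use pb in auto)
  finally show "Om.prob {\<xi> \<in> space \<Omega>. Q (pts \<xi> i) \<and> card {j \<in> {lo..<u}. R (pts \<xi> i) (pts \<xi> j)} < r} \<le> real n * exp (- (real n powr \<sigma> / 4))" .
  have "(\<lambda>\<xi>. card {j \<in> {lo..<u}. R (pts \<xi> i) (pts \<xi> j)}) \<in> measurable \<Omega> (count_space UNIV)"
    using i lu by (intro measurable_card_filter pred_pt2[OF R]) auto
  hence "Measurable.pred \<Omega> (\<lambda>\<xi>. card {j \<in> {lo..<u}. R (pts \<xi> i) (pts \<xi> j)} < r)" by measurable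
  thus "Measurable.pred \<Omega> (\<lambda>\<xi>. Q (pts \<xi> i) \<and> card {j \<in> {lo..<u}. R (pts \<xi> i) (pts \<xi> j)} < r)"
    by (intro pred_intros_logic pred_pt[OF Q] i)
qed

lemma block_len_pos: "0 < block_len"
proof -
  have "0 < real n powr (\<kappa>^2 + 14 * \<sigma>)" using n2 by simp
  thus ?thesis using block_len_ge by (metis less_le_trans of_nat_0_less_iff)
qed

lemma block_len_prob: "real n powr (- (\<kappa>^2) - 13 * \<sigma>) \<le> 1"
  "real n powr \<sigma> / 4 \<le> real n powr (- (\<kappa>^2) - 13 * \<sigma>) * real block_len"
proof -
  have "real n powr (- (\<kappa>^2) - 13 * \<sigma>) \<le> real n powr 0" using sg zero_le_power2[of \<kappa>] by (intro powr_le) linarith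
  thus "real n powr (- (\<kappa>^2) - 13 * \<sigma>) \<le> 1" using n2 by simp
  have "real n powr \<sigma> = real n powr (- (\<kappa>^2) - 13 * \<sigma>) * real n powr (\<kappa>^2 + 14 * \<sigma>)"
    by (simp add: powr_add[symmetric])
  also have "\<dots> \<le> real n powr (- (\<kappa>^2) - 13 * \<sigma>) * real block_len" using block_len_ge by (intro mult_left_mono) auto
  finally show "real n powr \<sigma> / 4 \<le> real n powr (- (\<kappa>^2) - 13 * \<sigma>) * real block_len"
    using powr_ge_zero[of "real n" \<sigma>] by linarith
qed

text \<open>Starting at height at most 0 makes the step to an intermediate point a valid
  improvement, at no cost in the leading exponent.\<close>

definition below :: "(nat \<Rightarrow> real) \<Rightarrow> (nat \<Rightarrow> real) \<Rightarrow> bool" where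
  "below x y \<longleftrightarrow> \<kappa> * \<mu> \<le> ip d y x \<and> ip d y q \<le> 0"

lemma pred_below [measurable]: "Measurable.pred (\<nu> \<Otimes>\<^sub>M \<nu>) (\<lambda>(x, y). below x y)"
  unfolding below_def split_beta' by measurable

lemma few_below_rare: "rare (\<lambda>\<xi>. \<exists>j\<in>{1..<m}. typical (pts \<xi> j) \<and> card {i \<in> {m..<n}. below (pts \<xi> j) (pts \<xi> i)} < n_blocks) (real n powr (- \<sigma>))"
proof (rule rare_Bex)
  fix j assume j: "j \<in> {1..<m}"
  have "rare (\<lambda>\<xi>. typical (pts \<xi> j) \<and> card {i \<in> {m..<n}. below (pts \<xi> j) (pts \<xi> i)} < n_blocks) (real n * exp (- (real n powr \<sigma> / 4)))"
  proof (rule few_hits_small[OF pred_below pred_typical _ _ half_bounds(1) _ half_bounds(2) block_len_pos n_blocks_def block_len_prob])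
    fix x assume x: "x \<in> space (Rd d)" "typical x"
    have "\<sigma>^2 \<le> \<sigma>" by (rule sg_sq)
    hence "real n powr (- (\<kappa>^2) - 13 * \<sigma>) \<le> real n powr (- (\<kappa>^2 + \<sigma>^2) - 12 * \<sigma>)" by (intro powr_le) simp
    \<comment> \<open>\<open>two_caps_lower\<close> needs positive heights, so height at most 0 is
      sharpened to height \<open>\<sigma> * \<mu>\<close> in direction \<open>- q\<close>.\<close>
    also have "\<dots> \<le> prob {y \<in> space (Rd d). \<kappa> * \<mu> \<le> ip d y x \<and> \<sigma> * \<mu> \<le> ip d y (\<lambda>i. - q i)}"
      using x q kap sg by (intro two_caps_lower) (auto simp: typical_def ip_uminus_left ip_uminus_right)
    also have "\<dots> \<le> prob {y \<in> space (Rd d). below x y}"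
    proof (rule finite_measure_mono)
      have "0 \<le> \<sigma> * \<mu>" using sg mu_nonneg by simp
      thus "{y \<in> space (Rd d). \<kappa> * \<mu> \<le> ip d y x \<and> \<sigma> * \<mu> \<le> ip d y (\<lambda>i. - q i)} \<subseteq> {y \<in> space (Rd d). below x y}"
        unfolding below_def ip_uminus_right by auto
      show "{y \<in> space (Rd d). below x y} \<in> events" unfolding below_def by measurable
    qed
    finally show "real n powr (- (\<kappa>^2) - 13 * \<sigma>) \<le> prob {y \<in> space (Rd d). below x y}" .
  qed (use j half_bounds in auto)
  thus "Measurable.pred \<Omega> (\<lambda>\<xi>. typical (pts \<xi> j) \<and> card {i \<in> {m..<n}. below (pts \<xi> j) (pts \<xi> i)} < n_blocks)"
    "Om.prob {\<xi> \<in> space \<Omega>. typical (pts \<xi> j) \<and> card {i \<in> {m..<n}. below (pts \<xi> j) (pts \<xi> i)} < n_blocks} \<le> real n * exp (- (real n powr \<sigma> / 4))"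
    by (auto simp: rare_def pred_def)
next
  have "real (card {1..<m}) * (real n * exp (- (real n powr \<sigma> / 4))) \<le> real n * (real n * exp (- (real n powr \<sigma> / 4)))"
    using half_bounds by (intro mult_right_mono) auto
  also have "\<dots> = real n ^ 2 * exp (- (real n powr \<sigma> / 4))" by (simp add: power2_eq_square)
  finally show "real (card {1..<m}) * (real n * exp (- (real n powr \<sigma> / 4))) \<le> real n powr (- \<sigma>)" using n_large_exp by linarith
qed simp

lemma few_direct_rare: "rare (\<lambda>\<xi>. card {i \<in> {m..<n}. \<kappa> * \<mu> \<le> ip d (pts \<xi> i) x0} < n_blocks) (real n powr (- \<sigma>))"
proof -
  let ?w = "\<lambda>i. ((\<kappa> + \<sigma>) * \<mu>) * x0 i"
  let ?\<theta> = "(\<kappa> + \<sigma>)^2"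
  have "\<kappa> * \<sigma> \<le> \<sigma>" using kap sg by (simp add: mult_left_le_one_le)
  hence th: "?\<theta> \<le> \<kappa>^2 + 3 * \<sigma>" using sg_sq by (simp add: power2_sum)
  have "real n powr (- (\<kappa>^2) - 13 * \<sigma>) \<le> real n powr (- ?\<theta> - 2 * \<sigma>)" using th sg by (intro powr_le) simp
  also have "\<dots> \<le> prob {x \<in> space (Rd d). \<kappa> * \<mu> \<le> ip d x x0 \<and> \<kappa> * \<mu> \<le> ip d x x0}"
  proof (rule caps_lower)
    show "ip d ?w ?w \<le> ?\<theta> * \<mu>^2" unfolding ip_scale_left ip_scale_right x0_unit by (simp add: power2_eq_square algebra_simps)
    show "?\<theta> \<le> 10" using th kap_sq sg by linarith
    have "(\<kappa> + \<sigma> / 2) * \<mu> \<le> (\<kappa> + \<sigma>) * \<mu>" using sg mu_nonneg by (intro mult_right_mono) auto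
    thus "(\<kappa> + \<sigma> / 2) * \<mu> \<le> ip d ?w x0" "(\<kappa> + \<sigma> / 2) * \<mu> \<le> ip d ?w x0" unfolding ip_scale_left x0_unit by simp_all
  qed (use kap x0_unit in auto)
  finally have p: "real n powr (- (\<kappa>^2) - 13 * \<sigma>) \<le> prob {x \<in> space (Rd d). \<kappa> * \<mu> \<le> ip d x x0}" by simp
  have "rare (\<lambda>\<xi>. True \<and> card {i \<in> {m..<n}. \<kappa> * \<mu> \<le> ip d (pts \<xi> i) x0} < n_blocks) (real n * exp (- (real n powr \<sigma> / 4)))"
    by (rule few_hits_small[where i = 0 and Q = "\<lambda>_. True" and R = "\<lambda>x y. \<kappa> * \<mu> \<le> ip d y x0", OF _ _ _ _ half_bounds(1) _ half_bounds(2) block_len_pos n_blocks_def block_len_prob])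
      (use p half_bounds n2 in \<open>auto simp: split_beta'\<close>)
  from rare_mono[OF this exp_small(1)] show ?thesis by simp
qed

end

text \<open>The difference of the cross-multiplied sides is \<open>h - g\<close> times
  \<open>2 * k * s * (1 + g * h) - (g + h)\<close>. By \<open>k^2 + s^2 = 1\<close> the latter is a
  sum of two products of slacks such as \<open>s - k * g\<close>, nonnegative while both constraints
  are active.\<close>

lemma two_constraint_value_mono:
  fixes k s g h :: real
  assumes ks: "0 < k" "0 < s" "k^2 + s^2 = 1" and g: "0 \<le> g" "g \<le> h" "h < 1"
    and h: "k * h \<le> s" "s * h \<le> k"
  shows "(1 - 2 * h * k * s) / (1 - h^2) \<le> (1 - 2 * g * k * s) / (1 - g^2)"
proof -
  have g1: "k * g \<le> s" "s * g \<le> k" using h g ks by (smt (verit) mult_left_mono)+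
  have "0 \<le> (s - k * g) * (k - s * h) + (s - k * h) * (k - s * g)"
    using h g1 by (intro add_nonneg_nonneg mult_nonneg_nonneg) auto
  also have "\<dots> = 2 * k * s * (1 + g * h) - (g + h) * (k^2 + s^2)" by algebra
  finally have "0 \<le> 2 * k * s * (1 + g * h) - (g + h)" using ks by simp
  hence "0 \<le> (h - g) * (2 * k * s * (1 + g * h) - (g + h))" using g by simp
  also have "\<dots> = (1 - 2 * g * k * s) * (1 - h^2) - (1 - 2 * h * k * s) * (1 - g^2)" by algebra
  finally have *: "(1 - 2 * h * k * s) * (1 - g^2) \<le> (1 - 2 * g * k * s) * (1 - h^2)" by simp
  have "0 < 1 - h^2" "0 < 1 - g^2" using g by (simp_all add: power_less_one_iff abs_square_less_1)
  thus ?thesis using * by (simp add: divide_simps mult.commute)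
qed

text \<open>The nearest point of the intersection of the two half spaces, bounded by its value when the
  inner product of the two directions is exactly \<open>g\<close>.\<close>
lemma two_constraint_vector:
  assumes ks: "0 < k" "0 < s" "k^2 + s^2 = 1" and g: "0 \<le> g" "g < 1"
    and x: "ip d x x = 1" and q: "ip d q q = 1" and xq: "g \<le> ip d x q"
  shows "\<exists>v. s \<le> ip d v q \<and> k \<le> ip d v x \<and> ip d v v \<le> (1 - 2 * g * k * s) / (1 - g^2)"
proof -
  define h where "h = ip d x q"
  have h1: "h \<le> 1" using ip_abs_le_1[of d x q] x q by (simp add: h_def)
  have qx: "ip d q x = h" by (simp add: h_def ip_commute)
  have gp: "0 < 1 - g^2" using g by (simp add: abs_square_less_1)
  have k2: "k^2 \<le> (1 - 2 * g * k * s) / (1 - g^2)"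
  proof -
    have "k^2 * (1 - g^2) + (s - g * k)^2 = 1 - 2 * g * k * s + (k^2 + s^2 - 1)" by algebra
    hence "k^2 * (1 - g^2) \<le> 1 - 2 * g * k * s" using ks(3) zero_le_power2[of "s - g * k"] by linarith
    thus ?thesis using gp by (simp add: pos_le_divide_eq)
  qed
  have s2: "s^2 \<le> (1 - 2 * g * k * s) / (1 - g^2)"
  proof -
    have "s^2 * (1 - g^2) + (k - g * s)^2 = 1 - 2 * g * k * s + (k^2 + s^2 - 1)" by algebra
    hence "s^2 * (1 - g^2) \<le> 1 - 2 * g * k * s" using ks(3) zero_le_power2[of "k - g * s"] by linarith
    thus ?thesis using gp by (simp add: pos_le_divide_eq)
  qed
  \<comment> \<open>Either one constraint implies the other, and a multiple of a single direction is
    the nearest point, or both are active and \<open>v\<close> solves the linear system given by the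
    Gram matrix of \<open>q\<close> and \<open>x\<close>.\<close>
  consider "s \<le> k * h" | "k \<le> s * h" | "k * h < s" "s * h < k" by linarith
  thus ?thesis
  proof cases
    case 1
    thus ?thesis using k2 x by (intro exI[of _ "\<lambda>i. k * x i"])
      (simp only: ip_scale_left ip_scale_right h_def, simp add: power2_eq_square)
  next
    case 2
    thus ?thesis using s2 q qx by (intro exI[of _ "\<lambda>i. s * q i"])
      (simp only: ip_scale_left ip_scale_right, simp add: power2_eq_square)
  next
    case 3
    have hn1: "h \<noteq> 1" using 3 by auto
    hence h: "h < 1" using h1 by simp
    have gh: "g \<le> h" using xq by (simp add: h_def)
    have hp: "0 < 1 - h^2" using h gh g by (simp add: abs_square_less_1)
    let ?a = "(s - h * k) / (1 - h^2)" and ?b = "(k - h * s) / (1 - h^2)"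
    let ?v = "\<lambda>i. ?a * q i + ?b * x i"
    have "ip d ?v q = ?a + ?b * h" unfolding ip_comb_left q h_def by simp
    also have "\<dots> = (s * (1 - h^2)) / (1 - h^2)" by (simp add: add_divide_distrib[symmetric] algebra_simps power2_eq_square)
    finally have vq: "ip d ?v q = s" using hp by simp
    have "ip d ?v x = ?a * h + ?b" unfolding ip_comb_left x qx by simp
    also have "\<dots> = (k * (1 - h^2)) / (1 - h^2)" by (simp add: add_divide_distrib[symmetric] algebra_simps power2_eq_square)
    finally have vx: "ip d ?v x = k" using hp by simp
    have "ip d ?v ?v = ?a * s + ?b * k" using vq vx by (subst ip_comb_right) simp
    also have "\<dots> = (k^2 + s^2 - 2 * h * k * s) / (1 - h^2)"
      by (simp add: add_divide_distrib[symmetric] algebra_simps power2_eq_square)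
    also have "\<dots> \<le> (1 - 2 * g * k * s) / (1 - g^2)"
      using two_constraint_value_mono[of k s g h] ks g gh h 3 by simp
    finally show ?thesis using vq vx by (intro exI[of _ ?v]) simp
  qed
qed

context search begin

section \<open>Intermediate points adjacent to the planted point\<close>

definition \<rho> :: real where "\<rho> = (1 - 2 * \<gamma> * \<kappa> * s) / (1 - \<gamma>^2)"

text \<open>The height exceeds \<open>s * \<mu>\<close> by \<open>\<eta> * \<mu>\<close>, so that a
  start is unlikely to have a second neighbour this high.\<close>

definition peak :: "(nat \<Rightarrow> real) \<Rightarrow> bool" where
  "peak y \<longleftrightarrow> \<kappa> * \<mu> \<le> ip d y x0 \<and> (s + \<eta>) * \<mu> \<le> ip d y q"

text \<open>No matching upper bound is proved for this probability. Keeping its exact value lets it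
  cancel when the expected number of conflicts is compared with the number of peaks; only the final
  count uses the lower bound.\<close>

definition \<pi> :: real where "\<pi> = prob {y \<in> space (Rd d). peak y}"

lemma pred_peak [measurable]: "Measurable.pred \<nu> peak"
  unfolding peak_def by measurable

text \<open>The nearest point is stretched by \<open>1 + \<xi>\<close> with
  \<open>\<xi> = 2 * \<eta> / s\<close>, which lifts the height from \<open>s\<close> to
  \<open>s + 2 * \<eta>\<close> and leaves the slack that \<open>caps_lower\<close> needs. As
  \<open>\<rho> < 1\<close>, this costs at most \<open>3 * \<xi> = 6 * \<eta> / s\<close>.\<close>

lemma pi_lower:
  assumes "\<rho> < 1"
  shows "real n powr (- \<rho> - 6 * \<eta> / s - 2 * \<sigma>) \<le> \<pi>"
proof -
  have ks: "\<kappa>^2 + s^2 = 1" using s by simp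
  obtain v where v: "s \<le> ip d v q" "\<kappa> \<le> ip d v x0" "ip d v v \<le> \<rho>"
    using two_constraint_vector[of \<kappa> s \<gamma> d x0 q] kap(1) s(1) ks gam x0_unit q x0_q unfolding \<rho>_def by auto
  have rho0: "0 \<le> \<rho>" using v(3) ip_nonneg[of d v] by linarith
  define \<xi> where "\<xi> = 2 * \<eta> / s"
  have xi: "0 \<le> \<xi>" "\<xi> \<le> 1/2" "\<xi> * s = 2 * \<eta>" using eta s by (auto simp: \<xi>_def field_simps)
  have xik: "\<sigma> / 2 \<le> \<xi> * \<kappa>"
  proof -
    have "2 * \<eta> \<le> \<xi>" using eta s s_less_1 by (simp add: \<xi>_def field_simps)
    hence "2 * \<eta> * \<kappa> \<le> \<xi> * \<kappa>" using kap by (intro mult_right_mono) auto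
    moreover have "2 * \<eta> * \<kappa> = 2 * (\<kappa> * \<eta>)" by simp
    ultimately show ?thesis using sg_kap sg by linarith
  qed
  let ?\<theta> = "\<rho> * (1 + \<xi>)^2"
  let ?w = "\<lambda>i. ((1 + \<xi>) * \<mu>) * v i"
  have x2: "(1 + \<xi>)^2 \<le> 1 + 3 * \<xi>"
    using mult_left_mono[OF xi(2) xi(1)] xi by (simp add: power2_eq_square algebra_simps)
  have "?\<theta> \<le> \<rho> * (1 + 3 * \<xi>)" using x2 rho0 by (rule mult_left_mono)
  also have "\<dots> \<le> \<rho> + 3 * \<xi>" using xi assms mult_right_mono[of \<rho> 1 "3 * \<xi>"] by (simp add: algebra_simps)
  finally have th: "?\<theta> \<le> \<rho> + 6 * \<eta> / s" by (simp add: \<xi>_def)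
  have "real n powr (- \<rho> - 6 * \<eta> / s - 2 * \<sigma>) \<le> real n powr (- ?\<theta> - 2 * \<sigma>)" using th by (intro powr_le) simp
  also have "\<dots> \<le> prob {y \<in> space (Rd d). \<kappa> * \<mu> \<le> ip d y x0 \<and> (s + \<eta>) * \<mu> \<le> ip d y q}"
  proof (rule caps_lower)
    have "ip d ?w ?w = ip d v v * ((1 + \<xi>)^2 * \<mu>^2)" unfolding ip_scale_left ip_scale_right
      by (simp add: power2_eq_square algebra_simps)
    also have "\<dots> \<le> \<rho> * ((1 + \<xi>)^2 * \<mu>^2)" using v(3) by (rule mult_right_mono) simp
    finally show "ip d ?w ?w \<le> ?\<theta> * \<mu>^2" by (simp add: mult.assoc)
    have "\<rho> + 3 * \<xi> \<le> 10" using assms xi by simp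
    thus "?\<theta> \<le> 10" using th by (simp add: \<xi>_def)
    have "(\<kappa> + \<sigma> / 2) * \<mu> \<le> ((1 + \<xi>) * \<kappa>) * \<mu>"
      using xik mu_nonneg by (intro mult_right_mono) (auto simp: algebra_simps)
    also have "\<dots> \<le> ((1 + \<xi>) * ip d v x0) * \<mu>" using v(2) xi mu_nonneg by (intro mult_right_mono mult_left_mono) auto
    finally show "(\<kappa> + \<sigma> / 2) * \<mu> \<le> ip d ?w x0" unfolding ip_scale_left by (simp add: mult_ac)
    have "(s + \<eta> + \<sigma> / 2) * \<mu> \<le> ((1 + \<xi>) * s) * \<mu>"
      using xi sg_le sg mu_nonneg by (intro mult_right_mono) (auto simp: algebra_simps)
    also have "\<dots> \<le> ((1 + \<xi>) * ip d v q) * \<mu>" using v(1) xi mu_nonneg by (intro mult_right_mono mult_left_mono) auto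
    finally show "(s + \<eta> + \<sigma> / 2) * \<mu> \<le> ip d ?w q" unfolding ip_scale_left by (simp add: mult_ac)
  qed (use rho0 kap s eta x0_unit q in auto)
  finally show ?thesis by (simp add: \<pi>_def peak_def)
qed

lemma pi_pos: "\<rho> < 1 \<Longrightarrow> 0 < \<pi>"
  by (rule order.strict_trans2[OF _ pi_lower]) (use n2 in auto)

lemma n_pi: "\<rho> < 1 \<Longrightarrow> real n powr (6 * \<sigma>) \<le> real n * \<pi>"
proof -
  assume r: "\<rho> < 1"
  have "6 * \<sigma> \<le> 1 + (- \<rho> - 6 * \<eta> / s - 2 * \<sigma>)" using rho_gap r unfolding \<rho>_def by linarith
  hence "real n powr (6 * \<sigma>) \<le> real n * real n powr (- \<rho> - 6 * \<eta> / s - 2 * \<sigma>)" unfolding n_pow by (rule powr_le)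
  also have "\<dots> \<le> real n * \<pi>" using pi_lower[OF r] by (intro mult_left_mono) auto
  finally show ?thesis .
qed

text \<open>The analogue of \<open>block_len\<close> for hit probability \<open>\<pi>\<close>: a
  block contains about \<open>n powr \<sigma>\<close> peaks on average.\<close>

definition peak_block_len :: nat where "peak_block_len = nat \<lceil>real n powr \<sigma> / \<pi>\<rceil>"
definition n_peaks :: nat where "n_peaks = (m - 1) div peak_block_len"

lemma n_peaks_ge:
  assumes r: "\<rho> < 1"
  shows "real n powr (1 - 2 * \<sigma>) * \<pi> \<le> real n_peaks" "0 < peak_block_len"
proof -
  let ?Z = "real n powr \<sigma> / \<pi>"
  note pi0 = pi_pos[OF r]
  have pi1: "\<pi> \<le> 1" unfolding \<pi>_def by (rule prob_le_1)
  have "1 * \<pi> \<le> real n powr \<sigma>" using n_sg pi1 by linarith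
  hence Z1: "1 \<le> ?Z" using pi0 by (simp add: pos_le_divide_eq)
  have bZ: "?Z \<le> real peak_block_len" unfolding peak_block_len_def by (rule real_nat_ceiling_ge)
  have "real peak_block_len \<le> ?Z + 1" unfolding peak_block_len_def using Z1 by (simp add: of_nat_ceiling)
  hence b: "real peak_block_len \<le> 2 * ?Z" using Z1 by simp
  have b0: "0 < real peak_block_len" using bZ Z1 by linarith
  thus "0 < peak_block_len" by simp
  have nn: "0 < real n" using n2 by simp
  define Y where "Y = real n powr (1 - 2 * \<sigma>) * \<pi>"
  have Y: "Y * real n powr (2 * \<sigma>) = real n * \<pi>"
    unfolding Y_def using n2 by (simp add: powr_diff)
  have Y1: "1 \<le> Y"
  proof -
    have "real n powr (2 * \<sigma>) \<le> real n powr (6 * \<sigma>)" using sg by (intro powr_le) simp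
    hence "1 * real n powr (2 * \<sigma>) \<le> Y * real n powr (2 * \<sigma>)" using n_pi[OF r] Y by simp
    thus ?thesis using nn by (simp add: mult_le_cancel_right)
  qed
  have "real n powr (2 * \<sigma>) = real n powr \<sigma> * real n powr \<sigma>" by (simp add: powr_add[symmetric])
  hence "16 * Y * real n powr \<sigma> \<le> real n * \<pi>"
    using Y mult_right_mono[of 16 "real n powr \<sigma>" "Y * real n powr \<sigma>"] n_sg Y1 by (simp add: mult_ac)
  hence Z: "16 * Y \<le> real n / ?Z" using pi0 nn by (simp add: field_simps)
  define A where "A = real n / ?Z"
  have "16 * Y \<le> A" using Z by (simp only: A_def)
  moreover have "(real n / 4) / (2 * ?Z) = A / 8" by (simp add: A_def)
  ultimately have "2 * Y \<le> (real n / 4) / (2 * ?Z)" by linarith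
  also have "\<dots> \<le> real (m - 1) / real peak_block_len" using half_bounds(4) b b0 by (intro frac_le) auto
  finally have "2 * Y \<le> real (m - 1) / real peak_block_len" .
  moreover have "real (m - 1) / real peak_block_len - 1 \<le> real n_peaks" unfolding n_peaks_def using b0 by (intro nat_div_ge) simp
  ultimately have "Y \<le> real n_peaks" using Y1 by linarith
  thus "real n powr (1 - 2 * \<sigma>) * \<pi> \<le> real n_peaks" by (simp add: Y_def)
qed

lemma few_peaks_rare:
  assumes r: "\<rho> < 1"
  shows "rare (\<lambda>\<xi>. card {j \<in> {1..<m}. peak (pts \<xi> j)} < n_peaks) (real n powr (- \<sigma>))"
proof -
  have "rare (\<lambda>\<xi>. True \<and> card {j \<in> {1..<m}. peak (pts \<xi> j)} < n_peaks) (real n * exp (- (real n powr \<sigma> / 4)))"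
  proof (rule few_hits_small[where i = 0 and Q = "\<lambda>_. True" and R = "\<lambda>x y. peak y", OF _ _ _ _ _ half_bounds(2) half_bounds(1) n_peaks_ge(2)[OF r] n_peaks_def, where p = \<pi>])
    show "Measurable.pred (\<nu> \<Otimes>\<^sub>M \<nu>) (\<lambda>(x, y). peak y)" unfolding split_beta' by measurable
    show "\<pi> \<le> 1" unfolding \<pi>_def by (rule prob_le_1)
    have "real n powr \<sigma> / \<pi> \<le> real peak_block_len" unfolding peak_block_len_def by (rule real_nat_ceiling_ge)
    hence "real n powr \<sigma> \<le> \<pi> * real peak_block_len" using pi_pos[OF r] by (simp add: pos_divide_le_eq mult.commute)
    thus "real n powr \<sigma> / 4 \<le> \<pi> * real peak_block_len" using powr_ge_zero[of "real n" \<sigma>] by linarith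
  qed (use n2 in \<open>auto simp: \<pi>_def\<close>)
  from rare_mono[OF this exp_small(1)] show ?thesis by simp
qed

definition rival :: "(nat \<Rightarrow> real) \<Rightarrow> (nat \<Rightarrow> real) \<Rightarrow> bool" where
  "rival x y \<longleftrightarrow> typical x \<and> \<kappa> * \<mu> \<le> ip d y x \<and> (s + \<eta>) * \<mu> \<le> ip d y q"

lemma pred_rival [measurable]: "Measurable.pred (\<nu> \<Otimes>\<^sub>M \<nu>) (\<lambda>(x, y). rival x y)"
  unfolding rival_def split_beta' typical_def by measurable

lemma rival_bound: "prob {y \<in> space (Rd d). rival x y} \<le> real n powr (- (\<kappa>^2 + (s + \<eta>)^2) + 2 * \<sigma>)"
proof (cases "typical x")
  case True
  thus ?thesis using two_caps_upper[of x q \<kappa> "s + \<eta>"] q kap s s_less_1 eta by (simp add: rival_def typical_def)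
next
  case False
  hence e: "{y \<in> space (Rd d). rival x y} = {}" by (auto simp: rival_def)
  show ?thesis unfolding e by simp
qed

definition triples :: "(nat \<times> nat \<times> nat) set" where
  "triples = {(j, i, k). j \<in> {1..<n} \<and> i \<in> {1..<n} \<and> k \<in> {1..<n} \<and> i \<noteq> j \<and> k \<noteq> j \<and> k \<noteq> i}"

lemma finite_triples: "finite triples" and card_triples: "card triples \<le> n ^ 3"
proof -
  have sub: "triples \<subseteq> {..<n} \<times> {..<n} \<times> {..<n}" by (auto simp: triples_def)
  show "finite triples" by (rule finite_subset[OF sub]) simp
  have "card triples \<le> card ({..<n} \<times> {..<n} \<times> {..<n})" by (rule card_mono[OF _ sub]) simp
  thus "card triples \<le> n ^ 3" by (simp add: power3_eq_cube mult.assoc)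
qed

definition conflict :: "(nat \<Rightarrow> nat \<Rightarrow> real) \<Rightarrow> nat \<times> nat \<times> nat \<Rightarrow> bool" where
  "conflict P = (\<lambda>(j, i, k). peak (P j) \<and> adj (P j) (P i) \<and> rival (P i) (P k))"

text \<open>The expected number of conflicts is at most \<open>n^3\<close> times three
  probabilities, one of them \<open>\<pi>\<close>. Divided by half of the certified count, also
  proportional to \<open>\<pi>\<close>, it is
  \<open>2 * n powr (21 * \<sigma> - 2 * s * \<eta> - \<eta>^2)\<close>. This ratio motivates the
  assumption \<open>21 * \<sigma> \<le> s * \<eta>\<close>.\<close>

lemma conflicts_rare:
  assumes r: "\<rho> < 1"
  shows "rare (\<lambda>\<xi>. real (n_peaks * n_blocks) / 2 \<le> real (card {t \<in> triples. conflict (pts \<xi>) t})) (real n powr (- \<sigma>))"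
proof (rule rare_mono[OF markov_card[OF finite_triples]])
  let ?p1 = "real n powr (- (\<kappa>^2) + \<sigma>)"
  let ?p2 = "real n powr (- (\<kappa>^2 + (s + \<eta>)^2) + 2 * \<sigma>)"
  fix t assume "t \<in> triples"
  then obtain j i k where t: "t = (j, i, k)" and
    ijk: "j \<in> {1..<n}" "i \<in> {1..<n}" "k \<in> {1..<n}" "i \<noteq> j" "k \<noteq> j" "k \<noteq> i" by (auto simp: triples_def)
  show "Om.prob {\<xi> \<in> space \<Omega>. conflict (pts \<xi>) t} \<le> ?p2 * (?p1 * \<pi>)"
    unfolding conflict_def t prod.case
    by (rule triple_bound[OF pred_peak pred_adj pred_rival]) (use ijk adj_bound rival_bound in \<open>auto simp: \<pi>_def\<close>)
  show "Measurable.pred \<Omega> (\<lambda>\<xi>. conflict (pts \<xi>) t)"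
    unfolding conflict_def t prod.case
    using ijk by (intro pred_intros_logic pred_pt[OF pred_peak] pred_pt2[OF pred_adj] pred_pt2[OF pred_rival]) auto
next
  let ?p1 = "real n powr (- (\<kappa>^2) + \<sigma>)"
  let ?p2 = "real n powr (- (\<kappa>^2 + (s + \<eta>)^2) + 2 * \<sigma>)"
  note pi0 = pi_pos[OF r]
  have nn: "0 < real n" using n2 by simp
  define X where "X = real n powr (1 - 2 * \<sigma>) * real n powr (1 - \<kappa>^2 - 16 * \<sigma>)"
  have X0: "0 < X" using nn by (simp add: X_def)
  have "(real n powr (1 - 2 * \<sigma>) * \<pi>) * real n powr (1 - \<kappa>^2 - 16 * \<sigma>) \<le> real n_peaks * real n_blocks"
    using n_peaks_ge(1)[OF r] n_blocks_ge pi0 by (intro mult_mono) auto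
  hence rr: "X * \<pi> \<le> real n_peaks * real n_blocks" by (simp add: X_def mult_ac)
  thus "0 < real (n_peaks * n_blocks) / 2" using X0 pi0 by (smt (verit) mult_pos_pos of_nat_mult half_gt_zero)
  have "real (card triples) * (?p2 * (?p1 * \<pi>)) / (real (n_peaks * n_blocks) / 2) \<le> real n ^ 3 * (?p2 * (?p1 * \<pi>)) / (X * \<pi> / 2)"
  proof (rule frac_le)
    have "real (card triples) \<le> real (n ^ 3)" using card_triples by (simp only: of_nat_le_iff)
    thus "real (card triples) * (?p2 * (?p1 * \<pi>)) \<le> real n ^ 3 * (?p2 * (?p1 * \<pi>))"
      using pi0 by (intro mult_right_mono) auto
  qed (use pi0 X0 rr in auto)
  also have "\<dots> = 2 * (real n ^ 3 * (?p2 * ?p1) / X)" using pi0 X0 by (simp add: field_simps)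
  also have "real n ^ 3 = real n powr 3" using nn by simp
  also have "real n powr 3 * (?p2 * ?p1) / X = real n powr (3 + (- (\<kappa>^2 + (s + \<eta>)^2) + 2 * \<sigma>) + (- (\<kappa>^2) + \<sigma>) - (1 - 2 * \<sigma>) - (1 - \<kappa>^2 - 16 * \<sigma>))"
    using nn unfolding X_def by (simp only: powr_add powr_diff) simp
  also have "3 + (- (\<kappa>^2 + (s + \<eta>)^2) + 2 * \<sigma>) + (- (\<kappa>^2) + \<sigma>) - (1 - 2 * \<sigma>) - (1 - \<kappa>^2 - 16 * \<sigma>) = 21 * \<sigma> - 2 * (s * \<eta>) - \<eta>^2"
    using s(2) by (simp add: power2_sum)
  also have "2 * real n powr (21 * \<sigma> - 2 * (s * \<eta>) - \<eta>^2) \<le> real n powr (21 * \<sigma> - 2 * (s * \<eta>) - \<eta>^2 + \<sigma>)" by (rule absorb) simp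
  also have "\<dots> \<le> real n powr (- \<sigma>)" using sg_eta sg zero_le_power2[of \<eta>] by (intro powr_le) linarith
  finally show "real (card triples) * (?p2 * (?p1 * \<pi>)) / (real (n_peaks * n_blocks) / 2) \<le> real n powr (- \<sigma>)" .
qed

end

text \<open>This property of the points alone is all that the analysis of the restarts uses; it
  separates the randomness of the points from that of the starts. \<open>G\<close> bounds the number
  of successful starts from below.\<close>

definition well_behaved :: "nat \<Rightarrow> real \<Rightarrow> real \<Rightarrow> nat \<Rightarrow> (nat \<Rightarrow> real) \<Rightarrow> nat \<Rightarrow> nat \<Rightarrow> real \<Rightarrow> (nat \<Rightarrow> nat \<Rightarrow> real) \<Rightarrow> bool" where
  "well_behaved d \<alpha> g n q D C G P \<longleftrightarrow>
     (\<forall>i\<in>{1..<n}. ip d (P i) q < g)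
     \<and> (\<forall>i\<in>{..<n}. card (nbrs d \<alpha> n P i) \<le> D)
     \<and> (\<forall>i\<in>{..<n}. snd (walk d \<alpha> g n P q n i) \<le> C)
     \<and> G \<le> real (card {i \<in> {..<n}. fst (walk d \<alpha> g n P q n i) \<noteq> None})"

section \<open>Deterministic consequences when no rare event occurs\<close>

context search begin

text \<open>Heights are of order \<open>\<mu>\<close>, so about \<open>n powr (14 * \<eta>)\<close>
  gains of \<open>\<Delta> * \<mu>\<close> fit, each spread over at most \<open>L\<close> steps. The
  remaining factor \<open>n powr \<eta>\<close> dominates \<open>5 * L\<close>.\<close>

definition steps :: nat where "steps = nat \<lceil>real n powr (15 * \<eta>)\<rceil>"

lemma steps_ge: "real n powr (15 * \<eta>) \<le> real steps"
  unfolding steps_def by (rule real_nat_ceiling_ge)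

lemma L_pos: "0 < L" using L by (cases L) auto

lemma steps_ge': "5 * real L * real n powr (14 * \<eta>) \<le> real steps" "1 \<le> real n powr (14 * \<eta>)"
proof -
  have "5 * real L * real n powr (14 * \<eta>) \<le> real n powr \<eta> * real n powr (14 * \<eta>)"
    using n_large_L by (intro mult_right_mono) auto
  also have "\<dots> = real n powr (15 * \<eta>)" by (simp add: powr_add[symmetric])
  finally show "5 * real L * real n powr (14 * \<eta>) \<le> real steps" using steps_ge by linarith
  have "real n powr 0 \<le> real n powr (14 * \<eta>)" using eta by (intro powr_le) auto
  thus "1 \<le> real n powr (14 * \<eta>)" using n2 by simp
qed

context
  fixes P :: "nat \<Rightarrow> nat \<Rightarrow> real"
  assumes P0: "P 0 = x0"
    and typ1: "\<And>i. i \<in> {1..<n} \<Longrightarrow> typical (P i)"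
begin

lemma unit: "i < n \<Longrightarrow> ip d (P i) (P i) = 1"
  using typ1[of i] P0 x0_unit by (cases "i = 0") (auto simp: typical_def)

lemma far: "i \<in> {1..<n} \<Longrightarrow> ip d (P i) q < \<gamma>"
  using typ1[of i] mu_small mu_pos gam by (auto simp: typical_def abs_le_iff)

lemma degree_le:
  assumes deg: "\<And>i. i \<in> {..<n} \<Longrightarrow> card {j \<in> {1..<n} - {i}. adj (P i) (P j)} < Dg" and i: "i < n"
  shows "card (nbrs d (\<kappa> * \<mu>) n P i) \<le> Dg"
proof -
  let ?A = "{j \<in> {1..<n} - {i}. adj (P i) (P j)}"
  have "nbrs d (\<kappa> * \<mu>) n P i \<subseteq> insert 0 ?A"
  proof
    fix j assume j: "j \<in> nbrs d (\<kappa> * \<mu>) n P i"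
    hence "adj (P i) (P j)" using unit[OF i] ip_commute[of d "P i" "P j"] by (simp add: nbrs_def adj_def)
    thus "j \<in> insert 0 ?A" using j by (auto simp: nbrs_def)
  qed
  hence "card (nbrs d (\<kappa> * \<mu>) n P i) \<le> card (insert 0 ?A)" by (intro card_mono) auto
  also have "\<dots> \<le> Suc (card ?A)" by (intro card_insert_le_m1) auto
  finally show ?thesis using deg[of i] i by simp
qed

text \<open>Heights increase along the path and, before its end, stay within
  \<open>2 * \<mu>\<close> in absolute value because all points but the planted one are typical.
  Enough steps must leave this range.\<close>

lemma no_long_path:
  assumes climb: "\<And>i. i \<in> {1..<n} \<Longrightarrow> \<exists>j\<in>{1..<n} - {i}. climb (P i) (P j)"
    and creep: "\<And>xs. 1 / real d \<le> \<Delta> \<Longrightarrow> set xs \<subseteq> {1..<n} \<Longrightarrow> length xs = Suc L \<Longrightarrow> distinct xs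
        \<Longrightarrow> \<not> successively (\<lambda>i j. creep (P i) (P j)) xs"
    and path: "greedy_path d (\<kappa> * \<mu>) \<gamma> n P q xs" "length xs = Suc steps" "hd xs < n"
  shows False
proof -
  define x where "x t = xs ! t" for t
  define f where "f t = ip d (P (x t)) q" for t
  have next_x: "greedy_next d (\<kappa> * \<mu>) n P q (x t) = Some (x (Suc t))" "f t < \<gamma>" if "t < steps" for t
    using greedy_path_nth[OF path(1), of t] path(2) that by (auto simp: x_def f_def)
  have inc: "f t + real k / real d \<le> f (t + k)" if "t + k \<le> steps" for t k
    using greedy_path_increasing[OF path(1), of t k] path(2) that by (simp add: x_def f_def)
  have mono: "f t \<le> f u" if "t \<le> u" "u \<le> steps" for t u
  proof -
    have "f t + real (u - t) / real d \<le> f u" using inc[of t "u - t"] that by simp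
    moreover have "0 \<le> real (u - t) / real d" by simp
    ultimately show ?thesis by linarith
  qed
  have strict: "f t < f u" if "t < u" "u \<le> steps" for t u
  proof -
    have "f t + real (u - t) / real d \<le> f u" using inc[of t "u - t"] that by simp
    moreover have "0 < real (u - t) / real d" using that d0 by simp
    ultimately show ?thesis by linarith
  qed
  \<comment> \<open>The position \<open>steps\<close> is excluded: the path may end in the planted
    point.\<close>
  have xr: "x t \<in> {1..<n}" if "t < steps" for t
  proof -
    have "x t < n"
    proof (cases t)
      case 0
      have "x 0 = hd xs" using path(2) by (cases xs) (auto simp: x_def)
      thus ?thesis using 0 path(3) by simp
    next
      case (Suc u)
      thus ?thesis using greedy_next_improves(1)[OF next_x(1)[of u]] that by simp
    qed
    moreover have "x t \<noteq> 0"
    proof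
      assume "x t = 0"
      hence "f t \<ge> \<gamma>" using P0 x0_q by (simp add: f_def)
      thus False using next_x(2)[OF that] by simp
    qed
    ultimately show ?thesis by simp
  qed
  have fb: "\<bar>f t\<bar> \<le> 2 * \<mu>" if "t < steps" for t using typ1[OF xr[OF that]] by (simp add: f_def typical_def)
  have L1: "1 \<le> real L" using L_pos by simp
  have st5: "5 * real n powr (14 * \<eta>) \<le> real steps"
    using steps_ge'(1) mult_right_mono[OF L1, of "5 * real n powr (14 * \<eta>)"] by (simp add: mult_ac)
  hence st: "2 \<le> steps" using steps_ge'(2) by linarith
  show False
  proof (cases "1 / real d \<le> \<Delta>")
    case False
    \<comment> \<open>Here \<open>d\<close> is at most \<open>n powr (14 * \<eta>)\<close>.
      Increments of \<open>1/d\<close> within a range of width \<open>4 * \<mu> \<le> 1\<close>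
      allow at most \<open>d\<close> steps, fewer than \<open>steps - 1\<close>.\<close>
    have Dinv: "\<Delta> * real n powr (14 * \<eta>) = 1" unfolding \<Delta>_def using n2 by (simp add: powr_add[symmetric])
    have "\<Delta> * real n powr (14 * \<eta>) \<le> 1 / real d * real n powr (14 * \<eta>)"
      using False by (intro mult_right_mono) auto
    hence dle: "real d \<le> real n powr (14 * \<eta>)" using Dinv d0 by (simp add: field_simps)
    have "f 0 + real (steps - 1) / real d \<le> f (0 + (steps - 1))" by (rule inc) simp
    hence "real (steps - 1) / real d \<le> 4 * \<mu>" using fb[of 0] fb[of "steps - 1"] st by simp
    hence "real (steps - 1) / real d \<le> 1" using mu_le by linarith
    hence "real (steps - 1) \<le> real d" using d0 by simp
    thus False using dle st5 steps_ge'(2) st by linarith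
  next
    case True
    have f1: "(s - \<eta>) * \<mu> \<le> f 1"
    proof -
      have x0r: "x 0 \<in> {1..<n}" using xr[of 0] st by simp
      obtain j where j: "j \<in> {1..<n} - {x 0}" "climb (P (x 0)) (P j)" using climb[OF x0r] by blast
      have g: "greedy_next d (\<kappa> * \<mu>) n P q (x 0) = Some (x 1)" using next_x(1)[of 0] st by simp
      show ?thesis
      \<comment> \<open>If the high neighbour \<open>j\<close> is an admissible improvement, the
        greedy choice is at least as high. If not, \<open>j\<close> is lower than
        \<open>f 0 + 1/d\<close>, hence lower than the point actually chosen.\<close>
      proof (cases "f 0 + 1 / real d \<le> ip d (P j) q")
        case True
        hence "j \<in> impr d (\<kappa> * \<mu>) n P q (x 0)"
          using j by (auto simp: impr_def nbrs_def f_def climb_def ip_commute[of d "P (x 0)" "P j"])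
        hence "ip d (P j) q \<le> f 1" using greedy_next_SomeD(2)[OF g] by (simp add: f_def)
        thus ?thesis using j(2) by (simp add: climb_def)
      next
        case False
        moreover have "f 0 + 1 / real d \<le> f 1" using inc[of 0 1] st by simp
        ultimately show ?thesis using j(2) by (simp add: climb_def)
      qed
    qed
    have f1': "0 \<le> f 1" "(s - 2 * \<eta>) * \<mu> \<le> f 1"
    proof -
      have "0 \<le> (s - \<eta>) * \<mu>" using eta s mu_nonneg by simp
      thus "0 \<le> f 1" using f1 by simp
      have "(s - 2 * \<eta>) * \<mu> \<le> (s - \<eta>) * \<mu>" using eta mu_nonneg by (intro mult_right_mono) auto
      thus "(s - 2 * \<eta>) * \<mu> \<le> f 1" using f1 by simp
    qed
    \<comment> \<open>If \<open>L\<close> consecutive steps gained at most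
      \<open>\<Delta> * \<mu>\<close> in total, each would be a creeping step, and the strictly
      increasing heights would make their \<open>L + 1\<close> vertices distinct: an excluded
      chain.\<close>
    have jump: "f t + \<Delta> * \<mu> < f (t + L)" if t: "1 \<le> t" "t + L < steps" for t
    proof (rule ccontr)
      assume neg: "\<not> f t + \<Delta> * \<mu> < f (t + L)"
      define ys where "ys = map x [t..<t + Suc L]"
      have inj: "inj_on x {t..<t + Suc L}"
      proof (rule inj_onI)
        fix u v assume uv: "u \<in> {t..<t + Suc L}" "v \<in> {t..<t + Suc L}" "x u = x v"
        hence "f u = f v" by (simp add: f_def)
        thus "u = v" using uv strict[of u v] strict[of v u] t by (cases u v rule: linorder_cases) auto
      qed
      have "set ys \<subseteq> {1..<n}" unfolding ys_def using xr t by fastforce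
      moreover have "length ys = Suc L" by (simp add: ys_def)
      moreover have "distinct ys" unfolding ys_def distinct_map using inj by (simp only: set_upt distinct_upt simp_thms)
      moreover have "successively (\<lambda>i j. creep (P i) (P j)) ys"
        unfolding successively_conv_nth
      proof (intro allI impI)
        fix i assume i: "Suc i < length ys"
        hence iL: "i < L" by (simp add: ys_def)
        have e: "ys ! i = x (t + i)" "ys ! Suc i = x (Suc (t + i))" using i unfolding ys_def by (simp_all del: upt_Suc)
        have lt: "t + i < steps" using iL t by simp
        have g: "greedy_next d (\<kappa> * \<mu>) n P q (x (t + i)) = Some (x (Suc (t + i)))" by (rule next_x[OF lt])
        have "f (Suc (t + i)) \<le> f (t + L)" using iL t by (intro mono) auto
        moreover have "f t \<le> f (t + i)" using lt by (intro mono) auto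
        moreover have "f 1 \<le> f (t + i)" using lt t by (intro mono) auto
        moreover have "f (t + i) \<le> f (Suc (t + i))" using lt by (intro mono) auto
        ultimately show "creep (P (ys ! i)) (P (ys ! Suc i))"
          unfolding e creep_def using typ1[OF xr[OF lt]] f1'(2) neg greedy_next_improves(3)[OF g]
          by (auto simp: f_def ip_commute[of d "P (x (Suc (t + i)))" "P (x (t + i))"])
      qed
      ultimately show False using creep[OF True, of ys] by blast
    qed
    have jumps: "f 1 + real k * (\<Delta> * \<mu>) \<le> f (1 + k * L)" if "1 + k * L < steps" for k
      using that
    proof (induction k)
      case (Suc k)
      have "f (1 + k * L) + \<Delta> * \<mu> < f (1 + k * L + L)" using Suc(2) by (intro jump) auto
      moreover have "1 + k * L + L = 1 + Suc k * L" by simp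
      moreover have "f 1 + real k * (\<Delta> * \<mu>) \<le> f (1 + k * L)" using Suc by simp
      ultimately show ?case by (simp add: distrib_right add.commute[of L])
    qed simp
    \<comment> \<open>More than \<open>2 * n powr (14 * \<eta>)\<close> jumps of
      \<open>\<Delta> * \<mu>\<close>, starting from \<open>f 1 \<ge> 0\<close>, end above
      \<open>2 * \<mu>\<close>; the factor 5 in \<open>steps_ge'\<close> leaves room for
      them.\<close>
    define k where "k = nat \<lfloor>2 * real n powr (14 * \<eta>)\<rfloor> + 1"
    have k1: "2 * real n powr (14 * \<eta>) < real k" unfolding k_def using steps_ge'(2) by linarith
    have k2: "real k \<le> 2 * real n powr (14 * \<eta>) + 1" unfolding k_def using steps_ge'(2) by simp
    have "real (1 + k * L) < real steps"
    proof -
      have "real k \<le> 3 * real n powr (14 * \<eta>)" using k2 steps_ge'(2) by linarith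
      hence "real k * real L \<le> 3 * real n powr (14 * \<eta>) * real L" by (rule mult_right_mono) simp
      moreover have "1 * 1 \<le> real n powr (14 * \<eta>) * real L" using steps_ge'(2) L1 by (intro mult_mono) auto
      moreover have "5 * (real n powr (14 * \<eta>) * real L) \<le> real steps" using steps_ge'(1) by (simp add: mult_ac)
      ultimately show ?thesis by simp
    qed
    hence kL: "1 + k * L < steps" by (simp only: of_nat_less_iff)
    have "\<Delta> * real n powr (14 * \<eta>) = 1" unfolding \<Delta>_def using n2 by (simp add: powr_add[symmetric])
    hence "\<Delta> * (2 * real n powr (14 * \<eta>)) = 2" by simp
    moreover have "0 < \<Delta>" unfolding \<Delta>_def using n2 by simp
    hence "\<Delta> * (2 * real n powr (14 * \<eta>)) < \<Delta> * real k" using k1 by (rule mult_strict_left_mono[rotated])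
    ultimately have "2 < real k * \<Delta>" by (simp add: mult.commute)
    hence "2 * \<mu> < (real k * \<Delta>) * \<mu>" using mu_pos by (rule mult_strict_right_mono)
    hence "2 * \<mu> < f (1 + k * L)" using jumps[OF kL] f1'(1) by (simp add: mult.assoc)
    thus False using fb[OF kL] by simp
  qed
qed

lemma walk_direct:
  assumes i: "i \<in> {1..<n}" "\<kappa> * \<mu> \<le> ip d (P i) x0"
  shows "fst (walk d (\<kappa> * \<mu>) \<gamma> n P q n i) \<noteq> None"
proof -
  have "1 / real d \<le> \<sigma> * \<mu>" by (rule inv_d_le)
  also have "\<sigma> * \<mu> \<le> 1 * \<mu>" using sg mu_nonneg by (intro mult_right_mono) auto
  finally have "ip d (P i) q + 1 / real d \<le> ip d (P 0) q"
    using typ1[OF i(1)] mu_small mu_pos gam x0_q P0 by (auto simp: typical_def abs_le_iff)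
  hence "fst (walk d (\<kappa> * \<mu>) \<gamma> n P q (Suc (n - 1)) i) = Some 0"
    using i far x0_q P0 by (intro one_step_success(2)) auto
  moreover have "Suc (n - 1) = n" using n2 by simp
  ultimately show ?thesis by simp
qed

lemma walk_via:
  assumes j: "j \<in> {1..<m}" "peak (P j)" and i: "i \<in> {m..<n}" "below (P j) (P i)"
    and no: "\<And>k. k \<in> {1..<n} \<Longrightarrow> k \<noteq> i \<Longrightarrow> k \<noteq> j \<Longrightarrow> \<not> rival (P i) (P k)"
  shows "fst (walk d (\<kappa> * \<mu>) \<gamma> n P q n i) \<noteq> None"
proof -
  have jn: "j \<in> {1..<n}" and inn: "i \<in> {1..<n}" using i j half_bounds by auto
  have d1: "1 / real d \<le> \<sigma> * \<mu>" by (rule inv_d_le)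
  have "\<sigma> * \<mu> \<le> 1 * \<mu>" using sg mu_nonneg by (intro mult_right_mono) auto
  hence "1 / real d \<le> \<mu>" using d1 by linarith
  hence d2: "ip d (P j) q + 1 / real d \<le> ip d (P 0) q"
    using typ1[OF jn] mu_small mu_pos gam x0_q P0 by (auto simp: typical_def abs_le_iff)
  have "\<sigma> * \<mu> \<le> (s + \<eta>) * \<mu>" using sg_le sg s mu_nonneg by (intro mult_right_mono) auto
  hence d3: "ip d (P i) q + 1 / real d \<le> ip d (P j) q" using d1 j(2) i(2) unfolding peak_def below_def by linarith
  have "fst (walk d (\<kappa> * \<mu>) \<gamma> n P q (Suc (Suc (n - 2))) i) = Some 0"
  proof (rule two_step_success)
    show "\<kappa> * \<mu> \<le> ip d (P i) (P j)" using i(2) by (simp add: below_def)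
    show "\<kappa> * \<mu> \<le> ip d (P j) (P 0)" using j(2) P0 by (simp add: peak_def)
    show "ip d (P k) q < ip d (P j) q" if k: "0 < k" "k < n" "k \<noteq> i" "k \<noteq> j" "\<kappa> * \<mu> \<le> ip d (P i) (P k)" for k
    proof -
      have "\<not> rival (P i) (P k)" using no[of k] k by simp
      hence "ip d (P k) q < (s + \<eta>) * \<mu>" using k(5) typ1[OF inn] by (simp add: rival_def ip_commute[of d "P k" "P i"])
      thus ?thesis using j(2) by (simp add: peak_def)
    qed
  qed (use far x0_q P0 jn inn i j d2 d3 in auto)
  moreover have "Suc (Suc (n - 2)) = n" using n2 by simp
  ultimately show ?thesis by simp
qed

text \<open>Double counting with peaks as certifiers and the other rivals of \<open>i\<close> as
  obstructions. If \<open>i\<close> lies below two peaks, each obstructs the other, which gives the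
  uniqueness required by \<open>card_certified\<close>.\<close>

lemma many_successes_via:
  assumes many_below: "\<And>j. j \<in> {1..<m} \<Longrightarrow> n_blocks \<le> card {i \<in> {m..<n}. below (P j) (P i)}"
    and peaks: "n_peaks \<le> card {j \<in> {1..<m}. peak (P j)}"
    and few_conflicts: "real (card {t \<in> triples. conflict P t}) < real (n_peaks * n_blocks) / 2"
  shows "real (n_peaks * n_blocks) / 2 \<le> real (card {i \<in> {..<n}. fst (walk d (\<kappa> * \<mu>) \<gamma> n P q n i) \<noteq> None})"
proof -
  let ?G = "{j \<in> {1..<m}. peak (P j)}"
  let ?D = "\<lambda>j. {i \<in> {m..<n}. below (P j) (P i)}"
  let ?bad = "\<lambda>j i. {k \<in> {1..<n}. k \<noteq> i \<and> k \<noteq> j \<and> rival (P i) (P k)}"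
  have "n_peaks * n_blocks \<le> card {i \<in> {m..<n}. \<exists>j\<in>?G. i \<in> ?D j \<and> ?bad j i = {}}
      + card {(j, i, k). j \<in> ?G \<and> i \<in> ?D j \<and> k \<in> ?bad j i}"
  proof (rule card_certified[of ?G "{m..<n}" "{1..<n}"])
    fix j j' i assume j: "j \<in> ?G" "j' \<in> ?G" "j \<noteq> j'" "i \<in> ?D j" "i \<in> ?D j'"
    have "typical (P i)" using j half_bounds by (intro typ1) auto
    hence "rival (P i) (P j')" using j by (auto simp: rival_def peak_def below_def ip_commute[of d "P j'" "P i"])
    hence "j' \<in> ?bad j i" using j half_bounds by auto
    thus "?bad j i \<noteq> {}" by blast
  qed (use many_below peaks in auto)
  moreover have "card {(j, i, k). j \<in> ?G \<and> i \<in> ?D j \<and> k \<in> ?bad j i} \<le> card {t \<in> triples. conflict P t}"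
  proof (rule card_mono)
    show "finite {t \<in> triples. conflict P t}" using finite_triples by simp
    show "{(j, i, k). j \<in> ?G \<and> i \<in> ?D j \<and> k \<in> ?bad j i} \<subseteq> {t \<in> triples. conflict P t}"
      using half_bounds unit by (auto simp: triples_def conflict_def adj_def below_def)
  qed
  moreover have "card {i \<in> {m..<n}. \<exists>j\<in>?G. i \<in> ?D j \<and> ?bad j i = {}}
      \<le> card {i \<in> {..<n}. fst (walk d (\<kappa> * \<mu>) \<gamma> n P q n i) \<noteq> None}"
  proof (rule card_mono)
    show "{i \<in> {m..<n}. \<exists>j\<in>?G. i \<in> ?D j \<and> ?bad j i = {}} \<subseteq> {i \<in> {..<n}. fst (walk d (\<kappa> * \<mu>) \<gamma> n P q n i) \<noteq> None}"
    proof
      fix i assume "i \<in> {i \<in> {m..<n}. \<exists>j\<in>?G. i \<in> ?D j \<and> ?bad j i = {}}"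
      then obtain j where j: "i \<in> {m..<n}" "j \<in> {1..<m}" "peak (P j)" "below (P j) (P i)" and b: "?bad j i = {}" by blast
      have "\<not> rival (P i) (P k)" if "k \<in> {1..<n}" "k \<noteq> i" "k \<noteq> j" for k using b that by blast
      from walk_via[OF j(2,3,1,4) this] show "i \<in> {i \<in> {..<n}. fst (walk d (\<kappa> * \<mu>) \<gamma> n P q n i) \<noteq> None}"
        using j(1) by simp
    qed
  qed simp
  ultimately have "real (n_peaks * n_blocks) \<le> real (card {i \<in> {..<n}. fst (walk d (\<kappa> * \<mu>) \<gamma> n P q n i) \<noteq> None})
      + real (card {t \<in> triples. conflict P t})" by linarith
  thus ?thesis using few_conflicts by linarith
qed

lemma many_successes_direct:
  assumes "n_blocks \<le> card {i \<in> {m..<n}. \<kappa> * \<mu> \<le> ip d (P i) x0}"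
  shows "n_blocks \<le> card {i \<in> {..<n}. fst (walk d (\<kappa> * \<mu>) \<gamma> n P q n i) \<noteq> None}"
proof (rule order_trans[OF assms card_mono])
  show "{i \<in> {m..<n}. \<kappa> * \<mu> \<le> ip d (P i) x0} \<subseteq> {i \<in> {..<n}. fst (walk d (\<kappa> * \<mu>) \<gamma> n P q n i) \<noteq> None}"
    using walk_direct half_bounds by auto
qed simp

end

end

section \<open>Joining the rare events and adding up the exponents\<close>

context search begin

text \<open>The exponent adds \<open>1 - \<rho>\<close> for the peaks and
  \<open>1 - \<kappa>^2\<close> for the starts below each peak. The loss
  \<open>21 * \<sigma>\<close> consists of 2 and 16 from the block counts, 2 from
  \<open>pi_lower\<close> and 1 for a factor 2. Unlike \<open>\<pi>\<close>, it does not depend on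
  the planted point.\<close>

abbreviation threshold :: real where
  "threshold \<equiv> real n powr (2 - \<kappa>^2 - \<rho> - 6 * \<eta> / s - 21 * \<sigma>)"

lemma well_behavedI:
  assumes P0: "P 0 = x0"
    and all_typical: "\<not> (\<exists>i\<in>{1..<n}. \<not> typical (P i))"
    and degrees: "\<not> (\<exists>i\<in>{..<n}. Dg \<le> card {j \<in> {1..<n} - {i}. adj (P i) (P j)})"
    and climbs: "\<not> (\<exists>i\<in>{1..<n}. typical (P i) \<and> (\<forall>j\<in>{1..<n} - {i}. \<not> climb (P i) (P j)))"
    and no_creep: "1 / real d \<le> \<Delta> \<Longrightarrow> \<not> (\<exists>xs\<in>{xs. set xs \<subseteq> {1..<n} \<and> length xs = Suc L \<and> distinct xs}.
      successively (\<lambda>i j. creep (P i) (P j)) xs)"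
    and many: "threshold \<le> real (card {i \<in> {..<n}. fst (walk d (\<kappa> * \<mu>) \<gamma> n P q n i) \<noteq> None})"
  shows "well_behaved d (\<kappa> * \<mu>) \<gamma> n q Dg (steps * (1 + Dg)) threshold P"
proof -
  have typ1: "typical (P i)" if "i \<in> {1..<n}" for i using all_typical that by blast
  have deg: "card (nbrs d (\<kappa> * \<mu>) n P i) \<le> Dg" if "i < n" for i
  proof (rule degree_le[where P = P, OF P0 typ1 _ that])
    show "card {j \<in> {1..<n} - {i}. adj (P i) (P j)} < Dg" if "i \<in> {..<n}" for i
      using degrees that by (meson not_le)
  qed
  have "snd (walk d (\<kappa> * \<mu>) \<gamma> n P q n i) \<le> steps * (1 + Dg)" if i: "i < n" for i
  proof (rule walk_cost[OF deg _ i])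
    fix xs assume "greedy_path d (\<kappa> * \<mu>) \<gamma> n P q xs" "length xs = Suc steps" "hd xs = i"
    moreover have "\<exists>j\<in>{1..<n} - {k}. climb (P k) (P j)" if "k \<in> {1..<n}" for k using climbs typ1 that by blast
    moreover have "\<not> successively (\<lambda>i j. creep (P i) (P j)) ys"
      if "1 / real d \<le> \<Delta>" "set ys \<subseteq> {1..<n}" "length ys = Suc L" "distinct ys" for ys using no_creep that by blast
    ultimately show False using no_long_path[where P = P, OF P0 typ1, of xs] i by blast
  qed
  thus ?thesis using far[where P = P, OF P0 typ1] deg many by (simp add: well_behaved_def)
qed

text \<open>Completing the square; geometrically, the inner product with \<open>q\<close> alone
  already forces squared length \<open>s^2\<close>. It follows that
  \<open>\<kappa>^2 + \<rho> - 1 \<ge> 0\<close>, so that the number of tries is a nonnegative power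
  of \<open>n\<close>.\<close>

lemma rho_ge: "s^2 \<le> \<rho>"
proof -
  have "s^2 * (1 - \<gamma>^2) + (\<kappa> - \<gamma> * s)^2 = 1 - 2 * \<gamma> * \<kappa> * s + (\<kappa>^2 + s^2 - 1)" by algebra
  hence "s^2 * (1 - \<gamma>^2) \<le> 1 - 2 * \<gamma> * \<kappa> * s" using s(2) zero_le_power2[of "\<kappa> - \<gamma> * s"] by linarith
  moreover have "0 < 1 - \<gamma>^2" using gam by (simp add: abs_square_less_1)
  ultimately show ?thesis by (simp add: \<rho>_def pos_le_divide_eq)
qed

lemma threshold_via: "\<rho> < 1 \<Longrightarrow> threshold \<le> real (n_peaks * n_blocks) / 2"
proof -
  assume r: "\<rho> < 1"
  have "2 * threshold \<le> real n powr (2 - \<kappa>^2 - \<rho> - 6 * \<eta> / s - 21 * \<sigma> + \<sigma>)" by (rule absorb) simp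
  also have "\<dots> = real n powr (1 - 2 * \<sigma>) * real n powr (- \<rho> - 6 * \<eta> / s - 2 * \<sigma>) * real n powr (1 - \<kappa>^2 - 16 * \<sigma>)"
    by (simp add: powr_add[symmetric] algebra_simps)
  also have "\<dots> \<le> (real n powr (1 - 2 * \<sigma>) * \<pi>) * real n powr (1 - \<kappa>^2 - 16 * \<sigma>)"
    using pi_lower[OF r] by (intro mult_right_mono mult_left_mono) auto
  also have "\<dots> \<le> real n_peaks * real n_blocks"
    using n_peaks_ge(1)[OF r] n_blocks_ge by (rule mult_mono) auto
  finally show ?thesis by simp
qed

lemma threshold_direct: "1 \<le> \<rho> \<Longrightarrow> threshold \<le> real n_blocks"
proof -
  assume r: "1 \<le> \<rho>"
  have "0 \<le> 6 * \<eta> / s" using eta s by simp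
  hence "threshold \<le> real n powr (1 - \<kappa>^2 - 16 * \<sigma>)" using r sg by (intro powr_le) linarith
  thus ?thesis using n_blocks_ge by linarith
qed

lemma well_behaved_likely:
  "\<exists>E. rare E (7 * real n powr (- \<sigma>)) \<and>
     (\<forall>\<xi>. \<not> E \<xi> \<longrightarrow> well_behaved d (\<kappa> * \<mu>) \<gamma> n q Dg (steps * (1 + Dg)) threshold (pts \<xi>))"
proof -
  let ?e = "real n powr (- \<sigma>)"
  \<comment> \<open>The comparison of \<open>d\<close> with \<open>1 / \<Delta>\<close> is part of
    the event, since chains are shown to be rare only when
    \<open>1/d \<le> \<Delta>\<close>.\<close>
  define F4 where "F4 \<xi> \<longleftrightarrow> 1 / real d \<le> \<Delta> \<and> (\<exists>xs\<in>{xs. set xs \<subseteq> {1..<n} \<and> length xs = Suc L \<and> distinct xs}.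
      successively (\<lambda>i j. creep (pts \<xi> i) (pts \<xi> j)) xs)" for \<xi>
  have F4: "rare F4 ?e"
  proof (cases "1 / real d \<le> \<Delta>")
    case True
    show ?thesis using creep_chain_rare[OF True] unfolding F4_def by (simp only: True simp_thms)
  next
    case False
    have "rare (\<lambda>_. False) ?e" by (simp add: rare_def)
    thus ?thesis unfolding F4_def by (simp only: False simp_thms)
  qed
  define F where "F \<xi> \<longleftrightarrow> ((\<exists>i\<in>{1..<n}. \<not> typical (pts \<xi> i))
      \<or> (\<exists>i\<in>{..<n}. Dg \<le> card {j \<in> {1..<n} - {i}. adj (pts \<xi> i) (pts \<xi> j)}))
      \<or> ((\<exists>i\<in>{1..<n}. typical (pts \<xi> i) \<and> (\<forall>j\<in>{1..<n} - {i}. \<not> climb (pts \<xi> i) (pts \<xi> j))) \<or> F4 \<xi>)" for \<xi>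
  have F: "rare F ((?e + ?e) + (?e + ?e))"
    unfolding F_def by (intro rare_disj atypical_rare high_degree_rare stuck_low_rare F4)
  have good: "well_behaved d (\<kappa> * \<mu>) \<gamma> n q Dg (steps * (1 + Dg)) threshold (pts \<xi>)"
    if "\<not> F \<xi>" "threshold \<le> real (card {i \<in> {..<n}. fst (walk d (\<kappa> * \<mu>) \<gamma> n (pts \<xi>) q n i) \<noteq> None})" for \<xi>
  proof (rule well_behavedI)
    show "pts \<xi> 0 = x0" by simp
  qed (use that in \<open>unfold F_def F4_def, blast+\<close>)
  have typ1: "typical (pts \<xi> i)" if "\<not> F \<xi>" "i \<in> {1..<n}" for \<xi> i using that unfolding F_def by blast
  have P0: "pts \<xi> 0 = x0" for \<xi> by simp
  show ?thesis
  proof (cases "\<rho> < 1")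
    case False
    let ?E = "\<lambda>\<xi>. F \<xi> \<or> card {i \<in> {m..<n}. \<kappa> * \<mu> \<le> ip d (pts \<xi> i) x0} < n_blocks"
    have "rare ?E (((?e + ?e) + (?e + ?e)) + ?e)" by (intro rare_disj F few_direct_rare)
    hence "rare ?E (7 * ?e)" by (rule rare_mono) simp
    moreover have "well_behaved d (\<kappa> * \<mu>) \<gamma> n q Dg (steps * (1 + Dg)) threshold (pts \<xi>)" if "\<not> ?E \<xi>" for \<xi>
    proof (rule good)
      have "n_blocks \<le> card {i \<in> {..<n}. fst (walk d (\<kappa> * \<mu>) \<gamma> n (pts \<xi>) q n i) \<noteq> None}"
        using that typ1[of \<xi>] by (intro many_successes_direct[where P = "pts \<xi>", OF P0]) (blast, simp only: not_less de_Morgan_disj)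
      thus "threshold \<le> real (card {i \<in> {..<n}. fst (walk d (\<kappa> * \<mu>) \<gamma> n (pts \<xi>) q n i) \<noteq> None})"
        using threshold_direct False by linarith
    qed (use that in blast)
    ultimately show ?thesis by blast
  next
    case True
    let ?E = "\<lambda>\<xi>. F \<xi> \<or> ((\<exists>j\<in>{1..<m}. typical (pts \<xi> j) \<and> card {i \<in> {m..<n}. below (pts \<xi> j) (pts \<xi> i)} < n_blocks)
      \<or> (card {j \<in> {1..<m}. peak (pts \<xi> j)} < n_peaks
      \<or> real (n_peaks * n_blocks) / 2 \<le> real (card {t \<in> triples. conflict (pts \<xi>) t})))"
    have "rare ?E (((?e + ?e) + (?e + ?e)) + (?e + (?e + ?e)))"
      by (intro rare_disj F few_below_rare few_peaks_rare[OF True] conflicts_rare[OF True])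
    hence "rare ?E (7 * ?e)" by (rule rare_mono) simp
    moreover have "well_behaved d (\<kappa> * \<mu>) \<gamma> n q Dg (steps * (1 + Dg)) threshold (pts \<xi>)" if E: "\<not> ?E \<xi>" for \<xi>
    proof (rule good)
      have nF: "\<not> F \<xi>" using E by blast
      have "real (n_peaks * n_blocks) / 2 \<le> real (card {i \<in> {..<n}. fst (walk d (\<kappa> * \<mu>) \<gamma> n (pts \<xi>) q n i) \<noteq> None})"
      proof (rule many_successes_via[where P = "pts \<xi>", OF P0 typ1[OF nF]])
        show "n_blocks \<le> card {i \<in> {m..<n}. below (pts \<xi> j) (pts \<xi> i)}" if j: "j \<in> {1..<m}" for j
          using E typ1[OF nF, of j] j half_bounds by (meson atLeastLessThan_iff not_le order_less_le_trans)
        show "n_peaks \<le> card {j \<in> {1..<m}. peak (pts \<xi> j)}" using E by (meson not_le)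
        show "real (card {t \<in> triples. conflict (pts \<xi>) t}) < real (n_peaks * n_blocks) / 2" using E by (meson not_le)
      qed
      thus "threshold \<le> real (card {i \<in> {..<n}. fst (walk d (\<kappa> * \<mu>) \<gamma> n (pts \<xi>) q n i) \<noteq> None})"
        using threshold_via[OF True] by linarith
    qed (use E in blast)
    ultimately show ?thesis by blast
  qed
qed

text \<open>This is \<open>n / threshold\<close> times \<open>n powr \<sigma>\<close>, so all tries
  fail with probability at most \<open>exp (- (n powr \<sigma>))\<close>.\<close>

definition tries :: nat where "tries = nat \<lceil>real n powr (\<kappa>^2 + \<rho> - 1 + 6 * \<eta> / s + 22 * \<sigma>)\<rceil>"

lemma ceiling_le_double:
  "0 \<le> a \<Longrightarrow> real (nat \<lceil>real n powr a\<rceil>) \<le> 2 * real n powr a"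
proof -
  assume "0 \<le> a"
  hence "real n powr 0 \<le> real n powr a" by (rule powr_le)
  hence "1 \<le> real n powr a" using n2 by simp
  thus ?thesis by linarith
qed

lemma tries_threshold: "real n powr \<sigma> \<le> real tries * (threshold / real n)"
proof -
  have "real n powr (\<kappa>^2 + \<rho> - 1 + 6 * \<eta> / s + 22 * \<sigma>) * (threshold / real n) \<le> real tries * (threshold / real n)"
    unfolding tries_def by (intro mult_right_mono real_nat_ceiling_ge) auto
  moreover have "threshold / real n = real n powr (1 - \<kappa>^2 - \<rho> - 6 * \<eta> / s - 21 * \<sigma>)"
  proof -
    have "2 - \<kappa>^2 - \<rho> - 6 * \<eta> / s - 21 * \<sigma> = 1 + (1 - \<kappa>^2 - \<rho> - 6 * \<eta> / s - 21 * \<sigma>)" by simp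
    thus ?thesis using n2 by (simp only: powr_add) simp
  qed
  moreover have "real n powr (\<kappa>^2 + \<rho> - 1 + 6 * \<eta> / s + 22 * \<sigma>) * real n powr (1 - \<kappa>^2 - \<rho> - 6 * \<eta> / s - 21 * \<sigma>) = real n powr \<sigma>"
    by (simp add: powr_add[symmetric])
  ultimately show ?thesis by simp
qed

lemma Dg_le: "real Dg \<le> real n powr (1 - \<kappa>^2 + 3 * \<sigma>)" "1 + real Dg \<le> 3 * real n powr (1 - \<kappa>^2 + 2 * \<sigma>)"
proof -
  have a: "0 \<le> 1 - \<kappa>^2 + 2 * \<sigma>" using kap_sq sg by simp
  have D: "real Dg \<le> 2 * real n powr (1 - \<kappa>^2 + 2 * \<sigma>)" unfolding Dg_def by (rule ceiling_le_double[OF a])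
  also have "\<dots> \<le> real n powr (1 - \<kappa>^2 + 2 * \<sigma> + \<sigma>)" by (rule absorb) simp
  finally show "real Dg \<le> real n powr (1 - \<kappa>^2 + 3 * \<sigma>)" by (simp add: algebra_simps)
  have "real n powr 0 \<le> real n powr (1 - \<kappa>^2 + 2 * \<sigma>)" using a by (rule powr_le)
  thus "1 + real Dg \<le> 3 * real n powr (1 - \<kappa>^2 + 2 * \<sigma>)" using D n2 by simp
qed

text \<open>The product of tries, steps per try and degree. The exponents
  \<open>\<kappa>^2 + \<rho> - 1\<close> and \<open>1 - \<kappa>^2\<close> add up to
  \<open>\<rho>\<close>; the rest is error.\<close>

lemma time_le: "real (tries * (steps * (1 + Dg))) \<le> real n powr (\<rho> + 6 * \<eta> / s + 15 * \<eta> + 25 * \<sigma>)"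
proof -
  have e: "0 \<le> \<kappa>^2 + \<rho> - 1 + 6 * \<eta> / s + 22 * \<sigma>"
  proof -
    have "0 \<le> 6 * \<eta> / s" using eta s by simp
    thus ?thesis using rho_ge s(2) sg by linarith
  qed
  have "real (tries * (steps * (1 + Dg))) = real tries * (real steps * (1 + real Dg))"
    by (simp only: of_nat_mult of_nat_add of_nat_1)
  also have "\<dots> \<le> (2 * real n powr (\<kappa>^2 + \<rho> - 1 + 6 * \<eta> / s + 22 * \<sigma>)) * ((2 * real n powr (15 * \<eta>)) * (3 * real n powr (1 - \<kappa>^2 + 2 * \<sigma>)))"
  proof (rule mult_mono[OF _ mult_mono])
    show "real tries \<le> 2 * real n powr (\<kappa>^2 + \<rho> - 1 + 6 * \<eta> / s + 22 * \<sigma>)"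
      unfolding tries_def by (rule ceiling_le_double[OF e])
    show "real steps \<le> 2 * real n powr (15 * \<eta>)"
      unfolding steps_def using eta by (intro ceiling_le_double) simp
    show "1 + real Dg \<le> 3 * real n powr (1 - \<kappa>^2 + 2 * \<sigma>)" by (rule Dg_le)
  qed auto
  also have "\<dots> = 12 * real n powr (\<rho> + 6 * \<eta> / s + 15 * \<eta> + 24 * \<sigma>)" by (simp add: powr_add[symmetric] algebra_simps)
  also have "\<dots> \<le> real n powr (\<rho> + 6 * \<eta> / s + 15 * \<eta> + 24 * \<sigma> + \<sigma>)" by (rule absorb) simp
  finally show ?thesis by (simp add: algebra_simps)
qed

lemma space_le: "real n + real n * real Dg \<le> real n powr (2 - \<kappa>^2 + 3 * \<sigma>)"
proof -
  have "real n + real n * real Dg = real n * (1 + real Dg)" by (simp add: algebra_simps)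
  also have "\<dots> \<le> real n * (3 * real n powr (1 - \<kappa>^2 + 2 * \<sigma>))" using Dg_le(2) by (intro mult_left_mono) auto
  also have "\<dots> = 3 * real n powr (1 + (1 - \<kappa>^2 + 2 * \<sigma>))" by (simp only: n_pow[symmetric])
  also have "\<dots> \<le> real n powr (1 + (1 - \<kappa>^2 + 2 * \<sigma>) + \<sigma>)" by (rule absorb) simp
  finally show ?thesis by (simp add: algebra_simps)
qed

lemma insert_le: "2 * real n \<le> real n powr (1 + \<sigma>)"
  using absorb[of 2 1] n2 by simp

end

section \<open>The planted model\<close>

text \<open>Conditioning on the cap makes sense only if it has positive measure. The lower bound
  with \<open>t = (1 - g) / 2\<close> gives this, as the assumption on \<open>d\<close> makes each
  tail less than 1/4.\<close>

lemma cap_unif_prob: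
  assumes g: "0 < g" "g < 1" and d: "16 \<le> (1 - g)^2 * real d" and q: "ip d q q = 1"
  shows "prob_space (cap_unif d q g)"
    "AE x in cap_unif d q g. x \<in> space (Rd d) \<and> ip d x x = 1 \<and> g \<le> ip d x q"
proof -
  interpret prob_space "unif_sphere d" by (rule prob_space_unif_sphere)
  define t where "t = (1 - g) / 2"
  let ?A = "{x \<in> space (Rd d). g \<le> ip d x q}"
  have A: "?A \<in> events" by measurable
  have d0: "d > 0" using d by (cases d) auto
  have t: "0 \<le> t" "t \<le> 1/2" using g by (auto simp: t_def)
  have "t^2 \<le> (1/2)^2" using t by (intro power_mono) auto
  hence t2: "t^2 \<le> 1/2" by (simp add: power2_eq_square)
  have td: "4 \<le> t^2 * real d" using d by (simp add: t_def power_divide)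
  hence "exp (- (t^2 * real d / 2)) \<le> exp (- 2)" by simp
  also have "exp (- 2) < (1/4 :: real)"
  proof -
    have "(2::real) < exp 1" using exp_ge_one_plus_x_over_n_power_n[of 2 1] by (simp add: power2_eq_square)
    hence "(2::real)^2 < exp 1 ^ 2" by (intro power_strict_mono) auto
    also have "exp (1::real) ^ 2 = exp 2" by (simp add: power2_eq_square exp_add[symmetric])
    finally show ?thesis by (simp add: exp_minus field_simps)
  qed
  finally have e: "0 < 1/2 - 2 * exp (- (t^2 * real d / 2))" by simp
  let ?w = "\<lambda>i. (g + t) * q i"
  have gt: "g + t < 1" "0 \<le> g + t" using g by (auto simp: t_def field_simps)
  have ww: "ip d ?w ?w = (g + t)^2" unfolding ip_scale_left ip_scale_right q by (simp add: power2_eq_square)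
  have ww1: "ip d ?w ?w < 1" unfolding ww using gt by (simp add: abs_square_less_1)
  have wq: "ip d ?w q = g + t" unfolding ip_scale_left q by simp
  have "0 < (1/2 - 2 * exp (- (t^2 * real d / 2))) * sqrt (1 - ip d ?w ?w) ^ d"
    using e ww1 by (intro mult_pos_pos zero_less_power) auto
  also have "\<dots> \<le> prob {x \<in> space (Rd d). g \<le> ip d x q \<and> g \<le> ip d x q}"
    by (rule sphere_two_caps_lower[OF ww1 _ _ t(1) t2]) (use q g wq in auto)
  finally have pos: "0 < prob ?A" by simp
  hence "emeasure (unif_sphere d) ?A \<noteq> 0" by (simp add: emeasure_eq_measure)
  thus "prob_space (cap_unif d q g)"
    unfolding cap_unif_def by (intro prob_space_uniform_measure) auto
  have "AE x in unif_sphere d. ip d x x = 1"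
  proof (rule AE_I)
    show "{x \<in> space (unif_sphere d). \<not> ip d x x = 1} \<subseteq> {x \<in> space (Rd d). ip d x x \<noteq> 1}" by auto
    show "emeasure (unif_sphere d) {x \<in> space (Rd d). ip d x x \<noteq> 1} = 0"
      using AE_unif_sphere[OF d0] by (simp add: emeasure_eq_measure)
    show "{x \<in> space (Rd d). ip d x x \<noteq> 1} \<in> events" by measurable
  qed
  hence "AE x in unif_sphere d. x \<in> ?A \<longrightarrow> x \<in> space (Rd d) \<and> ip d x x = 1 \<and> g \<le> ip d x q" by eventually_elim auto
  thus "AE x in cap_unif d q g. x \<in> space (Rd d) \<and> ip d x x = 1 \<and> g \<le> ip d x q"
    unfolding cap_unif_def using A by (intro AE_uniform_measureI) auto
qed

text \<open>Fubini with the planted point outside: for almost every position \<open>x\<close> it may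
  be held fixed, and the bound is uniform in \<open>x\<close>.\<close>

lemma points_model_bound:
  assumes n: "0 < n" and cap: "prob_space (cap_unif d q g)"
    and AE: "AE x in cap_unif d q g. T x"
    and A: "{P \<in> space (points_model d n g q). B P} \<in> sets (points_model d n g q)"
    and bound: "\<And>x. T x \<Longrightarrow> emeasure (PiM {1..<n} (\<lambda>_. unif_sphere d))
        {\<xi> \<in> space (PiM {1..<n} (\<lambda>_. unif_sphere d)). B (\<xi>(0 := x))} \<le> e"
  shows "emeasure (points_model d n g q) {P \<in> space (points_model d n g q). B P} \<le> e"
proof -
  let ?M = "\<lambda>i::nat. if i = 0 then cap_unif d q g else unif_sphere d"
  let ?A = "{P \<in> space (points_model d n g q). B P}"
  interpret C: prob_space "cap_unif d q g" by (rule cap)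
  interpret product_sigma_finite ?M
    using cap prob_space_unif_sphere[of d]
    by (intro product_sigma_finite.intro) (auto intro: prob_space_imp_sigma_finite)
  have ins: "insert 0 {1..<n} = {..<n}" using n by auto
  have PiM_eq: "PiM {1..<n} ?M = PiM {1..<n} (\<lambda>_. unif_sphere d)" by (rule PiM_cong) auto
  have "emeasure (points_model d n g q) ?A = (\<integral>\<^sup>+ P. indicator ?A P \<partial>PiM (insert 0 {1..<n}) ?M)"
    unfolding ins using A by simp
  also have "\<dots> = (\<integral>\<^sup>+ x. \<integral>\<^sup>+ \<xi>. indicator ?A (\<xi>(0 := x)) \<partial>PiM {1..<n} ?M \<partial>?M 0)"
  proof (rule product_nn_integral_insert_rev)
    show "indicator ?A \<in> borel_measurable (PiM (insert 0 {1..<n}) ?M)" unfolding ins using A by simp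
  qed auto
  also have "\<dots> = (\<integral>\<^sup>+ x. \<integral>\<^sup>+ \<xi>. indicator ?A (\<xi>(0 := x)) \<partial>PiM {1..<n} (\<lambda>_. unif_sphere d) \<partial>cap_unif d q g)"
    unfolding PiM_eq by simp
  also have "\<dots> \<le> (\<integral>\<^sup>+ x. e \<partial>cap_unif d q g)"
  proof (rule nn_integral_mono_AE)
    show "AE x in cap_unif d q g. (\<integral>\<^sup>+ \<xi>. indicator ?A (\<xi>(0 := x)) \<partial>PiM {1..<n} (\<lambda>_. unif_sphere d)) \<le> e"
      using AE AE_space
    proof eventually_elim
      case (elim x)
      let ?P = "PiM {1..<n} (\<lambda>_. unif_sphere d)"
      have m: "(\<lambda>\<xi>. \<xi>(0 := x)) \<in> measurable ?P (points_model d n g q)"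
        using measurable_fun_upd[of "{..<n}" "{1..<n}" 0 "\<lambda>\<xi>. \<xi>" ?P ?M "\<lambda>_. x"] elim(2) ins PiM_eq by simp
      have sp: "\<xi>(0 := x) \<in> space (points_model d n g q)" if "\<xi> \<in> space ?P" for \<xi>
        using measurable_space[OF m that] .
      have "(\<integral>\<^sup>+ \<xi>. indicator ?A (\<xi>(0 := x)) \<partial>?P) = (\<integral>\<^sup>+ \<xi>. indicator {\<xi> \<in> space ?P. B (\<xi>(0 := x))} \<xi> \<partial>?P)"
        by (intro nn_integral_cong) (auto simp: indicator_def sp)
      also have "\<dots> = emeasure ?P {\<xi> \<in> space ?P. B (\<xi>(0 := x))}"
      proof (rule nn_integral_indicator)
        have "(\<lambda>\<xi>. \<xi>(0 := x)) -` ?A \<inter> space ?P = {\<xi> \<in> space ?P. B (\<xi>(0 := x))}" using sp by auto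
        thus "{\<xi> \<in> space ?P. B (\<xi>(0 := x))} \<in> sets ?P" using measurable_sets[OF m A] by simp
      qed
      also have "\<dots> \<le> e" by (rule bound[OF elim(1)])
      finally show ?case .
    qed
  qed
  also have "\<dots> = e" using C.emeasure_space_1 by simp
  finally show ?thesis .
qed

section \<open>Random restarts and the cost of a successful run\<close>

abbreviation starts_model :: "nat \<Rightarrow> (nat \<Rightarrow> nat) measure" where
  "starts_model n \<equiv> PiM UNIV (\<lambda>_::nat. measure_pmf (pmf_of_set {..<n}))"

text \<open>Sequences in the product space may leave \<open>{..<n}\<close>, but only on a null set,
  which is added to the failure event. The \<open>K\<close> draws miss \<open>B\<close>
  independently of each other.\<close>

lemma starts_miss:
  assumes n: "0 < n" and B: "B \<subseteq> {..<n}" "x \<le> real K * (real (card B) / real n)"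
  shows "emeasure (starts_model n) {S \<in> space (starts_model n). (\<exists>k\<in>{..<K}. n \<le> S k) \<or> (\<forall>k\<in>{..<K}. S k \<notin> B)} \<le> ennreal (exp (- x))"
proof -
  interpret product_prob_space "\<lambda>_::nat. measure_pmf (pmf_of_set {..<n})" UNIV ..
  let ?Y = "starts_model n"
  have ne: "{..<n} \<noteq> {}" using n by auto
  have m [measurable]: "(\<lambda>S. S k) \<in> measurable ?Y (count_space UNIV)" for k
    using measurable_component_singleton[of k UNIV "\<lambda>_. measure_pmf (pmf_of_set {..<n})"]
    by (simp cong: measurable_cong_sets)
  have pm: "emeasure (measure_pmf (pmf_of_set {..<n})) C = ennreal (real (card ({..<n} \<inter> C)) / real n)" for C
    by (simp add: measure_pmf.emeasure_eq_measure measure_pmf_of_set[OF ne])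
  have 1: "emeasure ?Y {S \<in> space ?Y. \<exists>k\<in>{..<K}. n \<le> S k} = 0"
  proof -
    have "AE S in ?Y. \<not> n \<le> S k" for k
    proof (rule AE_I)
      have "{..<n} \<inter> {n..} = {}" by auto
      hence "emeasure (measure_pmf (pmf_of_set {..<n})) {n..} = 0" by (simp add: pm)
      thus "emeasure ?Y {S \<in> space ?Y. S k \<in> {n..}} = 0" by (subst emeasure_PiM_Collect_single) auto
    qed (auto intro: measurable_sets)
    hence "AE S in ?Y. \<forall>k\<in>{..<K}. \<not> n \<le> S k" by (intro AE_finite_allI) auto
    hence "AE S in ?Y. \<not> (\<exists>k\<in>{..<K}. n \<le> S k)" by eventually_elim blast
    thus ?thesis by (subst (asm) AE_iff_measurable[OF _ refl]) (auto simp: not_not)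
  qed
  have "emeasure ?Y {S \<in> space ?Y. \<forall>k\<in>{..<K}. S k \<in> - B} = (\<Prod>k\<in>{..<K}. emeasure (measure_pmf (pmf_of_set {..<n})) (- B))"
    by (rule emeasure_PiM_Collect) auto
  also have "\<dots> = ennreal ((1 - real (card B) / real n) ^ K)"
  proof -
    have "{..<n} \<inter> - B = {..<n} - B" by auto
    hence "card ({..<n} \<inter> - B) = n - card B" using B card_Diff_subset[of B "{..<n}"] finite_subset[OF B(1)] by simp
    moreover have "card B \<le> n" using card_mono[OF _ B(1)] by simp
    ultimately have "emeasure (measure_pmf (pmf_of_set {..<n})) (- B) = ennreal (1 - real (card B) / real n)"
      using n by (simp add: pm of_nat_diff diff_divide_distrib)
    moreover have "0 \<le> 1 - real (card B) / real n" using \<open>card B \<le> n\<close> n by simp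
    ultimately show ?thesis by (simp add: ennreal_power)
  qed
  also have "\<dots> \<le> ennreal (exp (- x))"
  proof (rule ennreal_leI, rule power_one_minus_le_exp)
    have "card B \<le> n" using card_mono[OF _ B(1)] by simp
    thus "real (card B) / real n \<le> 1" using n by simp
    show "x \<le> real (card B) / real n * real K" using B(2) by (simp add: mult.commute)
  qed
  finally have 2: "emeasure ?Y {S \<in> space ?Y. \<forall>k\<in>{..<K}. S k \<in> - B} \<le> ennreal (exp (- x))" .
  let ?U = "{S \<in> space ?Y. \<exists>k\<in>{..<K}. n \<le> S k}" and ?V = "{S \<in> space ?Y. \<forall>k\<in>{..<K}. S k \<in> - B}"
  have eq: "{S \<in> space ?Y. (\<exists>k\<in>{..<K}. n \<le> S k) \<or> (\<forall>k\<in>{..<K}. S k \<notin> B)} = ?U \<union> ?V" by auto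
  have UV: "?U \<in> sets ?Y" "?V \<in> sets ?Y" by measurable
  show ?thesis unfolding eq
    using order_trans[OF emeasure_subadditive[OF UV] add_mono[OF eq_refl[OF 1] 2]] by (simp only: add_0)
qed

abbreviation hits :: "nat \<Rightarrow> real \<Rightarrow> real \<Rightarrow> nat \<Rightarrow> (nat \<Rightarrow> nat \<Rightarrow> real) \<Rightarrow> (nat \<Rightarrow> real) \<Rightarrow> nat set" where
  "hits d \<alpha> g n P q \<equiv> {i \<in> {..<n}. fst (walk d \<alpha> g n P q n i) \<noteq> None}"

lemma pred_well_behaved:
  "Measurable.pred (points_model d n g' q) (\<lambda>P. well_behaved d \<alpha> g n q D C G P)"
proof -
  interpret random_points "points_model d n g' q" "\<lambda>P. P" d n by (rule random_points_model)
  have "card (hits d \<alpha> g n P q) = (\<Sum>i\<in>{..<n}. if fst (walk d \<alpha> g n P q n i) \<noteq> None then 1 else 0)" for P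
    by (subst sum.inter_filter[symmetric]) simp_all
  thus ?thesis unfolding well_behaved_def by simp
qed

text \<open>Integration over the starts for fixed points: a badly behaved configuration contributes
  at most 1 beyond the exponential term, any other at most the probability that all \<open>K\<close>
  starts miss its successful vertices.\<close>

lemma starts_fail_bound:
  assumes n: "0 < n" and cap: "prob_space (cap_unif d q g')"
    and W: "emeasure (points_model d n g' q) {P \<in> space (points_model d n g' q). \<not> well_behaved d \<alpha> g n q D C G P} \<le> ennreal p"
    and p: "0 \<le> p" and x: "x \<le> real K * (G / real n)"
  shows "emeasure (points_model d n g' q \<Otimes>\<^sub>M starts_model n)
      {w \<in> space (points_model d n g' q \<Otimes>\<^sub>M starts_model n). \<not> well_behaved d \<alpha> g n q D C G (fst w)
        \<or> (\<exists>k\<in>{..<K}. n \<le> snd w k) \<or> (\<forall>k\<in>{..<K}. snd w k \<notin> hits d \<alpha> g n (fst w) q)} \<le> ennreal (p + exp (- x))"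
    "{w \<in> space (points_model d n g' q \<Otimes>\<^sub>M starts_model n). \<not> well_behaved d \<alpha> g n q D C G (fst w)
        \<or> (\<exists>k\<in>{..<K}. n \<le> snd w k) \<or> (\<forall>k\<in>{..<K}. snd w k \<notin> hits d \<alpha> g n (fst w) q)}
      \<in> sets (points_model d n g' q \<Otimes>\<^sub>M starts_model n)"
proof -
  let ?X = "points_model d n g' q" and ?Y = "starts_model n"
  let ?A = "{w \<in> space (?X \<Otimes>\<^sub>M ?Y). \<not> well_behaved d \<alpha> g n q D C G (fst w)
        \<or> (\<exists>k\<in>{..<K}. n \<le> snd w k) \<or> (\<forall>k\<in>{..<K}. snd w k \<notin> hits d \<alpha> g n (fst w) q)}"
  interpret X: prob_space ?X using cap prob_space_unif_sphere by (intro prob_space_PiM) auto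
  interpret Y: prob_space ?Y by (intro prob_space_PiM measure_pmf.prob_space_axioms)
  interpret random_points "?X \<Otimes>\<^sub>M ?Y" fst d n
    by (rule random_points_compose[where h = fst and P = "\<lambda>P. P", OF random_points_model measurable_fst])
  have mS: "(\<lambda>w. snd w k) \<in> measurable (?X \<Otimes>\<^sub>M ?Y) (count_space UNIV)" for k
    using measurable_compose[OF measurable_snd measurable_component_singleton[of k UNIV "\<lambda>_. measure_pmf (pmf_of_set {..<n})"], of ?X]
    by (simp cong: measurable_cong_sets)
  have pw: "Measurable.pred (?X \<Otimes>\<^sub>M ?Y) (\<lambda>w. well_behaved d \<alpha> g n q D C G (fst w))"
    by (rule measurable_compose[OF measurable_fst pred_well_behaved])
  have mW: "(\<lambda>w. walk d \<alpha> g n (fst w) q n (snd w k)) \<in> measurable (?X \<Otimes>\<^sub>M ?Y) (count_space UNIV)" for k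
    by (rule measurable_compose_countable[OF measurable_walk mS])
  have h: "Measurable.pred (?X \<Otimes>\<^sub>M ?Y) (\<lambda>w. snd w k \<notin> hits d \<alpha> g n (fst w) q)" for k
  proof -
    have "snd w k \<notin> hits d \<alpha> g n (fst w) q \<longleftrightarrow> \<not> (snd w k < n \<and> fst (walk d \<alpha> g n (fst w) q n (snd w k)) \<noteq> None)" for w
      by auto
    moreover have "Measurable.pred (?X \<Otimes>\<^sub>M ?Y) (\<lambda>w. \<not> (snd w k < n \<and> fst (walk d \<alpha> g n (fst w) q n (snd w k)) \<noteq> None))"
    proof (rule pred_intros_logic(2), rule pred_intros_logic(3))
      show "Measurable.pred (?X \<Otimes>\<^sub>M ?Y) (\<lambda>w. snd w k < n)" by (rule measurable_compose[OF mS]) simp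
      show "Measurable.pred (?X \<Otimes>\<^sub>M ?Y) (\<lambda>w. fst (walk d \<alpha> g n (fst w) q n (snd w k)) \<noteq> None)"
        by (rule measurable_compose[OF mW]) simp
    qed
    ultimately show ?thesis by (simp only:)
  qed
  have h': "Measurable.pred (?X \<Otimes>\<^sub>M ?Y) (\<lambda>w. n \<le> snd w k)" for k by (rule measurable_compose[OF mS]) simp
  have h0: "Measurable.pred (?X \<Otimes>\<^sub>M ?Y) (\<lambda>w. \<not> well_behaved d \<alpha> g n q D C G (fst w))"
    by (intro pred_intros_logic(2) pw)
  have "Measurable.pred (?X \<Otimes>\<^sub>M ?Y) (\<lambda>w. \<not> well_behaved d \<alpha> g n q D C G (fst w)
        \<or> (\<exists>k\<in>{..<K}. n \<le> snd w k) \<or> (\<forall>k\<in>{..<K}. snd w k \<notin> hits d \<alpha> g n (fst w) q))"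
    by (intro pred_intros_logic(5) pred_intros_finite h h' h0) auto
  thus A: "?A \<in> sets (?X \<Otimes>\<^sub>M ?Y)" by (simp only: pred_def)
  have Wm: "{P \<in> space ?X. \<not> well_behaved d \<alpha> g n q D C G P} \<in> sets ?X"
    using pred_intros_logic(2)[OF pred_well_behaved] by (simp add: pred_def)
  have "emeasure (?X \<Otimes>\<^sub>M ?Y) ?A = (\<integral>\<^sup>+ P. emeasure ?Y (Pair P -` ?A) \<partial>?X)"
    by (rule Y.emeasure_pair_measure_alt[OF A])
  also have "\<dots> \<le> (\<integral>\<^sup>+ P. indicator {P \<in> space ?X. \<not> well_behaved d \<alpha> g n q D C G P} P + ennreal (exp (- x)) \<partial>?X)"
  proof (rule nn_integral_mono)
    fix P assume P: "P \<in> space ?X"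
    show "emeasure ?Y (Pair P -` ?A) \<le> indicator {P \<in> space ?X. \<not> well_behaved d \<alpha> g n q D C G P} P + ennreal (exp (- x))"
    proof (cases "well_behaved d \<alpha> g n q D C G P")
      case False
      hence one: "indicator {P \<in> space ?X. \<not> well_behaved d \<alpha> g n q D C G P} P = (1 :: ennreal)" using P by simp
      show ?thesis unfolding one by (rule add_increasing2[OF zero_le Y.emeasure_le_1])
    next
      case True
      have "Pair P -` ?A = {S \<in> space ?Y. (\<exists>k\<in>{..<K}. n \<le> S k) \<or> (\<forall>k\<in>{..<K}. S k \<notin> hits d \<alpha> g n P q)}"
        using P True by (auto simp: space_pair_measure)
      also have "emeasure ?Y \<dots> \<le> ennreal (exp (- x))"
      proof (rule starts_miss[OF n])
        have "G \<le> real (card (hits d \<alpha> g n P q))" using True by (simp add: well_behaved_def)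
        hence "real K * (G / real n) \<le> real K * (real (card (hits d \<alpha> g n P q)) / real n)"
          by (intro mult_left_mono divide_right_mono) auto
        thus "x \<le> real K * (real (card (hits d \<alpha> g n P q)) / real n)" using x by linarith
      qed auto
      finally show ?thesis by (rule add_increasing[OF zero_le])
    qed
  qed
  also have "\<dots> = emeasure ?X {P \<in> space ?X. \<not> well_behaved d \<alpha> g n q D C G P} + ennreal (exp (- x))"
    using Wm by (subst nn_integral_add) (auto simp: X.emeasure_space_1)
  also have "\<dots> \<le> ennreal p + ennreal (exp (- x))" using W by (rule add_right_mono)
  also have "\<dots> = ennreal (p + exp (- x))" using p by (simp add: ennreal_plus)
  finally show "emeasure (?X \<Otimes>\<^sub>M ?Y) ?A \<le> ennreal (p + exp (- x))" .
qed

text \<open>The first successful iteration comes no later than \<open>k\<close>, and every iteration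
  up to it has a valid start and hence cost at most \<open>C\<close>. A successful walk ends at
  height at least \<open>g\<close>, which only vertex 0 has.\<close>

lemma good_run:
  assumes W: "well_behaved d \<alpha> g n q D C G P"
    and S: "\<forall>k<K. S k < n" and hit: "k < K" "S k \<in> hits d \<alpha> g n P q"
  shows "query_ok d \<alpha> g n P q S" "query_result d \<alpha> g n P q S = Some 0" "query_time d \<alpha> g n P q S \<le> K * C"
    "space_cost d \<alpha> n P \<le> n + n * D" "\<And>i. i < n \<Longrightarrow> delete_cost d \<alpha> n P i \<le> D"
proof -
  have ok: "fst (iter d \<alpha> g n P q S k) \<noteq> None" using hit by (simp add: iter_def)
  thus "query_ok d \<alpha> g n P q S" by (auto simp: query_ok_def)
  define t where "t = query_iters d \<alpha> g n P q S"
  have tk: "t \<le> k" unfolding t_def query_iters_def using ok by (rule Least_le)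
  have "fst (iter d \<alpha> g n P q S t) \<noteq> None" unfolding t_def query_iters_def using ok by (rule LeastI)
  then obtain j where j: "fst (walk d \<alpha> g n P q n (S t)) = Some j" by (auto simp: iter_def)
  have "S t < n" using S tk hit(1) by simp
  hence "j < n" "g \<le> ip d (P j) q" using walk_result[OF j] by auto
  moreover have "ip d (P j) q < g" if "j \<noteq> 0" using W that \<open>j < n\<close> by (auto simp: well_behaved_def)
  ultimately have "j = 0" by force
  thus "query_result d \<alpha> g n P q S = Some 0" using j by (simp add: query_result_def t_def[symmetric] iter_def)
  have "query_time d \<alpha> g n P q S = (\<Sum>i\<le>t. snd (walk d \<alpha> g n P q n (S i)))"
    by (simp add: query_time_def t_def[symmetric] iter_def)
  also have "\<dots> \<le> (\<Sum>i\<le>t. C)"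
    using S tk hit(1) W by (intro sum_mono) (auto simp: well_behaved_def)
  also have "\<dots> = Suc t * C" by simp
  also have "\<dots> \<le> K * C" using tk hit(1) by (intro mult_right_mono) auto
  finally show "query_time d \<alpha> g n P q S \<le> K * C" .
  have deg: "card (nbrs d \<alpha> n P i) \<le> D" if "i < n" for i using W that by (simp add: well_behaved_def)
  thus "\<And>i. i < n \<Longrightarrow> delete_cost d \<alpha> n P i \<le> D" by (simp add: delete_cost_def)
  have "(\<Sum>i<n. card (nbrs d \<alpha> n P i)) \<le> (\<Sum>i<n. D)" using deg by (intro sum_mono) simp
  thus "space_cost d \<alpha> n P \<le> n + n * D" by (simp add: space_cost_def)
qed

lemma insert_cost_le: "insert_cost d \<alpha> n P z \<le> 2 * n"
proof -
  have "card {j. j < n \<and> \<alpha> \<le> ip d z (P j)} \<le> card {..<n}" by (intro card_mono) auto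
  thus ?thesis by (simp add: insert_cost_def)
qed

section \<open>From a fixed error to a vanishing error\<close>

lemma exp_powr_eventually_small:
  assumes "0 < (a :: real)"
  shows "eventually (\<lambda>x::real. x^2 * exp (- (x powr a / 4)) \<le> x powr (- a)) at_top"
  using assms by real_asymp

lemma good_event_likely:
  assumes S: "\<And>x0. x0 \<in> space (Rd d) \<Longrightarrow> ip d x0 x0 = 1 \<Longrightarrow> \<gamma> \<le> ip d x0 q \<Longrightarrow> search d n \<sigma> \<mu> q x0 \<kappa> s \<gamma> \<eta> L"
    and q: "q \<in> sphere_d d" and gam: "0 < \<gamma>" "\<gamma> < 1" and d: "16 \<le> (1 - \<gamma>)^2 * real d"
    and e: "6 * \<eta> / s + 15 * \<eta> + 25 * \<sigma> \<le> e" and rho: "\<rho> = (1 - 2 * \<gamma> * \<kappa> * s) / (1 - \<gamma>^2)"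
  shows "1 - 8 * real n powr (- \<sigma>) \<le> measure (nn_model d n \<gamma> q) (good_event d n (\<kappa> * \<mu>) \<gamma> q \<rho> \<kappa> e)"
proof -
  have q1: "q \<in> space (Rd d)" "ip d q q = 1" using q by (auto simp: sphere_d_def)
  \<comment> \<open>The query itself is an admissible position of the planted point. This instance
    gives access to \<open>Dg\<close>, \<open>steps\<close>, \<open>threshold\<close> and
    \<open>tries\<close>, whose values do not depend on that position.\<close>
  interpret Q: search d n \<sigma> \<mu> q q \<kappa> s \<gamma> \<eta> L using q1 gam by (intro S) auto
  have rho': "Q.\<rho> = \<rho>" by (simp add: Q.\<rho>_def rho)
  define C where "C = Q.steps * (1 + Q.Dg)"
  define G where "G = Q.threshold"
  define K where "K = Q.tries"
  let ?W = "well_behaved d (\<kappa> * \<mu>) \<gamma> n q Q.Dg C G"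
  let ?X = "points_model d n \<gamma> q" and ?Y = "starts_model n"
  have n0: "0 < n" using Q.n2 by simp
  note cap = cap_unif_prob[OF gam d q1(2)]
  let ?p = "7 * real n powr (- \<sigma>)"
  have "emeasure ?X {P \<in> space ?X. \<not> ?W P} \<le> ennreal ?p"
  proof (rule points_model_bound[OF n0 cap])
    show "{P \<in> space ?X. \<not> ?W P} \<in> sets ?X"
      using pred_intros_logic(2)[OF pred_well_behaved] by (simp add: pred_def)
    fix x assume x: "x \<in> space (Rd d) \<and> ip d x x = 1 \<and> \<gamma> \<le> ip d x q"
    interpret X: search d n \<sigma> \<mu> q x \<kappa> s \<gamma> \<eta> L using x by (intro S) auto
    obtain E where E: "X.rare E ?p" "\<And>\<xi>. \<not> E \<xi> \<Longrightarrow> ?W (\<xi>(0 := x))"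
      using X.well_behaved_likely unfolding C_def G_def by blast
    have "emeasure X.\<Omega> {\<xi> \<in> space X.\<Omega>. \<not> ?W (\<xi>(0 := x))} \<le> emeasure X.\<Omega> {\<xi> \<in> space X.\<Omega>. E \<xi>}"
      using E by (intro emeasure_mono) (auto simp: X.rare_def)
    also have "\<dots> \<le> ennreal ?p" using E(1) by (simp add: X.rare_def Q.Om.emeasure_eq_measure)
    finally show "emeasure (PiM {1..<n} (\<lambda>_. unif_sphere d)) {\<xi> \<in> space (PiM {1..<n} (\<lambda>_. unif_sphere d)). \<not> ?W (\<xi>(0 := x))} \<le> ennreal ?p"
      unfolding X.\<Omega>_def .
  qed
  note fail = starts_fail_bound[OF n0 cap(1) this _ Q.tries_threshold[folded G_def K_def]]
  let ?F = "{w \<in> space (?X \<Otimes>\<^sub>M ?Y). \<not> ?W (fst w)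
      \<or> (\<exists>k\<in>{..<K}. n \<le> snd w k) \<or> (\<forall>k\<in>{..<K}. snd w k \<notin> hits d (\<kappa> * \<mu>) \<gamma> n (fst w) q)}"
  have Fs: "?F \<in> sets (?X \<Otimes>\<^sub>M ?Y)" by (rule fail(2)) simp
  have "emeasure (?X \<Otimes>\<^sub>M ?Y) ?F \<le> ennreal (?p + exp (- (real n powr \<sigma>)))" by (rule fail(1)) simp
  also have "\<dots> \<le> ennreal (8 * real n powr (- \<sigma>))"
  proof (rule ennreal_leI)
    have "exp (- (real n powr \<sigma>)) \<le> exp (- (real n powr \<sigma> / 4))" by simp
    thus "?p + exp (- (real n powr \<sigma>)) \<le> 8 * real n powr (- \<sigma>)" using Q.exp_small(2) by linarith
  qed
  finally have Fb: "emeasure (?X \<Otimes>\<^sub>M ?Y) ?F \<le> ennreal (8 * real n powr (- \<sigma>))" .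
  let ?M = "nn_model d n \<gamma> q"
  let ?G = "good_event d n (\<kappa> * \<mu>) \<gamma> q \<rho> \<kappa> e"
  have ME: "?M = (?X \<Otimes>\<^sub>M ?Y) \<Otimes>\<^sub>M unif_sphere d" by (simp add: nn_model_def)
  interpret Xp: prob_space ?X using cap(1) prob_space_unif_sphere by (intro prob_space_PiM) auto
  interpret Yp: prob_space ?Y by (intro prob_space_PiM measure_pmf.prob_space_axioms)
  interpret XY: pair_prob_space ?X ?Y ..
  interpret Z: prob_space "unif_sphere d" by (rule prob_space_unif_sphere)
  interpret XYZ: pair_prob_space "?X \<Otimes>\<^sub>M ?Y" "unif_sphere d" ..
  have Mp: "prob_space ?M" unfolding ME by (rule XYZ.prob_space_axioms)
  interpret M: prob_space ?M by (rule Mp)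
  have N1: "1 \<le> real n" using n0 by simp
  have up: "real n powr a \<le> real n powr b" if "a \<le> b" for a b using that N1 by (intro powr_mono) auto
  have pos: "0 \<le> 6 * \<eta> / s" "0 \<le> \<eta>" "0 \<le> \<sigma>" using Q.eta Q.s Q.sg by auto
  have "space ?M - ?G \<subseteq> ?F \<times> space (unif_sphere d)"
  proof
    fix w assume w: "w \<in> space ?M - ?G"
    obtain P St z where wz: "w = ((P, St), z)" by (metis surj_pair)
    have sp: "(P, St) \<in> space (?X \<Otimes>\<^sub>M ?Y)" "z \<in> space (unif_sphere d)"
      using w unfolding wz ME by (auto simp: space_pair_measure)
    have "(P, St) \<in> ?F"
    proof (rule ccontr)
      assume "(P, St) \<notin> ?F"
      hence ok: "?W P" "\<forall>k<K. St k < n" "\<exists>k<K. St k \<in> hits d (\<kappa> * \<mu>) \<gamma> n P q"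
        using sp(1) by (auto simp: not_le)
      then obtain k where k: "k < K" "St k \<in> hits d (\<kappa> * \<mu>) \<gamma> n P q" by blast
      note run = good_run[where P = P and S = St, OF ok(1,2) k]
      have "real (query_time d (\<kappa> * \<mu>) \<gamma> n P q St) \<le> real (K * C)" using run(3) by (simp only: of_nat_le_iff)
      also have "\<dots> \<le> real n powr (\<rho> + 6 * \<eta> / s + 15 * \<eta> + 25 * \<sigma>)" using Q.time_le unfolding K_def C_def rho' .
      also have "\<dots> \<le> real n powr (\<rho> + e)" using e by (intro up) simp
      finally have time: "real (query_time d (\<kappa> * \<mu>) \<gamma> n P q St) \<le> real n powr (\<rho> + e)" .
      have "real (space_cost d (\<kappa> * \<mu>) n P) \<le> real (n + n * Q.Dg)" using run(4) by (simp only: of_nat_le_iff)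
      also have "\<dots> \<le> real n powr (2 - \<kappa>^2 + 3 * \<sigma>)" using Q.space_le by simp
      also have "\<dots> \<le> real n powr (2 - \<kappa>^2 + e)" using e pos by (intro up) linarith
      finally have space: "real (space_cost d (\<kappa> * \<mu>) n P) \<le> real n powr (2 - \<kappa>^2 + e)" .
      have "real (insert_cost d (\<kappa> * \<mu>) n P z) \<le> real (2 * n)" using insert_cost_le by (simp only: of_nat_le_iff)
      also have "\<dots> \<le> real n powr (1 + \<sigma>)" using Q.insert_le by simp
      also have "\<dots> \<le> real n powr (1 + e)" using e pos by (intro up) linarith
      finally have insert: "real (insert_cost d (\<kappa> * \<mu>) n P z) \<le> real n powr (1 + e)" .
      have delete: "real (delete_cost d (\<kappa> * \<mu>) n P i) \<le> real n powr (1 - \<kappa>^2 + e)" if "i < n" for i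
      proof -
        have "real (delete_cost d (\<kappa> * \<mu>) n P i) \<le> real Q.Dg" using run(5)[OF that] by simp
        also have "\<dots> \<le> real n powr (1 - \<kappa>^2 + 3 * \<sigma>)" by (rule Q.Dg_le)
        also have "\<dots> \<le> real n powr (1 - \<kappa>^2 + e)" using e pos by (intro up) linarith
        finally show ?thesis .
      qed
      have "w \<in> ?G" using w run(1,2) time space insert delete unfolding good_event_def wz by simp
      thus False using w by simp
    qed
    thus "w \<in> ?F \<times> space (unif_sphere d)" using sp wz by simp
  qed
  hence "emeasure ?M (space ?M - ?G) \<le> emeasure ?M (?F \<times> space (unif_sphere d))"
    unfolding ME by (intro emeasure_mono) (use Fs in auto)
  also have "\<dots> = emeasure (?X \<Otimes>\<^sub>M ?Y) ?F * emeasure (unif_sphere d) (space (unif_sphere d))"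
    unfolding ME by (rule sigma_finite_measure.emeasure_pair_measure_Times[OF prob_space_imp_sigma_finite[OF prob_space_unif_sphere]]) (use Fs in auto)
  also have "\<dots> = emeasure (?X \<Otimes>\<^sub>M ?Y) ?F" by (simp only: prob_space.emeasure_space_1[OF prob_space_unif_sphere] mult_1_right)
  also note Fb
  finally have "measure ?M (space ?M - ?G) \<le> 8 * real n powr (- \<sigma>)" by (simp add: M.emeasure_eq_measure)
  thus ?thesis using M.prob_compl[OF good_event_sets, of "\<kappa> * \<mu>" \<rho> \<kappa> e] by simp
qed

text \<open>The infimum of the positive valid errors at \<open>d\<close> tends to 0. It need not be
  attained, so \<open>\<epsilon> d\<close> is a valid error within \<open>1 / Suc d\<close> of it;
  the error 1 keeps the set of valid errors nonempty for every \<open>d\<close>.\<close>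

lemma vanishing_sequence:
  fixes Q :: "nat \<Rightarrow> real \<Rightarrow> bool"
  assumes ev: "\<And>e. 0 < e \<Longrightarrow> eventually (\<lambda>d. Q d e) sequentially" and one: "\<And>d. Q d 1"
  shows "\<exists>\<epsilon>. \<epsilon> \<longlonglongrightarrow> 0 \<and> (\<forall>d. Q d (\<epsilon> d))"
proof -
  define A where "A d = {e. 0 < e \<and> Q d e}" for d
  have A1: "1 \<in> A d" for d using one by (simp add: A_def)
  have bdd: "bdd_below (A d)" for d by (rule bdd_belowI[of _ 0]) (auto simp: A_def)
  have "\<exists>e\<in>A d. e < Inf (A d) + 1 / real (Suc d)" for d
    using cInf_lessD[of "A d" "Inf (A d) + 1 / real (Suc d)"] A1[of d] by (auto simp: field_simps)
  then obtain \<epsilon> where eps: "\<And>d. \<epsilon> d \<in> A d" "\<And>d. \<epsilon> d < Inf (A d) + 1 / real (Suc d)" by metis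
  have "\<epsilon> \<longlonglongrightarrow> 0"
  proof (rule order_tendstoI)
    fix a :: real assume "a < 0"
    have "a < \<epsilon> d" for d using eps(1)[of d] \<open>a < 0\<close> by (simp add: A_def)
    thus "eventually (\<lambda>d. a < \<epsilon> d) sequentially" by simp
  next
    fix a :: real assume a: "0 < a"
    have half: "eventually (\<lambda>d. Q d (a / 2)) sequentially" using ev a by simp
    have "eventually (\<lambda>d. 1 / real (Suc d) < a / 2) sequentially"
      using order_tendstoD(2)[OF LIMSEQ_inverse_real_of_nat, of "a / 2"] a by (simp add: inverse_eq_divide)
    thus "eventually (\<lambda>d. \<epsilon> d < a) sequentially" using half
    proof (eventually_elim)
      case (elim d)
      hence "Inf (A d) \<le> a / 2" using a by (intro cInf_lower bdd) (simp add: A_def)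
      thus ?case using eps(2)[of d] elim by simp
    qed
  qed
  thus ?thesis using eps(1) by (auto simp: A_def)
qed

theorem theorem9:
  fixes c \<kappa> \<gamma> :: real and n :: "nat \<Rightarrow> nat" and \<mu> \<alpha> :: "nat \<Rightarrow> real"
  assumes c: "c > 1"
    and gamma: "\<gamma> = 1 - 1 / c^2"
    and kappa: "sqrt (\<gamma>^2 / (1 + \<gamma>^2)) < \<kappa>" "\<kappa> < 1"
    and n_infty: "filterlim (\<lambda>d. real (n d)) at_top sequentially"
    and n_subexp: "(\<lambda>d. ln (real (n d)) / real d) \<longlonglongrightarrow> 0"
    and mu: "\<And>d. \<mu> d = sqrt (1 - real (n d) powr (- 2 / real d))"
    and alpha: "\<And>d. \<alpha> d = \<kappa> * \<mu> d"
  shows "let \<rho>q = (1 - 2 * \<gamma> * sqrt (\<kappa>^2 * (1 - \<kappa>^2))) / (1 - \<gamma>^2);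
             \<rho>s = 1 - \<kappa>^2
         in (\<exists>\<epsilon> \<delta> :: nat \<Rightarrow> real. \<epsilon> \<longlonglongrightarrow> 0 \<and> \<delta> \<longlonglongrightarrow> 0 \<and>
               (\<forall>d. \<forall>q \<in> sphere_d d.
                  1 - \<delta> d \<le> measure (nn_model d (n d) \<gamma> q)
                                (good_event d (n d) (\<alpha> d) \<gamma> q \<rho>q \<kappa> (\<epsilon> d))))
            \<and> (2 * c^2 - 1) * \<rho>q + 2 * c^2 * (c^2 - 1) * sqrt (\<rho>s * (1 - \<rho>s)) \<ge> c^4"
proof -
  have c2: "1 < c^2" using c by (simp add: one_less_power)
  have "0 < 1 / c^2" "1 / c^2 < 1" using c c2 by (simp_all add: divide_less_eq)
  hence gam: "0 < \<gamma>" "\<gamma> < 1" by (auto simp: gamma)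
  have "0 \<le> sqrt (\<gamma>^2 / (1 + \<gamma>^2))" by simp
  hence kap: "0 < \<kappa>" using kappa(1) by linarith
  have kap2: "\<kappa>^2 < 1" using kap kappa(2) by (simp add: power_less_one_iff)
  define s where "s = sqrt (1 - \<kappa>^2)"
  have s: "0 < s" "s^2 = 1 - \<kappa>^2" using kap2 by (auto simp: s_def)
  have s1: "s \<le> 1" by (simp add: s_def)
  define \<rho> where "\<rho> = (1 - 2 * \<gamma> * \<kappa> * s) / (1 - \<gamma>^2)"
  have root: "sqrt (\<kappa>^2 * (1 - \<kappa>^2)) = \<kappa> * s" using kap by (simp add: real_sqrt_mult s_def)
  have rho: "(1 - 2 * \<gamma> * sqrt (\<kappa>^2 * (1 - \<kappa>^2))) / (1 - \<gamma>^2) = \<rho>" by (simp add: root \<rho>_def mult.assoc)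
  \<comment> \<open>One parameter plays the roles of both error sequences; for \<open>e = 1\<close>
    the probability bound is trivial.\<close>
  define Q where "Q d e \<longleftrightarrow> (\<forall>q \<in> sphere_d d. 1 - e \<le> measure (nn_model d (n d) \<gamma> q)
                                (good_event d (n d) (\<alpha> d) \<gamma> q \<rho> \<kappa> e))" for d e
  have one: "Q d 1" for d by (simp add: Q_def)
  have "eventually (\<lambda>d. Q d e) sequentially" if e: "0 < e" for e
  proof -
    \<comment> \<open>The bound \<open>e * s / 23\<close> makes the total exponent error
      \<open>6 * \<eta> / s + 15 * \<eta> + 25 * \<sigma>\<close> at most \<open>e\<close>, since
      \<open>21 * \<sigma> \<le> \<eta>\<close> and \<open>s \<le> 1\<close>. The bound with 7
      guarantees \<open>rho_gap\<close>.\<close>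
    define \<eta> where "\<eta> = min (min (s / 4) (1 / 10)) (min (e * s / 23) (if \<rho> < 1 then s * (1 - \<rho>) / 7 else 1))"
    define \<sigma> where "\<sigma> = min (min \<gamma> (\<kappa> * \<eta>)) (s * \<eta> / 21)"
    define L where "L = nat \<lceil>2 / \<eta>\<rceil>"
    have eta: "0 < \<eta>" "4 * \<eta> \<le> s" "10 * \<eta> \<le> 1" "23 * \<eta> \<le> e * s"
      using s e by (auto simp: \<eta>_def)
    have eta_rho: "7 * \<eta> \<le> s * (1 - \<rho>)" if "\<rho> < 1" using that by (simp add: \<eta>_def)
    have sg: "0 < \<sigma>" "\<sigma> \<le> \<gamma>" "\<sigma> \<le> \<kappa> * \<eta>" "21 * \<sigma> \<le> s * \<eta>"
      using gam kap eta s by (auto simp: \<sigma>_def)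
    have se: "s * \<eta> \<le> \<eta>" using s1 eta s by (simp add: mult_left_le_one_le)
    have sg_eta: "21 * \<sigma> \<le> \<eta>" using sg(4) se by linarith
    have L: "2 \<le> \<eta> * real L"
    proof -
      have "2 / \<eta> \<le> real L" unfolding L_def by (rule real_nat_ceiling_ge)
      thus ?thesis using eta by (simp add: field_simps)
    qed
    have es: "\<eta> \<le> \<eta> / s" using eta s s1 by (simp add: field_simps)
    have ee: "6 * \<eta> / s + 15 * \<eta> + 25 * \<sigma> \<le> e"
    proof -
      have "23 * (\<eta> / s) \<le> e" using eta(4) s by (simp add: field_simps)
      thus ?thesis using es sg_eta eta by simp
    qed
    have gap: "\<rho> + 6 * \<eta> / s + 8 * \<sigma> \<le> 1" if r: "\<rho> < 1"
    proof -
      have "7 * (\<eta> / s) \<le> 1 - \<rho>" using eta_rho[OF r] s by (simp add: field_simps)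
      thus ?thesis using es sg_eta eta by simp
    qed
    have N: "eventually (\<lambda>d. P (real (n d))) sequentially" if "eventually P at_top" for P
      using that n_infty by (rule eventually_compose_filterlim)
    have "eventually (\<lambda>x::real. 24 \<le> \<sigma>^2 * ln x) at_top" using sg by real_asymp
    note e1 = N[OF this]
    have "eventually (\<lambda>x::real. 2 \<le> x) at_top" by (rule eventually_ge_at_top)
    note e2 = N[OF this]
    have "eventually (\<lambda>x::real. 16 / \<eta> \<le> x powr (2 * \<eta>)) at_top" using eta by real_asymp
    note e3 = N[OF this]
    have "eventually (\<lambda>x::real. 5 * real L \<le> x powr \<eta>) at_top" using eta by real_asymp
    note e4 = N[OF this]
    note e5 = N[OF exp_powr_eventually_small[OF sg(1)]]
    have "eventually (\<lambda>x::real. 8 * x powr (- \<sigma>) \<le> e) at_top" using sg e by real_asymp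
    note e6 = N[OF this]
    have e7: "eventually (\<lambda>d. ln (real (n d)) / real d < \<sigma>^2 / 3200) sequentially"
      using sg by (intro order_tendstoD(2)[OF n_subexp]) simp
    have "0 < (1 - \<gamma>)^2" using gam by simp
    hence e8: "eventually (\<lambda>d. 16 \<le> (1 - \<gamma>)^2 * real d) sequentially" by real_asymp
    show ?thesis using e1 e2 e3 e4 e5 e6 e7 e8 eventually_gt_at_top[of 0]
    proof eventually_elim
      case (elim d)
      have S: "search d (n d) \<sigma> (\<mu> d) q x0 \<kappa> s \<gamma> \<eta> L"
        if "ip d q q = 1" "x0 \<in> space (Rd d)" "ip d x0 x0 = 1" "\<gamma> \<le> ip d x0 q" for q x0
      proof
        show "3200 * ln (real (n d)) \<le> \<sigma>^2 * real d" using elim by (simp add: field_simps)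
        show "(1 - 2 * \<gamma> * \<kappa> * s) / (1 - \<gamma>^2) + 6 * \<eta> / s + 8 * \<sigma> \<le> 1" if "(1 - 2 * \<gamma> * \<kappa> * s) / (1 - \<gamma>^2) < 1"
          using gap that unfolding \<rho>_def by blast
        show "\<sigma> \<le> 1/2" using sg_eta eta by linarith
      qed (use elim that sg eta s L kap kappa gam mu in auto)
      show ?case unfolding Q_def
      proof
        fix q assume q: "q \<in> sphere_d d"
        hence "ip d q q = 1" by (simp add: sphere_d_def)
        hence "1 - 8 * real (n d) powr (- \<sigma>) \<le> measure (nn_model d (n d) \<gamma> q) (good_event d (n d) (\<kappa> * \<mu> d) \<gamma> q \<rho> \<kappa> e)"
          using elim by (intro good_event_likely[OF S q gam _ ee \<rho>_def]) auto
        thus "1 - e \<le> measure (nn_model d (n d) \<gamma> q) (good_event d (n d) (\<alpha> d) \<gamma> q \<rho> \<kappa> e)"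
          using elim unfolding alpha by linarith
      qed
    qed
  qed
  hence "\<exists>\<epsilon>. \<epsilon> \<longlonglongrightarrow> 0 \<and> (\<forall>d. Q d (\<epsilon> d))" by (rule vanishing_sequence[where Q = Q, OF _ one])
  hence "\<exists>\<epsilon> \<delta> :: nat \<Rightarrow> real. \<epsilon> \<longlonglongrightarrow> 0 \<and> \<delta> \<longlonglongrightarrow> 0 \<and>
               (\<forall>d. \<forall>q \<in> sphere_d d. 1 - \<delta> d \<le> measure (nn_model d (n d) \<gamma> q)
                                (good_event d (n d) (\<alpha> d) \<gamma> q \<rho> \<kappa> (\<epsilon> d)))"
    unfolding Q_def by blast
  \<comment> \<open>The tradeoff holds with equality: \<open>c^2 * \<gamma> = c^2 - 1\<close> and
    \<open>c^4 * (1 - \<gamma>^2) = 2 * c^2 - 1\<close>, so the two terms containing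
    \<open>\<kappa> * s\<close> cancel.\<close>
  moreover have "c^4 \<le> (2 * c^2 - 1) * \<rho> + 2 * c^2 * (c^2 - 1) * sqrt ((1 - \<kappa>^2) * (1 - (1 - \<kappa>^2)))"
  proof -
    have r: "sqrt ((1 - \<kappa>^2) * (1 - (1 - \<kappa>^2))) = \<kappa> * s" using root by (simp add: mult.commute)
    have g: "c^2 * \<gamma> = c^2 - 1" using c by (simp add: gamma algebra_simps)
    have g2: "c^4 * (1 - \<gamma>^2) = 2 * c^2 - 1"
    proof -
      have "c^4 * (1 - \<gamma>^2) = (c^2)^2 - (c^2 * \<gamma>)^2" by algebra
      thus ?thesis unfolding g by (simp add: power2_eq_square algebra_simps)
    qed
    have "\<gamma>^2 < 1" using gam by (simp add: power_less_one_iff)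
    hence gp: "1 - \<gamma>^2 \<noteq> 0" by simp
    have "(2 * c^2 - 1) * \<rho> = c^4 * (1 - 2 * \<gamma> * \<kappa> * s)" unfolding g2[symmetric] \<rho>_def using gp by simp
    moreover have "2 * c^2 * (c^2 - 1) * (\<kappa> * s) = c^4 * (2 * \<gamma> * \<kappa> * s)" unfolding g[symmetric] by algebra
    ultimately have "(2 * c^2 - 1) * \<rho> + 2 * c^2 * (c^2 - 1) * (\<kappa> * s) = c^4" by (simp add: algebra_simps)
    thus ?thesis unfolding r by simp
  qed
  ultimately show ?thesis unfolding Let_def rho by blast
qed

end
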